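(* Let $H$ be a semisimple and cosemisimple Hopf algebra over a field $\Bbbk$ and let $B$ be a bialgebra in the braided category ${}_H^H\mathcal{YD}$. Then, for every $n\in\mathbb{N}_0$, $$\mathrm{Z}^n_{\mathcal{YD}}(B,\Bbbk)=\mathrm{Z}^n(B,\Bbbk)^{D(H)},\qquad \mathrm{B}^n_{\mathcal{YD}}(B,\Bbbk)=\mathrm{B}^n(B,\Bbbk)^{D(H)},\qquad \mathrm{H}^n_{\mathcal{YD}}(B,\Bbbk)\cong\mathrm{H}^n(B,\Bbbk)^{D(H)},$$ where $\mathrm{Z}^n(B,\Bbbk)$ and $\mathrm{B}^n(B,\Bbbk)$ are regarded as $D(H)$-subbimodules of $\mathrm{Hom}_\Bbbk(B^{\otimes n},\Bbbk)$, whose structure is induced by the left $D(H)$-module structures of its arguments. Moreover $\mathrm{H}^n(B,\Bbbk)^{D(H)}$ is a subspace of $\mathrm{H}^n(B,\Bbbk)^H$.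
   Context: ${}_H^H\mathcal{YD}$ is the category of left-left Yetter-Drinfeld modules over $H$: left $H$-modules and left $H$-comodules $V$ (coaction $v\mapsto v_{-1}\otimes v_0$) with $(h_1v)_{-1}h_2\otimes(h_1v)_0=h_1v_{-1}\otimes h_2v_0$, monoidal with diagonal action and codiagonal coaction, unit $\Bbbk$ with trivial structures, and braiding $c_{V,W}(v\otimes w)=v_{-1}w\otimes v_0$. $D(H)$ is the Drinfeld double of the (finite-dimensional) Hopf algebra $H$, realized on $H^*\otimes H$ so that there is a monoidal category isomorphism ${}_H^H\mathcal{YD}\cong{}_{D(H)}\mathfrak{M}$ (left $D(H)$-modules) under which $V\in{}_H^H\mathcal{YD}$ has the action $(f\otimes h)\rhd v=f\big((hv)_{-1}\big)(hv)_0$. $H$ is a Hopf subalgebra of $D(H)$ via $h\mapsto\varepsilon_H\otimes h$. $\Bbbk$ is a $B$-bimodule via the counit $\varepsilon_B$. $\mathrm{Z}^n(B,\Bbbk)$, $\mathrm{B}^n(B,\Bbbk)$, $\mathrm{H}^n(B,\Bbbk)$ are the cocycles, coboundaries and cohomology of the ordinary Hochschild complex $\mathrm{Hom}_\Bbbk(B^{\otimes n},\Bbbk)$, $n\ge0$, of the algebra $B$. $\mathrm{Z}^n_{\mathcal{YD}}(B,\Bbbk)$, $\mathrm{B}^n_{\mathcal{YD}}(B,\Bbbk)$, $\mathrm{H}^n_{\mathcal{YD}}(B,\Bbbk)$ are the cocycles, coboundaries and cohomology of the subcomplex ${}_H^H\mathcal{YD}(B^{\otimes n},\Bbbk)$ of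 morphisms in ${}_H^H\mathcal{YD}$ (with zero coboundaries in degree $0$). For $K=H$ or $K=D(H)$, $\mathrm{Hom}_\Bbbk(B^{\otimes n},\Bbbk)$ is a $K$-bimodule with right action $(fd)(z)=f(dz)$, $d\in K$, $z\in B^{\otimes n}$ (using the left $K$-module structure of $B^{\otimes n}$) and left action through the counit $\varepsilon_K$; this induces $K$-bimodule structures on $\mathrm{Z}^n(B,\Bbbk)$, $\mathrm{B}^n(B,\Bbbk)$ and $\mathrm{H}^n(B,\Bbbk)$. For a $K$-bimodule $X$, $X^K=\{x\in X\mid dx=xd\text{ for all }d\in K\}$. *)

theory Defs
  imports Complex_Main "HOL-Library.Function_Algebras" "HOL-Library.Set_Algebras"
begin

section \<open>Vector spaces and tensor products over a field\<close>

text \<open>A vector space is a subspace of an ambient type that is itself a vector space; this gives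
  a uniform treatment of the given spaces, of tensor products and of spaces of linear maps.\<close>

record ('k, 'v) vecsp =
  carrier :: "'v set"
  smul :: "'k \<Rightarrow> 'v \<Rightarrow> 'v"

definition vecsp :: "('k::field, 'v::ab_group_add, 'z) vecsp_scheme \<Rightarrow> bool" where
  "vecsp V \<longleftrightarrow> vector_space (smul V) \<and> module.subspace (smul V) (carrier V)"

definition ground :: "('k::field, 'k) vecsp" where
  "ground = \<lparr>carrier = UNIV, smul = (*)\<rparr>"

definition lin_map ::
  "('k::field, 'v::ab_group_add, 'y) vecsp_scheme \<Rightarrow> ('k, 'w::ab_group_add, 'z) vecsp_scheme
    \<Rightarrow> ('v \<Rightarrow> 'w) \<Rightarrow> bool" where
  "lin_map V W f \<longleftrightarrow>
     (\<forall>x\<in>carrier V. f x \<in> carrier W) \<and>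
     (\<forall>x\<in>carrier V. \<forall>y\<in>carrier V. f (x + y) = f x + f y) \<and>
     (\<forall>c. \<forall>x\<in>carrier V. f (smul V c x) = smul W c (f x))"

definition bilin_map ::
  "('k::field, 'v::ab_group_add, 'x) vecsp_scheme \<Rightarrow> ('k, 'w::ab_group_add, 'y) vecsp_scheme
    \<Rightarrow> ('k, 'u::ab_group_add, 'z) vecsp_scheme \<Rightarrow> ('v \<times> 'w \<Rightarrow> 'u) \<Rightarrow> bool" where
  "bilin_map V W U g \<longleftrightarrow>
     (\<forall>v\<in>carrier V. lin_map W U (\<lambda>w. g (v, w))) \<and>
     (\<forall>w\<in>carrier W. lin_map V U (\<lambda>v. g (v, w)))"

definition words :: "('k, 'v, 'z) vecsp_scheme \<Rightarrow> nat \<Rightarrow> 'v list set" where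
  "words V n = {vs. length vs = n \<and> set vs \<subseteq> carrier V}"

text \<open>\<open>n\<close>-linear maps, the arguments being given as a list of length \<open>n\<close>.\<close>

definition multilin_map ::
  "('k::field, 'v::ab_group_add, 'y) vecsp_scheme \<Rightarrow> nat
    \<Rightarrow> ('k, 'u::ab_group_add, 'z) vecsp_scheme \<Rightarrow> ('v list \<Rightarrow> 'u) \<Rightarrow> bool" where
  "multilin_map V n U g \<longleftrightarrow>
     (\<forall>vs\<in>words V n. g vs \<in> carrier U) \<and>
     (\<forall>i<n. \<forall>vs\<in>words V n. lin_map V U (\<lambda>v. g (vs[i := v])))"

definition fscale :: "'k::field \<Rightarrow> ('x \<Rightarrow> 'k) \<Rightarrow> 'x \<Rightarrow> 'k" where
  "fscale c f = (\<lambda>x. c * f x)"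

text \<open>A tensor \<open>\<Sum>\<^sub>i v\<^sub>i \<otimes> w\<^sub>i\<close> is represented by the functional
  \<open>\<beta> \<mapsto> \<Sum>\<^sub>i \<beta> (v\<^sub>i, w\<^sub>i)\<close> on bilinear forms (and by \<open>0\<close> on all other functions \<open>\<beta>\<close>), and
  similarly for \<open>n\<close>-fold tensors and \<open>n\<close>-linear forms.  Over a field multilinear forms separate
  the elements of the tensor product, so this is a model of it; the universal
  property is proved below.  \<open>F\<close> is the set of forms and \<open>W\<close> the set of tuples.\<close>

type_synonym ('k, 'w) tens = "('w \<Rightarrow> 'k) \<Rightarrow> 'k"

definition pure_tens :: "('w \<Rightarrow> 'k::field) set \<Rightarrow> 'w \<Rightarrow> ('k, 'w) tens" where
  "pure_tens F w = (\<lambda>\<beta>. if \<beta> \<in> F then \<beta> w else 0)"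

definition tens_space :: "('w \<Rightarrow> 'k::field) set \<Rightarrow> 'w set \<Rightarrow> ('k, ('k, 'w) tens) vecsp" where
  "tens_space F W = \<lparr>carrier = module.span fscale (pure_tens F ` W), smul = fscale\<rparr>"

text \<open>The linear map on the tensor product induced by a multilinear map \<open>g\<close>; only its values on
  the tensor product are specified.\<close>

definition tens_lift ::
  "('w \<Rightarrow> 'k::field) set \<Rightarrow> 'w set \<Rightarrow> ('k, 'u::ab_group_add, 'z) vecsp_scheme \<Rightarrow> ('w \<Rightarrow> 'u)
    \<Rightarrow> ('k, 'w) tens \<Rightarrow> 'u" where
  "tens_lift F W U g =
     (SOME L. lin_map (tens_space F W) U L \<and> (\<forall>w\<in>W. L (pure_tens F w) = g w))"

definition bilin_forms ::
  "('k::field, 'v::ab_group_add, 'y) vecsp_scheme \<Rightarrow> ('k, 'w::ab_group_add, 'z) vecsp_scheme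
    \<Rightarrow> ('v \<times> 'w \<Rightarrow> 'k) set" where
  "bilin_forms V W = {\<beta>. bilin_map V W ground \<beta>}"

definition tensor ::
  "('k::field, 'v::ab_group_add, 'y) vecsp_scheme \<Rightarrow> ('k, 'w::ab_group_add, 'z) vecsp_scheme
    \<Rightarrow> ('k, ('k, 'v \<times> 'w) tens) vecsp" where
  "tensor V W = tens_space (bilin_forms V W) (carrier V \<times> carrier W)"

definition tens ::
  "('k::field, 'v::ab_group_add, 'y) vecsp_scheme \<Rightarrow> ('k, 'w::ab_group_add, 'z) vecsp_scheme
    \<Rightarrow> 'v \<Rightarrow> 'w \<Rightarrow> ('k, 'v \<times> 'w) tens" where
  "tens V W v w = pure_tens (bilin_forms V W) (v, w)"

text \<open>\<open>tlift V W U (\<lambda>(x, y). g x y) t\<close> is the sum written \<open>g t\<^sub>1 t\<^sub>2\<close> in Sweedler notation.\<close>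

definition tlift ::
  "('k::field, 'v::ab_group_add, 'x) vecsp_scheme \<Rightarrow> ('k, 'w::ab_group_add, 'y) vecsp_scheme
    \<Rightarrow> ('k, 'u::ab_group_add, 'z) vecsp_scheme \<Rightarrow> ('v \<times> 'w \<Rightarrow> 'u) \<Rightarrow> ('k, 'v \<times> 'w) tens \<Rightarrow> 'u"
  where
  "tlift V W U = tens_lift (bilin_forms V W) (carrier V \<times> carrier W) U"

definition multilin_forms ::
  "('k::field, 'v::ab_group_add, 'z) vecsp_scheme \<Rightarrow> nat \<Rightarrow> ('v list \<Rightarrow> 'k) set" where
  "multilin_forms V n = {\<beta>. multilin_map V n ground \<beta>}"

definition tpow ::
  "('k::field, 'v::ab_group_add, 'z) vecsp_scheme \<Rightarrow> nat \<Rightarrow> ('k, ('k, 'v list) tens) vecsp" where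
  "tpow V n = tens_space (multilin_forms V n) (words V n)"

definition wtens ::
  "('k::field, 'v::ab_group_add, 'z) vecsp_scheme \<Rightarrow> nat \<Rightarrow> 'v list \<Rightarrow> ('k, 'v list) tens" where
  "wtens V n vs = pure_tens (multilin_forms V n) vs"

definition wlift ::
  "('k::field, 'v::ab_group_add, 'y) vecsp_scheme \<Rightarrow> nat
    \<Rightarrow> ('k, 'u::ab_group_add, 'z) vecsp_scheme \<Rightarrow> ('v list \<Rightarrow> 'u) \<Rightarrow> ('k, 'v list) tens \<Rightarrow> 'u"
  where
  "wlift V n U = tens_lift (multilin_forms V n) (words V n) U"

text \<open>Linear forms on \<open>V\<close> are extended by \<open>0\<close> outside the carrier, so that equal forms are equal
  functions.\<close>

definition restr :: "('k, 'v, 'z) vecsp_scheme \<Rightarrow> ('v \<Rightarrow> 'k::zero) \<Rightarrow> 'v \<Rightarrow> 'k" where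
  "restr V f = (\<lambda>x. if x \<in> carrier V then f x else 0)"

definition dual :: "('k::field, 'v::ab_group_add, 'z) vecsp_scheme \<Rightarrow> ('k, 'v \<Rightarrow> 'k) vecsp" where
  "dual V = \<lparr>carrier = {f. lin_map V ground f \<and> (\<forall>x. x \<notin> carrier V \<longrightarrow> f x = 0)},
             smul = fscale\<rparr>"

subsection \<open>The universal property\<close>

lemma vector_space_ground: "vector_space ((*) :: 'k::field \<Rightarrow> 'k \<Rightarrow> 'k)"
  by unfold_locales (auto simp: algebra_simps)

lemma vector_space_fscale: "vector_space (fscale :: 'k::field \<Rightarrow> ('x \<Rightarrow> 'k) \<Rightarrow> 'x \<Rightarrow> 'k)"
  by unfold_locales (auto simp: fscale_def fun_eq_iff algebra_simps)

lemma functionals_separate: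
  fixes s :: "'k::field \<Rightarrow> 'u::ab_group_add \<Rightarrow> 'u"
  assumes s: "vector_space s"
    and eq: "\<And>\<phi>. Vector_Spaces.linear s (*) \<phi> \<Longrightarrow> \<phi> x = \<phi> y"
  shows "x = y"
proof (rule ccontr)
  assume "x \<noteq> y"
  then have nz: "x - y \<noteq> 0" by simp
  interpret p: vector_space_pair s "(*) :: 'k \<Rightarrow> 'k \<Rightarrow> 'k"
    by (intro vector_space_pair.intro s vector_space_ground)
  have ind: "p.vs1.independent {x - y}" using nz by (simp add: p.vs1.dependent_single)
  let ?\<phi> = "p.construct {x - y} (\<lambda>_. 1 :: 'k)"
  have lin: "Vector_Spaces.linear s (*) ?\<phi>" by (rule p.linear_construct[OF ind])
  have "?\<phi> (x - y) = 1" by (rule p.construct_basis[OF ind]) simp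
  moreover have "?\<phi> (x - y) = ?\<phi> x - ?\<phi> y"
    using p.linear_diff[OF lin] by simp
  ultimately show False using eq[OF lin] by simp
qed

lemma tens_lift_exists:
  assumes U: "vecsp U" and gW: "\<And>w. w \<in> W \<Longrightarrow> g w \<in> carrier U"
    and gF: "\<And>\<phi>. Vector_Spaces.linear (smul U) (*) \<phi> \<Longrightarrow> (\<lambda>w. \<phi> (g w)) \<in> F"
  shows "\<exists>L. lin_map (tens_space F W) U L \<and> (\<forall>w\<in>W. L (pure_tens F w) = g w)"
proof -
  have vU: "vector_space (smul U)" and sU: "module.subspace (smul U) (carrier U)"
    using U by (auto simp: vecsp_def)
  interpret p: vector_space_pair fscale "smul U"
    by (intro vector_space_pair.intro vector_space_fscale vU)
  let ?S = "pure_tens F ` W"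
  obtain A where A: "A \<subseteq> ?S" "p.vs1.independent A" "?S \<subseteq> p.vs1.span A"
    by (rule p.vs1.maximal_independent_subset)
  have "\<forall>a\<in>A. \<exists>w\<in>W. a = pure_tens F w" using A(1) by auto
  then obtain wt where wt: "\<And>a. a \<in> A \<Longrightarrow> wt a \<in> W \<and> a = pure_tens F (wt a)" by metis
  define L where "L = p.construct A (\<lambda>a. g (wt a))"
  have lin: "Vector_Spaces.linear fscale (smul U) L"
    unfolding L_def by (rule p.linear_construct[OF A(2)])
  have LA: "L a = g (wt a)" if "a \<in> A" for a
    unfolding L_def by (rule p.construct_basis[OF A(2) that])
  have key: "\<phi> (L t) = t (\<lambda>w. \<phi> (g w))"
    if \<phi>: "Vector_Spaces.linear (smul U) (*) \<phi>" and t: "t \<in> p.vs1.span A" for \<phi> t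
    using t
  proof (induction rule: p.vs1.span_induct_alt)
    case base
    have "L 0 = 0" "\<phi> 0 = 0"
      by (rule module_hom.zero[OF lin[unfolded linear_iff_module_hom]])
        (rule module_hom.zero[OF \<phi>[unfolded linear_iff_module_hom]])
    then show ?case by (simp add: zero_fun_def)
  next
    case (step c a t)
    have "\<phi> (L (fscale c a + t)) = c * \<phi> (L a) + \<phi> (L t)"
      using \<phi> lin by (simp add: linear_iff_module_hom module_hom.add module_hom.scale)
    also have "\<phi> (L a) = a (\<lambda>w. \<phi> (g w))"
    proof -
      have "a (\<lambda>w. \<phi> (g w)) = pure_tens F (wt a) (\<lambda>w. \<phi> (g w))"
        by (rule fun_cong[OF conjunct2[OF wt[OF step.hyps(1)]]])
      also have "\<dots> = \<phi> (g (wt a))" using gF[OF \<phi>] by (simp add: pure_tens_def)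
      finally show ?thesis using LA[OF step.hyps(1)] by simp
    qed
    finally show ?case using step.IH by (simp add: fscale_def)
  qed
  have Lw: "L (pure_tens F w) = g w" if w: "w \<in> W" for w
  proof (rule functionals_separate[OF vU])
    fix \<phi> assume \<phi>: "Vector_Spaces.linear (smul U) (*) \<phi>"
    show "\<phi> (L (pure_tens F w)) = \<phi> (g w)"
      using key[OF \<phi>, of "pure_tens F w"] A(3) w gF[OF \<phi>] by (auto simp: pure_tens_def)
  qed
  have "L t \<in> carrier U" if "t \<in> p.vs1.span ?S" for t
    using that
  proof (induction rule: p.vs1.span_induct_alt)
    case base
    have "L 0 = 0"
      by (rule module_hom.zero[OF lin[unfolded linear_iff_module_hom]])
    then show ?case using p.vs2.subspace_0[OF sU] by (simp only:)
  next
    case (step c a t)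
    then obtain w where w: "w \<in> W" "a = pure_tens F w" by auto
    have "L (fscale c a + t) = smul U c (g w) + L t"
      using lin Lw[OF w(1)] w(2)
      by (simp add: linear_iff_module_hom module_hom.add module_hom.scale)
    then show ?case
      using gW[OF w(1)] step.IH sU
      by (simp add: p.vs2.subspace_add p.vs2.subspace_scale del: plus_fun_apply)
  qed
  then have "lin_map (tens_space F W) U L"
    using lin
    by (simp add: lin_map_def tens_space_def linear_iff_module_hom module_hom.add module_hom.scale)
  with Lw show ?thesis by blast
qed

lemma tens_lift:
  assumes "vecsp U" "\<And>w. w \<in> W \<Longrightarrow> g w \<in> carrier U"
    and "\<And>\<phi>. Vector_Spaces.linear (smul U) (*) \<phi> \<Longrightarrow> (\<lambda>w. \<phi> (g w)) \<in> F"
  shows "lin_map (tens_space F W) U (tens_lift F W U g)"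
    and "w \<in> W \<Longrightarrow> tens_lift F W U g (pure_tens F w) = g w"
proof -
  have "\<exists>L. lin_map (tens_space F W) U L \<and> (\<forall>w\<in>W. L (pure_tens F w) = g w)"
    by (rule tens_lift_exists) (fact assms)+
  from someI_ex[OF this] show "lin_map (tens_space F W) U (tens_lift F W U g)"
    and "w \<in> W \<Longrightarrow> tens_lift F W U g (pure_tens F w) = g w"
    unfolding tens_lift_def by blast+
qed

lemma tens_space_ext:
  assumes U: "vecsp U" and L: "lin_map (tens_space F W) U L" "lin_map (tens_space F W) U L'"
    and eq: "\<And>w. w \<in> W \<Longrightarrow> L (pure_tens F w) = L' (pure_tens F w)"
    and t: "t \<in> carrier (tens_space F W)"
  shows "L t = L' t"
proof -
  interpret V: vector_space fscale by (rule vector_space_fscale)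
  interpret U: vector_space "smul U" using U by (simp add: vecsp_def)
  let ?S = "pure_tens F ` W"
  have hom: "M (fscale c a + t) = smul U c (M a) + M t"
    if "lin_map (tens_space F W) U M" "a \<in> V.span ?S" "t \<in> V.span ?S" for M c a t
    using that by (simp add: lin_map_def tens_space_def V.span_scale)
  have zero: "M 0 = 0" if "lin_map (tens_space F W) U M" for M
    using hom[OF that V.span_zero V.span_zero, of "-1"] by simp
  have "t \<in> V.span ?S \<and> L t = L' t"
    using t unfolding tens_space_def vecsp.simps
  proof (induction rule: V.span_induct_alt)
    case base
    show ?case by (simp only: zero[OF L(1)] zero[OF L(2)] V.span_zero simp_thms)
  next
    case (step c a t)
    then have "a \<in> V.span ?S" by (simp add: V.span_base)
    then show ?case
      using step eq hom[OF L(1), of a t c] hom[OF L(2), of a t c]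
      by (auto simp: V.span_add V.span_scale simp del: plus_fun_apply)
  qed
  then show ?thesis by simp
qed

lemma linear_comp_lin_map:
  assumes "Vector_Spaces.linear (smul U) (*) \<phi>" "lin_map V U f"
  shows "lin_map V ground (\<lambda>v. \<phi> (f v))"
  using assms by (auto simp: lin_map_def ground_def linear_iff_module_hom module_hom.add module_hom.scale)

proposition tensor_universal:
  assumes U: "vecsp U" and g: "bilin_map V W U g"
  shows "lin_map (tensor V W) U (tlift V W U g)"
    and "v \<in> carrier V \<Longrightarrow> w \<in> carrier W \<Longrightarrow> tlift V W U g (tens V W v w) = g (v, w)"
    and "lin_map (tensor V W) U L \<Longrightarrow>
      (\<And>v w. v \<in> carrier V \<Longrightarrow> w \<in> carrier W \<Longrightarrow> L (tens V W v w) = g (v, w)) \<Longrightarrow>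
      t \<in> carrier (tensor V W) \<Longrightarrow> L t = tlift V W U g t"
proof -
  have gW: "g x \<in> carrier U" if "x \<in> carrier V \<times> carrier W" for x
    using g that unfolding bilin_map_def lin_map_def by force
  have gF: "(\<lambda>x. \<phi> (g x)) \<in> bilin_forms V W" if \<phi>: "Vector_Spaces.linear (smul U) (*) \<phi>" for \<phi>
    using g unfolding bilin_forms_def bilin_map_def
    by (intro CollectI conjI ballI linear_comp_lin_map[OF \<phi>]) (elim conjE bspec, assumption)+
  show 1: "lin_map (tensor V W) U (tlift V W U g)"
    unfolding tensor_def tlift_def by (rule tens_lift(1)[OF U], fact gW, fact gF)
  have 2: "tlift V W U g (tens V W v w) = g (v, w)" if "v \<in> carrier V" "w \<in> carrier W" for v w
    unfolding tens_def tlift_def by (rule tens_lift(2)[OF U], fact gW, fact gF) (use that in simp)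
  then show "v \<in> carrier V \<Longrightarrow> w \<in> carrier W \<Longrightarrow> tlift V W U g (tens V W v w) = g (v, w)" .
  assume L: "lin_map (tensor V W) U L" and t: "t \<in> carrier (tensor V W)"
    and eq: "\<And>v w. v \<in> carrier V \<Longrightarrow> w \<in> carrier W \<Longrightarrow> L (tens V W v w) = g (v, w)"
  show "L t = tlift V W U g t"
  proof (rule tens_space_ext[OF U L[unfolded tensor_def] 1[unfolded tensor_def]
        _ t[unfolded tensor_def]])
    fix x assume "x \<in> carrier V \<times> carrier W"
    then show "L (pure_tens (bilin_forms V W) x) = tlift V W U g (pure_tens (bilin_forms V W) x)"
      using eq 2 unfolding tens_def by (cases x) simp
  qed
qed

proposition tpow_universal:
  assumes U: "vecsp U" and g: "multilin_map V n U g"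
  shows "lin_map (tpow V n) U (wlift V n U g)"
    and "vs \<in> words V n \<Longrightarrow> wlift V n U g (wtens V n vs) = g vs"
    and "lin_map (tpow V n) U L \<Longrightarrow> (\<And>vs. vs \<in> words V n \<Longrightarrow> L (wtens V n vs) = g vs) \<Longrightarrow>
      t \<in> carrier (tpow V n) \<Longrightarrow> L t = wlift V n U g t"
proof -
  have gW: "g x \<in> carrier U" if "x \<in> words V n" for x
    using g that unfolding multilin_map_def by blast
  have gF: "(\<lambda>x. \<phi> (g x)) \<in> multilin_forms V n" if \<phi>: "Vector_Spaces.linear (smul U) (*) \<phi>" for \<phi>
  proof -
    have "lin_map V ground (\<lambda>v. \<phi> (g (vs[i := v])))" if "i < n" "vs \<in> words V n" for i vs
      using linear_comp_lin_map[OF \<phi>, of V "\<lambda>v. g (vs[i := v])"] g that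
      unfolding multilin_map_def by blast
    then show ?thesis unfolding multilin_forms_def multilin_map_def by (simp add: ground_def)
  qed
  show 1: "lin_map (tpow V n) U (wlift V n U g)"
    unfolding tpow_def wlift_def by (rule tens_lift(1)[OF U], fact gW, fact gF)
  have 2: "wlift V n U g (wtens V n vs) = g vs" if "vs \<in> words V n" for vs
    unfolding wtens_def wlift_def by (rule tens_lift(2)[OF U], fact gW, fact gF, fact that)
  then show "vs \<in> words V n \<Longrightarrow> wlift V n U g (wtens V n vs) = g vs" .
  assume L: "lin_map (tpow V n) U L" and t: "t \<in> carrier (tpow V n)"
    and eq: "\<And>vs. vs \<in> words V n \<Longrightarrow> L (wtens V n vs) = g vs"
  show "L t = wlift V n U g t"
    by (rule tens_space_ext[OF U L[unfolded tpow_def] 1[unfolded tpow_def]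
          _ t[unfolded tpow_def]])
      (use eq 2 in \<open>simp add: wtens_def\<close>)
qed


section \<open>Algebras, coalgebras and Hopf algebras\<close>

record ('k, 'v) alg = "('k, 'v) vecsp" +
  mul :: "'v \<Rightarrow> 'v \<Rightarrow> 'v"
  unt :: 'v

record ('k, 'v) aug_alg = "('k, 'v) alg" +
  counit :: "'v \<Rightarrow> 'k"

record ('k, 'v) bialg = "('k, 'v) aug_alg" +
  comul :: "'v \<Rightarrow> ('k, 'v \<times> 'v) tens"

record ('k, 'v) hopf = "('k, 'v) bialg" +
  antipode :: "'v \<Rightarrow> 'v"

definition algebra :: "('k::field, 'v::ab_group_add, 'z) alg_scheme \<Rightarrow> bool" where
  "algebra A \<longleftrightarrow> vecsp A \<and>
     bilin_map A A A (\<lambda>(x, y). mul A x y) \<and> unt A \<in> carrier A \<and>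
     (\<forall>x\<in>carrier A. mul A (unt A) x = x \<and> mul A x (unt A) = x) \<and>
     (\<forall>x\<in>carrier A. \<forall>y\<in>carrier A. \<forall>z\<in>carrier A.
        mul A (mul A x y) z = mul A x (mul A y z))"

definition coalgebra :: "('k::field, 'v::ab_group_add, 'z) bialg_scheme \<Rightarrow> bool" where
  "coalgebra C \<longleftrightarrow> vecsp C \<and>
     lin_map C (tensor C C) (comul C) \<and> lin_map C ground (counit C) \<and>
     (\<forall>c\<in>carrier C.
        tlift C C (tensor C (tensor C C))
          (\<lambda>(x, y). tlift C C (tensor C (tensor C C))
             (\<lambda>(x\<^sub>1, x\<^sub>2). tens C (tensor C C) x\<^sub>1 (tens C C x\<^sub>2 y)) (comul C x)) (comul C c) =
        tlift C C (tensor C (tensor C C))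
          (\<lambda>(x, y). tens C (tensor C C) x (comul C y)) (comul C c)) \<and>
     (\<forall>c\<in>carrier C.
        tlift C C C (\<lambda>(x, y). smul C (counit C x) y) (comul C c) = c \<and>
        tlift C C C (\<lambda>(x, y). smul C (counit C y) x) (comul C c) = c)"

definition hopf_algebra :: "('k::field, 'v::ab_group_add, 'z) hopf_scheme \<Rightarrow> bool" where
  "hopf_algebra H \<longleftrightarrow> algebra H \<and> coalgebra H \<and>
     (\<forall>g\<in>carrier H. \<forall>h\<in>carrier H.
        comul H (mul H g h) =
        tlift H H (tensor H H) (\<lambda>(g\<^sub>1, g\<^sub>2). tlift H H (tensor H H)
          (\<lambda>(h\<^sub>1, h\<^sub>2). tens H H (mul H g\<^sub>1 h\<^sub>1) (mul H g\<^sub>2 h\<^sub>2)) (comul H h)) (comul H g)) \<and>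
     comul H (unt H) = tens H H (unt H) (unt H) \<and>
     (\<forall>g\<in>carrier H. \<forall>h\<in>carrier H. counit H (mul H g h) = counit H g * counit H h) \<and>
     counit H (unt H) = 1 \<and>
     lin_map H H (antipode H) \<and>
     (\<forall>h\<in>carrier H.
        tlift H H H (\<lambda>(x, y). mul H (antipode H x) y) (comul H h) = smul H (counit H h) (unt H) \<and>
        tlift H H H (\<lambda>(x, y). mul H x (antipode H y)) (comul H h) = smul H (counit H h) (unt H))"

definition left_ideal :: "('k::field, 'v::ab_group_add, 'z) alg_scheme \<Rightarrow> 'v set \<Rightarrow> bool" where
  "left_ideal A I \<longleftrightarrow> I \<subseteq> carrier A \<and> module.subspace (smul A) I \<and>
     (\<forall>a\<in>carrier A. \<forall>x\<in>I. mul A a x \<in> I)"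

text \<open>The left regular module is semisimple: every submodule is a direct summand.\<close>

definition semisimple_algebra :: "('k::field, 'v::ab_group_add, 'z) alg_scheme \<Rightarrow> bool" where
  "semisimple_algebra A \<longleftrightarrow>
     (\<forall>I. left_ideal A I \<longrightarrow>
        (\<exists>J. left_ideal A J \<and> I \<inter> J = {0} \<and> I + J = carrier A))"

definition subcoalgebra :: "('k::field, 'v::ab_group_add, 'z) bialg_scheme \<Rightarrow> 'v set \<Rightarrow> bool" where
  "subcoalgebra C D \<longleftrightarrow> D \<subseteq> carrier C \<and> module.subspace (smul C) D \<and>
     (\<forall>x\<in>D. comul C x \<in> module.span fscale {tens C C u v | u v. u \<in> D \<and> v \<in> D})"

definition simple_subcoalgebra ::
  "('k::field, 'v::ab_group_add, 'z) bialg_scheme \<Rightarrow> 'v set \<Rightarrow> bool" where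
  "simple_subcoalgebra C D \<longleftrightarrow> subcoalgebra C D \<and> D \<noteq> {0} \<and>
     (\<forall>E. subcoalgebra C E \<longrightarrow> E \<subseteq> D \<longrightarrow> E = {0} \<or> E = D)"

definition cosemisimple_coalgebra ::
  "('k::field, 'v::ab_group_add, 'z) bialg_scheme \<Rightarrow> bool" where
  "cosemisimple_coalgebra C \<longleftrightarrow>
     carrier C = module.span (smul C) (\<Union> {D. simple_subcoalgebra C D})"


section \<open>Yetter-Drinfeld modules\<close>

record ('k, 'v, 'h) ydmod = "('k, 'v) vecsp" +
  act :: "'h \<Rightarrow> 'v \<Rightarrow> 'v"
  coact :: "'v \<Rightarrow> ('k, 'h \<times> 'v) tens"

definition yd_module ::
  "('k::field, 'h::ab_group_add, 'y) hopf_scheme \<Rightarrow> ('k, 'v::ab_group_add, 'h, 'z) ydmod_scheme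
    \<Rightarrow> bool" where
  "yd_module H V \<longleftrightarrow> vecsp V \<and>
     bilin_map H V V (\<lambda>(h, v). act V h v) \<and>
     (\<forall>v\<in>carrier V. act V (unt H) v = v) \<and>
     (\<forall>g\<in>carrier H. \<forall>h\<in>carrier H. \<forall>v\<in>carrier V. act V (mul H g h) v = act V g (act V h v)) \<and>
     lin_map V (tensor H V) (coact V) \<and>
     (\<forall>v\<in>carrier V.
        tlift H V (tensor H (tensor H V))
          (\<lambda>(a, w). tlift H H (tensor H (tensor H V))
             (\<lambda>(a\<^sub>1, a\<^sub>2). tens H (tensor H V) a\<^sub>1 (tens H V a\<^sub>2 w)) (comul H a)) (coact V v) =
        tlift H V (tensor H (tensor H V))
          (\<lambda>(a, w). tens H (tensor H V) a (coact V w)) (coact V v)) \<and>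
     (\<forall>v\<in>carrier V. tlift H V V (\<lambda>(a, w). smul V (counit H a) w) (coact V v) = v) \<and>
     (\<forall>h\<in>carrier H. \<forall>v\<in>carrier V.
        tlift H H (tensor H V) (\<lambda>(h\<^sub>1, h\<^sub>2). tlift H V (tensor H V)
          (\<lambda>(a, w). tens H V (mul H a h\<^sub>2) w) (coact V (act V h\<^sub>1 v))) (comul H h) =
        tlift H H (tensor H V) (\<lambda>(h\<^sub>1, h\<^sub>2). tlift H V (tensor H V)
          (\<lambda>(a, w). tens H V (mul H h\<^sub>1 a) (act V h\<^sub>2 w)) (coact V v)) (comul H h))"

definition yd_morphism ::
  "('k::field, 'h::ab_group_add, 'x) hopf_scheme \<Rightarrow> ('k, 'v::ab_group_add, 'h, 'y) ydmod_scheme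
    \<Rightarrow> ('k, 'w::ab_group_add, 'h, 'z) ydmod_scheme \<Rightarrow> ('v \<Rightarrow> 'w) \<Rightarrow> bool" where
  "yd_morphism H V W f \<longleftrightarrow> lin_map V W f \<and>
     (\<forall>h\<in>carrier H. \<forall>v\<in>carrier V. f (act V h v) = act W h (f v)) \<and>
     (\<forall>v\<in>carrier V.
        coact W (f v) = tlift H V (tensor H W) (\<lambda>(a, x). tens H W a (f x)) (coact V v))"

definition yd_unit :: "('k::field, 'h::ab_group_add, 'z) hopf_scheme \<Rightarrow> ('k, 'k, 'h) ydmod" where
  "yd_unit H = \<lparr>carrier = UNIV, smul = (*), act = (\<lambda>h c. counit H h * c),
                coact = (\<lambda>c. tens H ground (unt H) c)\<rparr>"

definition yd_tensor ::
  "('k::field, 'h::ab_group_add, 'x) hopf_scheme \<Rightarrow> ('k, 'v::ab_group_add, 'h, 'y) ydmod_scheme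
    \<Rightarrow> ('k, 'w::ab_group_add, 'h, 'z) ydmod_scheme \<Rightarrow> ('k, ('k, 'v \<times> 'w) tens, 'h) ydmod" where
  "yd_tensor H V W =
     \<lparr>carrier = carrier (tensor V W), smul = smul (tensor V W),
      act = (\<lambda>h. tlift V W (tensor V W) (\<lambda>(v, w).
               tlift H H (tensor V W) (\<lambda>(h\<^sub>1, h\<^sub>2). tens V W (act V h\<^sub>1 v) (act W h\<^sub>2 w)) (comul H h))),
      coact = tlift V W (tensor H (tensor V W)) (\<lambda>(v, w).
               tlift H V (tensor H (tensor V W)) (\<lambda>(a, v\<^sub>0).
                 tlift H W (tensor H (tensor V W)) (\<lambda>(b, w\<^sub>0).
                   tens H (tensor V W) (mul H a b) (tens V W v\<^sub>0 w\<^sub>0)) (coact W w)) (coact V v))\<rparr>"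

definition braiding ::
  "('k::field, 'h::ab_group_add, 'x) hopf_scheme \<Rightarrow> ('k, 'v::ab_group_add, 'h, 'y) ydmod_scheme
    \<Rightarrow> ('k, 'w::ab_group_add, 'h, 'z) ydmod_scheme \<Rightarrow> ('k, 'v \<times> 'w) tens \<Rightarrow> ('k, 'w \<times> 'v) tens"
  where
  "braiding H V W = tlift V W (tensor W V)
     (\<lambda>(v, w). tlift H V (tensor W V) (\<lambda>(a, v\<^sub>0). tens W V (act W a w) v\<^sub>0) (coact V v))"

text \<open>The identification of \<open>V \<otimes> V\<^bsup>\<otimes>n\<^esup>\<close> with \<open>V\<^bsup>\<otimes>(n+1)\<^esup>\<close> and its inverse.\<close>

definition tjoin ::
  "('k::field, 'v::ab_group_add, 'z) vecsp_scheme \<Rightarrow> nat \<Rightarrow> ('k, 'v \<times> ('k, 'v list) tens) tens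
    \<Rightarrow> ('k, 'v list) tens" where
  "tjoin V n = tlift V (tpow V n) (tpow V (Suc n))
     (\<lambda>(v, t). wlift V n (tpow V (Suc n)) (\<lambda>vs. wtens V (Suc n) (v # vs)) t)"

definition tsplit ::
  "('k::field, 'v::ab_group_add, 'z) vecsp_scheme \<Rightarrow> nat \<Rightarrow> ('k, 'v list) tens
    \<Rightarrow> ('k, 'v \<times> ('k, 'v list) tens) tens" where
  "tsplit V n = wlift V (Suc n) (tensor V (tpow V n))
     (\<lambda>vs. tens V (tpow V n) (hd vs) (wtens V n (tl vs)))"

text \<open>\<open>V\<^bsup>\<otimes>n\<^esup>\<close> as a Yetter-Drinfeld module: the structure of \<open>V \<otimes> V\<^bsup>\<otimes>n\<^esup>\<close> is transported to
  \<open>V\<^bsup>\<otimes>(n+1)\<^esup>\<close>.\<close>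

primrec yd_pow ::
  "('k::field, 'h::ab_group_add, 'y) hopf_scheme \<Rightarrow> ('k, 'v::ab_group_add, 'h, 'z) ydmod_scheme
    \<Rightarrow> nat \<Rightarrow> ('k, ('k, 'v list) tens, 'h) ydmod" where
  "yd_pow H V 0 =
     \<lparr>carrier = carrier (tpow V 0), smul = smul (tpow V 0),
      act = (\<lambda>h t. smul (tpow V 0) (counit H h) t),
      coact = (\<lambda>t. tens H (tpow V 0) (unt H) t)\<rparr>"
| "yd_pow H V (Suc n) =
     \<lparr>carrier = carrier (tpow V (Suc n)), smul = smul (tpow V (Suc n)),
      act = (\<lambda>h t. tjoin V n (act (yd_tensor H V (yd_pow H V n)) h (tsplit V n t))),
      coact = (\<lambda>t. tlift H (tensor V (tpow V n)) (tensor H (tpow V (Suc n)))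
                 (\<lambda>(a, s). tens H (tpow V (Suc n)) a (tjoin V n s))
                 (coact (yd_tensor H V (yd_pow H V n)) (tsplit V n t)))\<rparr>"


section \<open>Bialgebras in the category of Yetter-Drinfeld modules\<close>

record ('k, 'v, 'h) yd_bialg = "('k, 'v) bialg" +
  bact :: "'h \<Rightarrow> 'v \<Rightarrow> 'v"
  bcoact :: "'v \<Rightarrow> ('k, 'h \<times> 'v) tens"

definition yd_of :: "('k, 'v, 'h, 'z) yd_bialg_scheme \<Rightarrow> ('k, 'v, 'h) ydmod" where
  "yd_of B = \<lparr>carrier = carrier B, smul = smul B, act = bact B, coact = bcoact B\<rparr>"

text \<open>The multiplication of the braided tensor product algebra \<open>B \<otimes> B\<close>, that is
  \<open>(m \<otimes> m) (id \<otimes> c \<otimes> id)\<close>.\<close>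

definition braided_mul ::
  "('k::field, 'h::ab_group_add, 'y) hopf_scheme \<Rightarrow> ('k, 'v::ab_group_add, 'h, 'z) yd_bialg_scheme
    \<Rightarrow> ('k, 'v \<times> 'v) tens \<Rightarrow> ('k, 'v \<times> 'v) tens \<Rightarrow> ('k, 'v \<times> 'v) tens" where
  "braided_mul H B s t =
     tlift B B (tensor B B) (\<lambda>(a, b).
       tlift B B (tensor B B) (\<lambda>(c, d).
         tlift B B (tensor B B) (\<lambda>(c', b'). tens B B (mul B a c') (mul B b' d))
           (braiding H (yd_of B) (yd_of B) (tens B B b c))) t) s"

definition yd_bialgebra ::
  "('k::field, 'h::ab_group_add, 'y) hopf_scheme \<Rightarrow> ('k, 'v::ab_group_add, 'h, 'z) yd_bialg_scheme
    \<Rightarrow> bool" where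
  "yd_bialgebra H B \<longleftrightarrow>
     yd_module H (yd_of B) \<and> algebra B \<and> coalgebra B \<and>
     yd_morphism H (yd_tensor H (yd_of B) (yd_of B)) (yd_of B) (tlift B B B (\<lambda>(x, y). mul B x y)) \<and>
     yd_morphism H (yd_unit H) (yd_of B) (\<lambda>c. smul B c (unt B)) \<and>
     yd_morphism H (yd_of B) (yd_tensor H (yd_of B) (yd_of B)) (comul B) \<and>
     yd_morphism H (yd_of B) (yd_unit H) (counit B) \<and>
     (\<forall>x\<in>carrier B. \<forall>y\<in>carrier B.
        comul B (mul B x y) = braided_mul H B (comul B x) (comul B y)) \<and>
     comul B (unt B) = tens B B (unt B) (unt B) \<and>
     (\<forall>x\<in>carrier B. \<forall>y\<in>carrier B. counit B (mul B x y) = counit B x * counit B y) \<and>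
     counit B (unt B) = 1"


section \<open>The Drinfeld double\<close>

text \<open>The algebra \<open>D(H)\<close> on \<open>H\<^sup>* \<otimes> H\<close> with its counit; the bimodules and invariants below
  do not involve its comultiplication and antipode.  The product is the one making
  \<open>(f \<otimes> h) \<rhd> v = f ((h v)\<^bsub>-1\<^esub>) (h v)\<^sub>0\<close> an action on Yetter-Drinfeld modules, namely
  \<open>(f \<otimes> h) (g \<otimes> l) = (x \<mapsto> g (S(h\<^sub>1) x\<^sub>1 h\<^sub>3) f(x\<^sub>2)) \<otimes> h\<^sub>2 l\<close>: the factor \<open>H\<^sup>*\<close> carries
  the opposite convolution product, since \<open>f \<rhd> (g \<rhd> v) = g ((v\<^bsub>-1\<^esub>)\<^sub>1) f ((v\<^bsub>-1\<^esub>)\<^sub>2) v\<^sub>0\<close>, and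
  \<open>h g = g (S(h\<^sub>1) - h\<^sub>3) h\<^sub>2\<close> by the Yetter-Drinfeld condition.\<close>

definition drinfeld_double ::
  "('k::field, 'h::ab_group_add, 'z) hopf_scheme \<Rightarrow> ('k, ('k, ('h \<Rightarrow> 'k) \<times> 'h) tens) aug_alg" where
  "drinfeld_double H =
     \<lparr>carrier = carrier (tensor (dual H) H),
      smul = smul (tensor (dual H) H),
      mul = (\<lambda>d e.
        tlift (dual H) H (tensor (dual H) H) (\<lambda>(f, h).
          tlift (dual H) H (tensor (dual H) H) (\<lambda>(g, l).
            tlift H H (tensor (dual H) H) (\<lambda>(h\<^sub>1, k).
              tlift H H (tensor (dual H) H) (\<lambda>(h\<^sub>2, h\<^sub>3).
                tens (dual H) H
                  (restr H (\<lambda>x. tlift H H ground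
                     (\<lambda>(x\<^sub>1, x\<^sub>2). g (mul H (mul H (antipode H h\<^sub>1) x\<^sub>1) h\<^sub>3) * f x\<^sub>2) (comul H x)))
                  (mul H h\<^sub>2 l)) (comul H k)) (comul H h)) e) d),
      unt = tens (dual H) H (restr H (counit H)) (unt H),
      counit = tlift (dual H) H ground (\<lambda>(f, h). f (unt H) * counit H h)\<rparr>"

definition double_act ::
  "('k::field, 'h::ab_group_add, 'y) hopf_scheme \<Rightarrow> ('k, 'v::ab_group_add, 'h, 'z) ydmod_scheme
    \<Rightarrow> ('k, ('h \<Rightarrow> 'k) \<times> 'h) tens \<Rightarrow> 'v \<Rightarrow> 'v" where
  "double_act H V d v =
     tlift (dual H) H V
       (\<lambda>(f, h). tlift H V V (\<lambda>(a, w). smul V (f a) w) (coact V (act V h v))) d"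


section \<open>Bimodules and invariants\<close>

definition bimodule ::
  "('k::field, 'd::ab_group_add, 'y) alg_scheme \<Rightarrow> ('k, 'x::ab_group_add, 'z) vecsp_scheme
    \<Rightarrow> ('d \<Rightarrow> 'x \<Rightarrow> 'x) \<Rightarrow> ('x \<Rightarrow> 'd \<Rightarrow> 'x) \<Rightarrow> bool" where
  "bimodule K X l r \<longleftrightarrow> vecsp X \<and>
     bilin_map K X X (\<lambda>(d, x). l d x) \<and> bilin_map X K X (\<lambda>(x, d). r x d) \<and>
     (\<forall>x\<in>carrier X. l (unt K) x = x \<and> r x (unt K) = x) \<and>
     (\<forall>d\<in>carrier K. \<forall>e\<in>carrier K. \<forall>x\<in>carrier X.
        l (mul K d e) x = l d (l e x) \<and> r x (mul K d e) = r (r x d) e \<and>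
        r (l d x) e = l d (r x e))"

definition sub_bimodule ::
  "('k::field, 'd::ab_group_add, 'y) alg_scheme \<Rightarrow> ('k, 'x::ab_group_add, 'z) vecsp_scheme
    \<Rightarrow> ('d \<Rightarrow> 'x \<Rightarrow> 'x) \<Rightarrow> ('x \<Rightarrow> 'd \<Rightarrow> 'x) \<Rightarrow> 'x set \<Rightarrow> bool" where
  "sub_bimodule K X l r Y \<longleftrightarrow> bimodule K X l r \<and>
     Y \<subseteq> carrier X \<and> module.subspace (smul X) Y \<and>
     (\<forall>d\<in>carrier K. \<forall>y\<in>Y. l d y \<in> Y \<and> r y d \<in> Y)"

definition invariants ::
  "('k, 'd, 'y) vecsp_scheme \<Rightarrow> ('d \<Rightarrow> 'x \<Rightarrow> 'x) \<Rightarrow> ('x \<Rightarrow> 'd \<Rightarrow> 'x) \<Rightarrow> 'x set \<Rightarrow> 'x set" where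
  "invariants K l r X = {x \<in> X. \<forall>d\<in>carrier K. l d x = r x d}"

text \<open>The \<open>K\<close>-bimodule structure on linear forms on a left \<open>K\<close>-module \<open>V\<close> with action \<open>\<alpha>\<close>.\<close>

definition form_lact ::
  "('k::field, 'd, 'z) aug_alg_scheme \<Rightarrow> 'd \<Rightarrow> ('v \<Rightarrow> 'k) \<Rightarrow> 'v \<Rightarrow> 'k" where
  "form_lact K d f = fscale (counit K d) f"

definition form_ract ::
  "('k::field, 'v, 'z) vecsp_scheme \<Rightarrow> ('d \<Rightarrow> 'v \<Rightarrow> 'v) \<Rightarrow> ('v \<Rightarrow> 'k) \<Rightarrow> 'd \<Rightarrow> 'v \<Rightarrow> 'k" where
  "form_ract V \<alpha> f d = restr V (\<lambda>z. f (\<alpha> d z))"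

text \<open>The quotient of a space of functions \<open>Z\<close> by \<open>N\<close> is the set of cosets \<open>z +o N\<close>, with zero
  \<open>N\<close> and addition of cosets as sets.  An operator \<open>T\<close> preserving \<open>Z\<close> and \<open>N\<close> induces
  \<open>quot_map N T\<close>; scalar multiplication is \<open>quot_map N (fscale c)\<close>.\<close>

definition quot :: "'x::ab_group_add set \<Rightarrow> 'x set \<Rightarrow> 'x set set" where
  "quot Z N = (\<lambda>z. z +o N) ` Z"

definition quot_map :: "'x::ab_group_add set \<Rightarrow> ('x \<Rightarrow> 'x) \<Rightarrow> 'x set \<Rightarrow> 'x set" where
  "quot_map N T X = T ` X + N"

definition quot_iso ::
  "('v \<Rightarrow> 'k::field) set \<Rightarrow> ('v \<Rightarrow> 'k) set set \<Rightarrow> ('w \<Rightarrow> 'k) set \<Rightarrow> ('w \<Rightarrow> 'k) set set \<Rightarrow> bool" where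
  "quot_iso N Q N' Q' \<longleftrightarrow>
     (\<exists>\<Phi>. bij_betw \<Phi> Q Q' \<and> (\<forall>X\<in>Q. \<forall>Y\<in>Q. \<Phi> (X + Y) = \<Phi> X + \<Phi> Y) \<and>
          (\<forall>c. \<forall>X\<in>Q. \<Phi> (quot_map N (fscale c) X) = quot_map N' (fscale c) (\<Phi> X)))"

definition quot_subspace :: "('v \<Rightarrow> 'k::field) set \<Rightarrow> ('v \<Rightarrow> 'k) set set \<Rightarrow> bool" where
  "quot_subspace N Q \<longleftrightarrow> N \<in> Q \<and> (\<forall>X\<in>Q. \<forall>Y\<in>Q. X + Y \<in> Q) \<and>
     (\<forall>c. \<forall>X\<in>Q. quot_map N (fscale c) X \<in> Q)"


section \<open>Hochschild cohomology with trivial coefficients\<close>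

definition cochains ::
  "('k::field, 'v::ab_group_add, 'z) vecsp_scheme \<Rightarrow> nat \<Rightarrow> (('k, 'v list) tens \<Rightarrow> 'k) set" where
  "cochains B n = carrier (dual (tpow B n))"

definition yd_cochains ::
  "('k::field, 'h::ab_group_add, 'y) hopf_scheme \<Rightarrow> ('k, 'v::ab_group_add, 'h, 'z) yd_bialg_scheme
    \<Rightarrow> nat \<Rightarrow> (('k, 'v list) tens \<Rightarrow> 'k) set" where
  "yd_cochains H B n = {f \<in> cochains B n. yd_morphism H (yd_pow H (yd_of B) n) (yd_unit H) f}"

definition hoch_diff ::
  "('k::field, 'v::ab_group_add, 'z) aug_alg_scheme \<Rightarrow> nat \<Rightarrow> (('k, 'v list) tens \<Rightarrow> 'k)
    \<Rightarrow> ('k, 'v list) tens \<Rightarrow> 'k" where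
  "hoch_diff B n f = restr (tpow B (Suc n)) (wlift B (Suc n) ground (\<lambda>bs.
     counit B (hd bs) * f (wtens B n (tl bs))
     + (\<Sum>i<n. (-1) ^ Suc i *
          f (wtens B n (take i bs @ mul B (bs ! i) (bs ! Suc i) # drop (Suc (Suc i)) bs)))
     + (-1) ^ Suc n * f (wtens B n (butlast bs)) * counit B (last bs)))"

text \<open>Cocycles, coboundaries and cohomology of a subcomplex \<open>C\<close> of the Hochschild complex.\<close>

definition cocycles ::
  "('k::field, 'v::ab_group_add, 'z) aug_alg_scheme \<Rightarrow> (nat \<Rightarrow> (('k, 'v list) tens \<Rightarrow> 'k) set)
    \<Rightarrow> nat \<Rightarrow> (('k, 'v list) tens \<Rightarrow> 'k) set" where
  "cocycles B C n = {f \<in> C n. hoch_diff B n f = 0}"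

definition coboundaries ::
  "('k::field, 'v::ab_group_add, 'z) aug_alg_scheme \<Rightarrow> (nat \<Rightarrow> (('k, 'v list) tens \<Rightarrow> 'k) set)
    \<Rightarrow> nat \<Rightarrow> (('k, 'v list) tens \<Rightarrow> 'k) set" where
  "coboundaries B C n = (case n of 0 \<Rightarrow> {0} | Suc m \<Rightarrow> hoch_diff B m ` C m)"

definition cohomology ::
  "('k::field, 'v::ab_group_add, 'z) aug_alg_scheme \<Rightarrow> (nat \<Rightarrow> (('k, 'v list) tens \<Rightarrow> 'k) set)
    \<Rightarrow> nat \<Rightarrow> (('k, 'v list) tens \<Rightarrow> 'k) set set" where
  "cohomology B C n = quot (cocycles B C n) (coboundaries B C n)"

abbreviation "HZ B \<equiv> cocycles B (cochains B)"
abbreviation "HB B \<equiv> coboundaries B (cochains B)"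
abbreviation "HH B \<equiv> cohomology B (cochains B)"
abbreviation "HZ_YD H B \<equiv> cocycles B (yd_cochains H B)"
abbreviation "HB_YD H B \<equiv> coboundaries B (yd_cochains H B)"
abbreviation "HH_YD H B \<equiv> cohomology B (yd_cochains H B)"

text \<open>The right actions of \<open>D(H)\<close> and \<open>H\<close> on cochains.\<close>

definition D_ract ::
  "('k::field, 'h::ab_group_add, 'y) hopf_scheme \<Rightarrow> ('k, 'v::ab_group_add, 'h, 'z) yd_bialg_scheme
    \<Rightarrow> nat \<Rightarrow> (('k, 'v list) tens \<Rightarrow> 'k) \<Rightarrow> ('k, ('h \<Rightarrow> 'k) \<times> 'h) tens
    \<Rightarrow> ('k, 'v list) tens \<Rightarrow> 'k" where
  "D_ract H B n = form_ract (tpow B n) (double_act H (yd_pow H (yd_of B) n))"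

definition H_ract ::
  "('k::field, 'h::ab_group_add, 'y) hopf_scheme \<Rightarrow> ('k, 'v::ab_group_add, 'h, 'z) yd_bialg_scheme
    \<Rightarrow> nat \<Rightarrow> (('k, 'v list) tens \<Rightarrow> 'k) \<Rightarrow> 'h \<Rightarrow> ('k, 'v list) tens \<Rightarrow> 'k" where
  "H_ract H B n = form_ract (tpow B n) (act (yd_pow H (yd_of B) n))"

text \<open>\<open>H\<^sup>n(B, k)\<^sup>K\<close> for the induced \<open>K\<close>-bimodule structure on classes, \<open>r\<close> being the right action
  of \<open>K\<close> on cochains.\<close>

definition HH_invariants ::
  "('k::field, 'd, 'y) aug_alg_scheme \<Rightarrow> ('k, 'v::ab_group_add, 'z) aug_alg_scheme \<Rightarrow> nat
    \<Rightarrow> ((('k, 'v list) tens \<Rightarrow> 'k) \<Rightarrow> 'd \<Rightarrow> ('k, 'v list) tens \<Rightarrow> 'k)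
    \<Rightarrow> (('k, 'v list) tens \<Rightarrow> 'k) set set" where
  "HH_invariants K B n r =
     invariants K (\<lambda>d. quot_map (HB B n) (form_lact K d))
       (\<lambda>X d. quot_map (HB B n) (\<lambda>f. r f d) X) (HH B n)"

end

theory Submission
  imports Defs
begin

text \<open>
  The elements \<open>\<epsilon> \<otimes> h\<close> and \<open>g \<otimes> 1\<close> of \<open>D(H)\<close> test a linear form on a Yetter-Drinfeld module for
  linearity and colinearity. Hence the forms that are morphisms to \<open>k\<close> are exactly the
  \<open>D(H)\<close>-invariant ones (\<open>hom_ground_iff\<close>). The Hochschild differential is an alternating sum of
  face maps made from the counit and the multiplication of \<open>B\<close> (\<open>hoch_diff_faces\<close>). These are
  morphisms of Yetter-Drinfeld modules and so commute with \<open>D(H)\<close> (\<open>hom_dact\<close>); therefore the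
  differential commutes with the right action of \<open>D(H)\<close> on cochains (\<open>diff_R\<close>). It follows that
  cocycles and coboundaries form sub-bimodules, and that an invariant cocycle is the same as a
  cocycle of the subcomplex of morphisms.

  Coboundaries and cohomology require averaging. There is \<open>\<Lambda> \<in> D(H)\<close> with \<open>\<epsilon>(\<Lambda>) = 1\<close> and
  \<open>\<Lambda> d = \<epsilon>(d) \<Lambda>\<close> for all \<open>d\<close> (\<open>averaging_element\<close>), so \<open>f \<mapsto> f \<Lambda>\<close> is a projection of the
  cochains onto the invariant ones that commutes with the differential. An invariant coboundary
  \<open>d f\<close> equals \<open>d (f \<Lambda>)\<close>, which makes it a coboundary of the subcomplex (\<open>HB_YD_eq\<close>). An invariant
  class of a cocycle \<open>z\<close> contains the invariant cocycle \<open>z \<Lambda>\<close> (\<open>HH_invariants_eq\<close>).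

  The element is \<open>\<Lambda> = l \<otimes> t\<close>. Here \<open>t\<close> is a two-sided integral of \<open>H\<close> with \<open>\<epsilon>(t) = 1\<close>, found in a
  complement of the augmentation ideal (\<open>two_sided_integral_exists\<close>), and \<open>l\<close> is a two-sided
  integral of \<open>H\<^sup>*\<close> with \<open>l(1) = 1\<close>, namely a form vanishing on all simple subcoalgebras but the
  one spanned by \<open>1\<close> (\<open>two_sided_cointegral_exists\<close>). That \<open>\<Lambda>\<close> absorbs all of \<open>D(H)\<close> comes down to
  the identity \<open>S(t\<^sub>1) t\<^sub>3 \<otimes> t\<^sub>2 = 1 \<otimes> t\<close> (\<open>integral_conjugation\<close>), which is verified against the
  nondegenerate form \<open>(x, y) \<mapsto> l(x y)\<close>.

  The computations use Sweedler sums \<open>sw\<close>, which are finite sums over a chosen representation of a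
  tensor.
\<close>

section \<open>Linear maps between subspaces\<close>

text \<open>The rules \<open>lin\<close> prove membership in carriers, linearity and bilinearity by resolution, following
  the syntax of the expression. A rule for one argument of an operation demands that the other
  arguments do not mention the bound variable, so the position of that variable determines the
  rule.\<close>

named_theorems lin

lemma vecsp_vector_space: "vecsp V \<Longrightarrow> vector_space (smul V)"
  by (simp add: vecsp_def)

lemma vecsp_subspace: "vecsp V \<Longrightarrow> module.subspace (smul V) (carrier V)"
  by (simp add: vecsp_def)

lemma vecsp_module: "vecsp V \<Longrightarrow> module (smul V)"
  by (auto simp: vecsp_def module_iff_vector_space)

lemma vecsp_zero [lin]: "vecsp V \<Longrightarrow> 0 \<in> carrier V"
  by (rule module.subspace_0[OF vecsp_module vecsp_subspace])

lemma vecsp_add [lin]: "x \<in> carrier V \<Longrightarrow> y \<in> carrier V \<Longrightarrow> vecsp V \<Longrightarrow> x + y \<in> carrier V"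
  by (rule module.subspace_add[OF vecsp_module vecsp_subspace])

lemma vecsp_smul [lin]: "x \<in> carrier V \<Longrightarrow> vecsp V \<Longrightarrow> smul V c x \<in> carrier V"
  by (rule module.subspace_scale[OF vecsp_module vecsp_subspace])

lemma vecsp_diff [lin]: "x \<in> carrier V \<Longrightarrow> y \<in> carrier V \<Longrightarrow> vecsp V \<Longrightarrow> x - y \<in> carrier V"
  by (rule module.subspace_diff[OF vecsp_module vecsp_subspace])

lemma smul_simps:
  assumes "vecsp V"
  shows "smul V c (x + y) = smul V c x + smul V c y" "smul V (c + d) x = smul V c x + smul V d x"
    "smul V c (smul V d x) = smul V (c * d) x" "smul V 1 x = x" "smul V c 0 = 0" "smul V 0 x = 0"
    "smul V c (- x) = - smul V c x" "smul V c (x - y) = smul V c x - smul V c y"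
  using vecsp_module[OF assms]
  by (simp_all add: module.scale_right_distrib module.scale_left_distrib module.scale_scale
      module.scale_one module.scale_zero_right module.scale_zero_left module.scale_minus_right
      module.scale_right_diff_distrib)

lemma vecsp_iff:
  "vecsp V \<longleftrightarrow> vector_space (smul V) \<and> 0 \<in> carrier V \<and>
     (\<forall>x\<in>carrier V. \<forall>y\<in>carrier V. x + y \<in> carrier V) \<and> (\<forall>c. \<forall>x\<in>carrier V. smul V c x \<in> carrier V)"
  unfolding vecsp_def module_iff_vector_space[symmetric]
  by (rule conj_cong) (auto simp: module.subspace_def)

lemma lin_mapI:
  assumes "\<And>x. x \<in> carrier V \<Longrightarrow> f x \<in> carrier W"
    and "\<And>x y. x \<in> carrier V \<Longrightarrow> y \<in> carrier V \<Longrightarrow> f (x + y) = f x + f y"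
    and "\<And>c x. x \<in> carrier V \<Longrightarrow> f (smul V c x) = smul W c (f x)"
  shows "lin_map V W f"
  using assms by (simp add: lin_map_def)

lemma lin_map_in: "lin_map V W f \<Longrightarrow> x \<in> carrier V \<Longrightarrow> f x \<in> carrier W"
  by (simp add: lin_map_def)

lemma lin_map_add: "lin_map V W f \<Longrightarrow> x \<in> carrier V \<Longrightarrow> y \<in> carrier V \<Longrightarrow> f (x + y) = f x + f y"
  by (simp add: lin_map_def)

lemma lin_map_smul: "lin_map V W f \<Longrightarrow> x \<in> carrier V \<Longrightarrow> f (smul V c x) = smul W c (f x)"
  by (simp add: lin_map_def)

lemma lin_map_zero:
  assumes "lin_map V W f" "vecsp V" "vecsp W"
  shows "f 0 = 0"
  using lin_map_smul[OF assms(1) vecsp_zero[OF assms(2)], of 0] assms by (simp add: smul_simps)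

lemma lin_map_minus:
  assumes "lin_map V W f" "vecsp V" "vecsp W" "x \<in> carrier V"
  shows "f (- x) = - f x"
proof -
  have "- x = smul V (-1) x" "- f x = smul W (-1) (f x)"
    using vecsp_module[OF assms(2)] vecsp_module[OF assms(3)] by (simp_all add: module.scale_minus_left module.scale_one)
  then show ?thesis using lin_map_smul[OF assms(1,4), of "-1"] by simp
qed

lemma lin_map_diff:
  assumes "lin_map V W f" "vecsp V" "vecsp W" "x \<in> carrier V" "y \<in> carrier V"
  shows "f (x - y) = f x - f y"
  using lin_map_add[OF assms(1), of x "- y"] lin_map_minus[OF assms(1-3,5)] assms
    vecsp_diff[of 0 V y] vecsp_zero[of V] by simp

lemma lin_map_cong:
  "lin_map V W f \<Longrightarrow> vecsp V \<Longrightarrow> (\<And>x. x \<in> carrier V \<Longrightarrow> f x = g x) \<Longrightarrow> lin_map V W g"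
  by (simp add: lin_map_def vecsp_add vecsp_smul)

lemma lin_id [lin]: "lin_map V V (\<lambda>x. x)"
  by (simp add: lin_map_def)

lemma lin_comp: "lin_map V W f \<Longrightarrow> lin_map X V G \<Longrightarrow> lin_map X W (\<lambda>x. f (G x))"
  by (simp add: lin_map_def)

lemma lin_add [lin]:
  "lin_map V W f \<Longrightarrow> lin_map V W g \<Longrightarrow> vecsp W \<Longrightarrow> lin_map V W (\<lambda>x. f x + g x)"
  by (auto simp: lin_map_def vecsp_add smul_simps)

lemma lin_smul_r [lin]:
  "lin_map V W f \<Longrightarrow> vecsp W \<Longrightarrow> lin_map V W (\<lambda>x. smul W c (f x))"
  by (auto simp: lin_map_def vecsp_smul smul_simps mult.commute)

lemma ground_simps [simp]: "carrier ground = UNIV" "smul ground = (*)"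
  by (simp_all add: ground_def)

lemma vecsp_ground [lin, simp]: "vecsp ground"
  by (simp add: vecsp_iff vector_space_ground)

lemma in_ground [lin]: "x \<in> carrier ground"
  by simp

lemma lin_smul_l [lin]:
  "lin_map V ground f \<Longrightarrow> u \<in> carrier W \<Longrightarrow> vecsp W \<Longrightarrow> lin_map V W (\<lambda>x. smul W (f x) u)"
  by (auto simp: lin_map_def vecsp_smul smul_simps)

lemma lin_mult_r [lin]: "lin_map V ground f \<Longrightarrow> lin_map V ground (\<lambda>x. c * f x)"
  by (auto simp: lin_map_def algebra_simps)

lemma lin_mult_l [lin]: "lin_map V ground f \<Longrightarrow> lin_map V ground (\<lambda>x. f x * c)"
  by (auto simp: lin_map_def algebra_simps)

lemma lin_sum_list:
  assumes W: "vecsp W" and f: "\<And>p. p \<in> set ps \<Longrightarrow> lin_map V W (f p)"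
  shows "lin_map V W (\<lambda>x. \<Sum>p\<leftarrow>ps. f p x)"
  using f
proof (induction ps)
  case Nil
  then show ?case using W by (simp add: lin_map_def vecsp_zero smul_simps)
next
  case (Cons p ps)
  then show ?case by (simp add: lin_add W)
qed

lemma lin_sum:
  assumes W: "vecsp W" and f: "\<And>p. p \<in> I \<Longrightarrow> lin_map V W (f p)"
  shows "lin_map V W (\<lambda>x. \<Sum>p\<in>I. f p x)"
proof -
  have 0: "lin_map V W (\<lambda>x. 0)" using W by (simp add: lin_map_def vecsp_zero smul_simps)
  show ?thesis using f by (induction I rule: infinite_finite_induct) (simp_all add: 0 lin_add W)
qed

lemma sum_list_mem:
  "(\<And>p. p \<in> set ps \<Longrightarrow> f p \<in> carrier W) \<Longrightarrow> vecsp W \<Longrightarrow> (\<Sum>p\<leftarrow>ps. f p) \<in> carrier W"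
  by (induction ps) (auto intro: vecsp_zero vecsp_add)

lemma lin_map_sum_list:
  assumes "lin_map V W f" "vecsp V" "vecsp W" "\<And>p. p \<in> set ps \<Longrightarrow> g p \<in> carrier V"
  shows "f (\<Sum>p\<leftarrow>ps. g p) = (\<Sum>p\<leftarrow>ps. f (g p))"
  using assms(4)
  by (induction ps)
    (auto simp: lin_map_zero[OF assms(1-3)] lin_map_add[OF assms(1)] sum_list_mem[OF _ assms(2)])

text \<open>Forms on the ambient space separate points; cutting them off outside the carrier turns them
  into elements of the dual as it is represented here, namely by functions that are zero there.\<close>

lemma vecsp_eqI:
  assumes "vecsp U" and eq: "\<And>f. lin_map U ground f \<Longrightarrow> (\<And>x. x \<notin> carrier U \<Longrightarrow> f x = 0) \<Longrightarrow> f x = f y"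
    and "x \<in> carrier U" "y \<in> carrier U"
  shows "x = y"
proof (rule functionals_separate)
  show "vector_space (smul U)" by (rule vecsp_vector_space) fact
  fix \<phi> :: "'b \<Rightarrow> 'a" assume \<phi>: "Vector_Spaces.linear (smul U) (*) \<phi>"
  have "lin_map U ground (restr U \<phi>)"
    using \<phi> assms(1) unfolding linear_iff_module_hom
    by (auto simp: lin_map_def restr_def vecsp_add vecsp_smul module_hom.add module_hom.scale)
  then have "restr U \<phi> x = restr U \<phi> y" by (rule eq) (simp add: restr_def)
  then show "\<phi> x = \<phi> y" using assms by (simp add: restr_def)
qed

section \<open>Tensor products and Sweedler sums\<close>

lemma vecsp_tens_space [simp]: "vecsp (tens_space F W)"
proof -
  interpret V: vector_space fscale by (rule vector_space_fscale)
  show ?thesis by (simp add: vecsp_def tens_space_def V.subspace_span vector_space_fscale)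
qed

lemma vecsp_tensor [lin, simp]: "vecsp (tensor V W)"
  by (simp add: tensor_def)

lemma vecsp_tpow [lin, simp]: "vecsp (tpow V n)"
  by (simp add: tpow_def)

lemma smul_tensor [simp]: "smul (tensor V W) = fscale" "smul (tpow V n) = fscale"
  by (simp_all add: tensor_def tens_space_def tpow_def)

abbreviation bil where
  "bil V W U g \<equiv> bilin_map V W U (\<lambda>(x, y). g x y)"

lemma bilI [lin]:
  assumes "\<And>v. v \<in> carrier V \<Longrightarrow> lin_map W U (\<lambda>w. g v w)"
    and "\<And>w. w \<in> carrier W \<Longrightarrow> lin_map V U (\<lambda>v. g v w)"
  shows "bil V W U (\<lambda>v w. g v w)"
  using assms by (simp add: bilin_map_def)

lemma bil_r: "bil V W U g \<Longrightarrow> v \<in> carrier V \<Longrightarrow> lin_map X W f \<Longrightarrow> lin_map X U (\<lambda>x. g v (f x))"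
  by (simp add: bilin_map_def lin_map_def)

lemma bil_l: "bil V W U g \<Longrightarrow> w \<in> carrier W \<Longrightarrow> lin_map X V f \<Longrightarrow> lin_map X U (\<lambda>x. g (f x) w)"
  by (simp add: bilin_map_def lin_map_def)

lemma bil_in: "bil V W U g \<Longrightarrow> v \<in> carrier V \<Longrightarrow> w \<in> carrier W \<Longrightarrow> g v w \<in> carrier U"
  by (simp add: bilin_map_def lin_map_def)

lemma tens_in [lin]: "v \<in> carrier V \<Longrightarrow> w \<in> carrier W \<Longrightarrow> tens V W v w \<in> carrier (tensor V W)"
proof -
  interpret V: vector_space fscale by (rule vector_space_fscale)
  show "v \<in> carrier V \<Longrightarrow> w \<in> carrier W \<Longrightarrow> ?thesis"
    by (auto simp: tensor_def tens_def tens_space_def intro!: V.span_base)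
qed

lemma tens_apply:
  assumes "v \<in> carrier V" "w \<in> carrier W" "v' \<in> carrier V" "w' \<in> carrier W"
  shows "tens V W (v + v') w \<beta> = tens V W v w \<beta> + tens V W v' w \<beta>"
    "tens V W v (w + w') \<beta> = tens V W v w \<beta> + tens V W v w' \<beta>"
    "tens V W (smul V c v) w \<beta> = fscale c (tens V W v w) \<beta>"
    "tens V W v (smul W c w) \<beta> = fscale c (tens V W v w) \<beta>"
  using assms
  by (auto simp: tens_def pure_tens_def fscale_def bilin_forms_def bilin_map_def lin_map_def)

lemma bil_tens: "bil V W (tensor V W) (tens V W)"
proof (rule bilI)
  fix v assume v: "v \<in> carrier V"
  show "lin_map W (tensor V W) (tens V W v)"
    by (rule lin_mapI)
      (use v in \<open>auto simp: tens_in fun_eq_iff tens_apply\<close>)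
next
  fix w assume w: "w \<in> carrier W"
  show "lin_map V (tensor V W) (\<lambda>v. tens V W v w)"
    by (rule lin_mapI)
      (use w in \<open>auto simp: tens_in fun_eq_iff tens_apply\<close>)
qed

lemmas lin_tens_r [lin] = bil_r[OF bil_tens]
lemmas lin_tens_l [lin] = bil_l[OF bil_tens]

text \<open>Sweedler notation: \<open>sw V W t (\<lambda>x y. g x y)\<close> is the sum written \<open>g t\<^sub>1 t\<^sub>2\<close>, evaluated on one chosen
  representation of \<open>t\<close> as a finite sum of pure tensors. As an honest finite sum it commutes with
  linear maps and with other such sums whether or not \<open>g\<close> is bilinear; bilinearity is what makes
  it independent of the representation, so it is demanded where \<open>t\<close> is rewritten. The list is empty
  outside the tensor product, so its entries always lie in the carriers.\<close>

definition tens_rep ::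
  "('k::field, 'v::ab_group_add, 'y) vecsp_scheme \<Rightarrow> ('k, 'w::ab_group_add, 'z) vecsp_scheme
    \<Rightarrow> ('k, 'v \<times> 'w) tens \<Rightarrow> ('v \<times> 'w) list" where
  "tens_rep V W t = (if t \<in> carrier (tensor V W) then
     SOME ps. set ps \<subseteq> carrier V \<times> carrier W \<and> t = (\<Sum>p\<leftarrow>ps. tens V W (fst p) (snd p)) else [])"

definition sw ::
  "('k::field, 'v::ab_group_add, 'y) vecsp_scheme \<Rightarrow> ('k, 'w::ab_group_add, 'z) vecsp_scheme
    \<Rightarrow> ('k, 'v \<times> 'w) tens \<Rightarrow> ('v \<Rightarrow> 'w \<Rightarrow> 'u::ab_group_add) \<Rightarrow> 'u" where
  "sw V W t g = (\<Sum>p\<leftarrow>tens_rep V W t. g (fst p) (snd p))"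

lemma tens_rep_exists:
  assumes "vecsp V" "t \<in> carrier (tensor V W)"
  shows "\<exists>ps. set ps \<subseteq> carrier V \<times> carrier W \<and> t = (\<Sum>p\<leftarrow>ps. tens V W (fst p) (snd p))"
proof -
  interpret V: vector_space fscale by (rule vector_space_fscale)
  show ?thesis
    using assms(2) unfolding tensor_def tens_space_def vecsp.simps
  proof (induction rule: V.span_induct_alt)
    case base
    show ?case by (rule exI[of _ "[]"]) simp
  next
    case (step c x t)
    then obtain ps where ps: "set ps \<subseteq> carrier V \<times> carrier W" "t = (\<Sum>p\<leftarrow>ps. tens V W (fst p) (snd p))"
      by blast
    obtain v w where x: "v \<in> carrier V" "w \<in> carrier W" "x = tens V W v w"
      using step.hyps by (auto simp: tens_def)
    have "fscale c x = tens V W (smul V c v) w"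
      using lin_map_smul[OF bil_l[OF bil_tens x(2) lin_id] x(1), of c] by (simp add: x(3))
    then show ?case
      using ps x assms(1) by (intro exI[of _ "(smul V c v, w) # ps"]) (simp add: vecsp_smul)
  qed
qed

lemma tens_rep:
  assumes "vecsp V"
  shows "set (tens_rep V W t) \<subseteq> carrier V \<times> carrier W"
    and "t \<in> carrier (tensor V W) \<Longrightarrow> t = (\<Sum>p\<leftarrow>tens_rep V W t. tens V W (fst p) (snd p))"
  using someI_ex[OF tens_rep_exists[OF assms], of t W] by (auto simp: tens_rep_def)

lemma sw_cong:
  assumes "\<And>a b. a \<in> carrier V \<Longrightarrow> b \<in> carrier W \<Longrightarrow> f a b = g a b" "vecsp V"
  shows "sw V W t f = sw V W t g"
  unfolding sw_def using tens_rep(1)[OF assms(2), of W t]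
  by (intro arg_cong[of _ _ sum_list] map_cong refl assms) auto

lemma sw_in [lin]:
  assumes "\<And>a b. a \<in> carrier V \<Longrightarrow> b \<in> carrier W \<Longrightarrow> g a b \<in> carrier U" "vecsp U" "vecsp V"
  shows "sw V W t (\<lambda>a b. g a b) \<in> carrier U"
  unfolding sw_def using tens_rep(1)[OF assms(3), of W t] by (intro sum_list_mem assms) auto


lemma sum_list_swap:
  "(\<Sum>p\<leftarrow>ps. \<Sum>q\<leftarrow>qs. h p q) = (\<Sum>q\<leftarrow>qs. \<Sum>p\<leftarrow>ps. (h p q :: 'u::ab_group_add))"
  by (induction ps) (simp_all add: sum_list_addf)

lemma sw_swap:
  "sw V W t (\<lambda>a b. sw X Y s (\<lambda>c d. g a b c d)) = sw X Y s (\<lambda>c d. sw V W t (\<lambda>a b. g a b c d))"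
  unfolding sw_def by (rule sum_list_swap)

lemma lin_map_sw:
  assumes "lin_map U U' f" "\<And>a b. a \<in> carrier V \<Longrightarrow> b \<in> carrier W \<Longrightarrow> g a b \<in> carrier U"
    and "vecsp U" "vecsp U'" "vecsp V"
  shows "f (sw V W t (\<lambda>a b. g a b)) = sw V W t (\<lambda>a b. f (g a b))"
  unfolding sw_def using tens_rep(1)[OF assms(5), of W t]
  by (intro lin_map_sum_list[OF assms(1,3,4)] assms(2)) auto

lemma lin_sw_body [lin]:
  assumes "\<And>a b. a \<in> carrier V \<Longrightarrow> b \<in> carrier W \<Longrightarrow> lin_map X U (\<lambda>x. g x a b)" "vecsp U" "vecsp V"
  shows "lin_map X U (\<lambda>x. sw V W t (\<lambda>a b. g x a b))"
  unfolding sw_def using tens_rep(1)[OF assms(3), of W t]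
  by (intro lin_sum_list[OF assms(2)] assms(1)) auto

lemma sw_eq_tlift:
  assumes g: "bil V W U g" and "vecsp U" "vecsp V" and t: "t \<in> carrier (tensor V W)"
  shows "sw V W t g = tlift V W U (\<lambda>(x, y). g x y) t"
proof -
  let ?L = "tlift V W U (\<lambda>(x, y). g x y)"
  have L: "lin_map (tensor V W) U ?L" by (rule tensor_universal(1)[OF \<open>vecsp U\<close> g])
  have set: "set (tens_rep V W t) \<subseteq> carrier V \<times> carrier W" by (rule tens_rep(1)[OF \<open>vecsp V\<close>])
  have "?L t = ?L (\<Sum>p\<leftarrow>tens_rep V W t. tens V W (fst p) (snd p))"
    using tens_rep(2)[OF \<open>vecsp V\<close> t] by simp
  also have "\<dots> = (\<Sum>p\<leftarrow>tens_rep V W t. ?L (tens V W (fst p) (snd p)))"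
    using set by (intro lin_map_sum_list[OF L vecsp_tensor \<open>vecsp U\<close>]) (force intro: tens_in)
  also have "\<dots> = sw V W t g"
    unfolding sw_def using set tensor_universal(2)[OF \<open>vecsp U\<close> g]
    by (intro arg_cong[of _ _ sum_list] map_cong refl) auto
  finally show ?thesis by simp
qed

lemma tlift_eq_sw:
  assumes "bil V W U (\<lambda>x y. g x y)" and "t \<in> carrier (tensor V W)" and "vecsp U" "vecsp V"
  shows "tlift V W U (\<lambda>(x, y). g x y) t = sw V W t (\<lambda>x y. g x y)"
  using sw_eq_tlift[OF assms(1,3,4,2)] by simp

lemma lin_sw:
  assumes g: "bil V W U g" and "vecsp U" "vecsp V"
  shows "lin_map (tensor V W) U (\<lambda>t. sw V W t g)"
  by (rule lin_map_cong[OF tensor_universal(1)[OF assms(2,1)]])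
    (simp_all add: sw_eq_tlift[OF assms])

lemma lin_sw_arg [lin]:
  assumes "lin_map X (tensor V W) T" "bil V W U (\<lambda>a b. g a b)" "vecsp U" "vecsp V"
  shows "lin_map X U (\<lambda>x. sw V W (T x) (\<lambda>a b. g a b))"
  by (rule lin_comp[OF lin_sw]) (use assms in auto)

lemma sw_tens:
  assumes "bil V W U (\<lambda>a b. g a b)" "v \<in> carrier V" "w \<in> carrier W" "vecsp U" "vecsp V"
  shows "sw V W (tens V W v w) (\<lambda>a b. g a b) = g v w"
  using assms by (simp add: sw_eq_tlift tens_in tensor_universal(2))

lemma sw_tens_id:
  assumes "t \<in> carrier (tensor V W)" "vecsp V"
  shows "sw V W t (\<lambda>a b. tens V W a b) = t"
  using tens_rep(2)[OF assms(2,1)] by (simp add: sw_def)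

lemma sw_sw:
  assumes "bil V W U (\<lambda>a b. g a b)" "\<And>c d. c \<in> carrier X \<Longrightarrow> d \<in> carrier Y \<Longrightarrow> T c d \<in> carrier (tensor V W)"
    and "vecsp U" "vecsp V" "vecsp X"
  shows "sw V W (sw X Y s (\<lambda>c d. T c d)) (\<lambda>a b. g a b) = sw X Y s (\<lambda>c d. sw V W (T c d) (\<lambda>a b. g a b))"
  by (rule lin_map_sw[OF lin_sw]) (use assms in auto)

lemma tensor_ext:
  assumes "lin_map (tensor V W) U f" "lin_map (tensor V W) U g"
    and "\<And>v w. v \<in> carrier V \<Longrightarrow> w \<in> carrier W \<Longrightarrow> f (tens V W v w) = g (tens V W v w)"
    and "t \<in> carrier (tensor V W)" "vecsp U"
  shows "f t = g t"
  by (rule tens_space_ext[OF assms(5) assms(1,2)[unfolded tensor_def] _ assms(4)[unfolded tensor_def]])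
    (use assms(3) in \<open>auto simp: tens_def\<close>)

lemma tpow_ext:
  assumes "lin_map (tpow V n) U f" "lin_map (tpow V n) U g"
    and "\<And>vs. vs \<in> words V n \<Longrightarrow> f (wtens V n vs) = g (wtens V n vs)"
    and "t \<in> carrier (tpow V n)" "vecsp U"
  shows "f t = g t"
  by (rule tens_space_ext[OF assms(5) assms(1,2)[unfolded tpow_def] _ assms(4)[unfolded tpow_def]])
    (use assms(3) in \<open>auto simp: wtens_def\<close>)

lemma vecsp_dual [lin, simp]: "vecsp (dual V)"
  unfolding vecsp_iff dual_def
  by (auto simp: lin_map_def vector_space_fscale fscale_def algebra_simps)

lemma dual_D: 
  assumes "f \<in> carrier (dual V)" 
  shows "lin_map V ground f" "x \<notin> carrier V \<Longrightarrow> f x = 0"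
  using assms by (auto simp: dual_def)

lemma smul_dual [simp]: "smul (dual V) = fscale"
  by (simp add: dual_def)

lemma dual_eqI:
  assumes "f \<in> carrier (dual V)" "g \<in> carrier (dual V)" "\<And>x. x \<in> carrier V \<Longrightarrow> f x = g x"
  shows "f = g"
  using assms by (fastforce simp: dual_def)

lemma lin_dual_eval [lin]: "lin_map (dual V) ground (\<lambda>f. f a)"
  by (simp add: lin_map_def fscale_def)

lemma restr_in_dual [lin]: "lin_map V ground (\<lambda>x. f x) \<Longrightarrow> vecsp V \<Longrightarrow> restr V (\<lambda>x. f x) \<in> carrier (dual V)"
  by (simp add: dual_def lin_map_def restr_def vecsp_add vecsp_smul)

lemma restr_apply: "x \<in> carrier V \<Longrightarrow> restr V f x = f x"
  by (simp add: restr_def)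

lemma lin_restr [lin]:
  assumes "\<And>x. x \<in> carrier V \<Longrightarrow> lin_map X ground (\<lambda>y. f y x)"
    "\<And>y. y \<in> carrier X \<Longrightarrow> lin_map V ground (\<lambda>x. f y x)" "vecsp V"
  shows "lin_map X (dual V) (\<lambda>y. restr V (\<lambda>x. f y x))"
proof (rule lin_mapI)
  fix y assume "y \<in> carrier X"
  then show "restr V (\<lambda>x. f y x) \<in> carrier (dual V)" by (intro restr_in_dual assms)
next
  fix y z assume "y \<in> carrier X" "z \<in> carrier X"
  then show "restr V (f (y + z)) = restr V (f y) + restr V (f z)"
    by (simp add: fun_eq_iff restr_def lin_map_add[OF assms(1)])
next
  fix c y assume "y \<in> carrier X"
  then show "restr V (f (smul X c y)) = smul (dual V) c (restr V (f y))"
    by (simp add: fun_eq_iff restr_def fscale_def lin_map_smul[OF assms(1)])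
qed

text \<open>Yetter-Drinfeld modules, bialgebras and plain spaces are records of different types. The
  following rules identify the tensor products formed from records that describe the same space.\<close>

lemma bilin_forms_cong:
  "carrier V = carrier V' \<Longrightarrow> smul V = smul V' \<Longrightarrow> carrier W = carrier W' \<Longrightarrow> smul W = smul W' \<Longrightarrow>
    bilin_forms V W = bilin_forms V' W'"
  by (simp add: bilin_forms_def bilin_map_def lin_map_def)

lemma tensor_cong:
  assumes "carrier V = carrier V'" "smul V = smul V'" "carrier W = carrier W'" "smul W = smul W'"
  shows "tensor V W = tensor V' W'" "tens V W = tens V' W'"
  using bilin_forms_cong[OF assms] assms by (simp_all add: tensor_def tens_def fun_eq_iff)

lemma lin_map_cong':
  assumes "carrier V = carrier V'" "smul V = smul V'" "carrier W = carrier W'" "smul W = smul W'"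
  shows "lin_map V W = lin_map V' W'"
  using assms by (simp add: lin_map_def fun_eq_iff)

lemma tlift_cong:
  assumes "carrier V = carrier V'" "smul V = smul V'" "carrier W = carrier W'" "smul W = smul W'"
    and "carrier U = carrier U'" "smul U = smul U'"
  shows "tlift V W U = tlift V' W' U'"
  by (simp add: tlift_def tens_lift_def fun_eq_iff assms(1,3) bilin_forms_cong[OF assms(1-4)]
      lin_map_cong'[OF refl refl assms(5,6)])

text \<open>The rules \<open>sweq\<close>, together with \<open>lin\<close> for their side conditions, compute: they turn the maps
  \<open>tlift\<close> of the definitions into sums \<open>sw\<close>, flatten a sum over a sum, and evaluate a sum over a
  pure tensor.\<close>

named_theorems sweq

lemma tlift_sw [sweq]:
  assumes "\<And>x y. x \<in> carrier V \<Longrightarrow> y \<in> carrier W \<Longrightarrow> g x y = g' x y"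
    and "bil V W U (\<lambda>x y. g' x y)" "t \<in> carrier (tensor V W)" "vecsp U" "vecsp V"
  shows "tlift V W U (\<lambda>(x, y). g x y) t = sw V W t (\<lambda>x y. g' x y)"
proof -
  have "tlift V W U (\<lambda>(x, y). g x y) t = tlift V W U (\<lambda>(x, y). g' x y) t"
    using assms(1) by (simp add: tlift_def tens_lift_def)
  then show ?thesis using assms by (simp add: tlift_eq_sw)
qed

lemma sw_sw_eq [sweq]:
  assumes "bil V W U (\<lambda>a b. g a b)" "\<And>c d. c \<in> carrier X \<Longrightarrow> d \<in> carrier Y \<Longrightarrow> T c d \<in> carrier (tensor V W)"
    and "\<And>c d. c \<in> carrier X \<Longrightarrow> d \<in> carrier Y \<Longrightarrow> sw V W (T c d) (\<lambda>a b. g a b) = h c d"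
    and "vecsp U" "vecsp V" "vecsp X"
  shows "sw V W (sw X Y s (\<lambda>c d. T c d)) (\<lambda>a b. g a b) = sw X Y s (\<lambda>c d. h c d)"
  by (subst sw_sw[OF assms(1,2,4-6)]) (auto intro: sw_cong assms)

lemma sw_tens_eq [sweq]:
  assumes "bil V W U (\<lambda>a b. g a b)" "g v w = r" "v \<in> carrier V" "w \<in> carrier W" "vecsp U" "vecsp V"
  shows "sw V W (tens V W v w) (\<lambda>a b. g a b) = r"
  using assms by (simp add: sw_tens)

text \<open>Identities such as the counit axiom hold in \<open>H\<close>; inside a computation they are needed after
  a linear map \<open>g\<close> has been applied.\<close>

lemma sw_smul:
  assumes "lin_map X U g" "sw V W t (\<lambda>a b. smul X (c a b) (h a b)) = x"
    and "\<And>a b. a \<in> carrier V \<Longrightarrow> b \<in> carrier W \<Longrightarrow> h a b \<in> carrier X"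
    and "vecsp X" "vecsp U" "vecsp V"
  shows "sw V W t (\<lambda>a b. smul U (c a b) (g (h a b))) = g x"
proof -
  have "g x = sw V W t (\<lambda>a b. g (smul X (c a b) (h a b)))"
    unfolding assms(2)[symmetric] by (rule lin_map_sw[OF assms(1)]) (assumption | rule assms lin)+
  also have "\<dots> = sw V W t (\<lambda>a b. smul U (c a b) (g (h a b)))"
    by (intro sw_cong lin_map_smul[OF assms(1)] assms)
  finally show ?thesis by simp
qed

section \<open>Hopf algebras\<close>

locale hopf_alg =
  fixes H :: "('k::field, 'h::ab_group_add) hopf"
  assumes H: "hopf_algebra H"
begin

abbreviation hmul (infixl "\<cdot>" 70) where "x \<cdot> y \<equiv> mul H x y"
abbreviation hunit ("\<one>") where "\<one> \<equiv> unt H"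
abbreviation hcounit ("\<epsilon>") where "\<epsilon> \<equiv> counit H"
abbreviation hanti ("\<S>") where "\<S> \<equiv> antipode H"
abbreviation copr ("\<Delta>") where "\<Delta> h g \<equiv> sw H H (comul H h) g"

lemma algebra_H: "algebra H" and coalgebra_H: "coalgebra H"
  using H by (auto simp: hopf_algebra_def)

lemma vecsp_H [lin]: "vecsp H"
  using algebra_H by (simp add: algebra_def)

lemma bil_mul: "bil H H H (\<cdot>)"
  using algebra_H by (simp add: algebra_def)

lemmas lin_mul [lin] = bil_l[OF bil_mul] bil_r[OF bil_mul]
lemmas mul_in [lin] = bil_in[OF bil_mul]

lemma unt_in [lin]: "\<one> \<in> carrier H"
  using algebra_H by (simp add: algebra_def)

lemma mul_unt: "x \<in> carrier H \<Longrightarrow> \<one> \<cdot> x = x" "x \<in> carrier H \<Longrightarrow> x \<cdot> \<one> = x"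
  using algebra_H by (auto simp: algebra_def)

lemma mul_assoc:
  "x \<in> carrier H \<Longrightarrow> y \<in> carrier H \<Longrightarrow> z \<in> carrier H \<Longrightarrow> x \<cdot> y \<cdot> z = x \<cdot> (y \<cdot> z)"
  using algebra_H by (auto simp: algebra_def)

lemma lin_comul0: "lin_map H (tensor H H) (comul H)"
  using coalgebra_H by (simp add: coalgebra_def)

lemma lin_counit0: "lin_map H ground \<epsilon>"
  using coalgebra_H by (simp add: coalgebra_def)

lemma lin_antipode0: "lin_map H H \<S>"
  using H by (simp add: hopf_algebra_def)

lemmas lin_structure [lin] = lin_comp[OF lin_comul0] lin_comp[OF lin_counit0] lin_comp[OF lin_antipode0]
lemmas comul_in [lin] = lin_map_in[OF lin_comul0]
lemmas antipode_in [lin] = lin_map_in[OF lin_antipode0]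

lemma counit_mul: "x \<in> carrier H \<Longrightarrow> y \<in> carrier H \<Longrightarrow> \<epsilon> (x \<cdot> y) = \<epsilon> x * \<epsilon> y"
  and counit_unt: "\<epsilon> \<one> = 1"
  and comul_unt: "comul H \<one> = tens H H \<one> \<one>"
  using H by (auto simp: hopf_algebra_def)

text \<open>The axioms of a Hopf algebra are identities between tensors. From here on they are used in the
  form that results from applying a multilinear map \<open>g\<close> to both sides.\<close>

lemma comul_mul:
  assumes "bil H H U (\<lambda>a b. g a b)" "x \<in> carrier H" "y \<in> carrier H" "vecsp U"
  shows "\<Delta> (x \<cdot> y) (\<lambda>a b. g a b) = \<Delta> x (\<lambda>x1 x2. \<Delta> y (\<lambda>y1 y2. g (x1 \<cdot> y1) (x2 \<cdot> y2)))"
proof -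
  have "comul H (x \<cdot> y) = tlift H H (tensor H H) (\<lambda>(g\<^sub>1, g\<^sub>2). tlift H H (tensor H H)
          (\<lambda>(h\<^sub>1, h\<^sub>2). tens H H (mul H g\<^sub>1 h\<^sub>1) (mul H g\<^sub>2 h\<^sub>2)) (comul H y)) (comul H x)"
    using H assms by (simp add: hopf_algebra_def)
  also have "\<dots> = \<Delta> x (\<lambda>x1 x2. \<Delta> y (\<lambda>y1 y2. tens H H (x1 \<cdot> y1) (x2 \<cdot> y2)))"
    by (assumption | rule sweq assms lin refl)+
  finally show ?thesis
    by (simp only:) (assumption | rule sweq assms lin refl)+
qed

lemma comul_one:
  assumes "bil H H U (\<lambda>a b. g a b)" "vecsp U"
  shows "\<Delta> \<one> (\<lambda>a b. g a b) = g \<one> \<one>"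
  unfolding comul_unt by (assumption | rule sweq assms lin refl)+

lemma coassoc:
  assumes "\<And>b c. b \<in> carrier H \<Longrightarrow> c \<in> carrier H \<Longrightarrow> lin_map H U (\<lambda>a. g a b c)"
    and "\<And>a c. a \<in> carrier H \<Longrightarrow> c \<in> carrier H \<Longrightarrow> lin_map H U (\<lambda>b. g a b c)"
    and "\<And>a b. a \<in> carrier H \<Longrightarrow> b \<in> carrier H \<Longrightarrow> lin_map H U (\<lambda>c. g a b c)"
    and "x \<in> carrier H" "vecsp U"
  shows "\<Delta> x (\<lambda>y c. \<Delta> y (\<lambda>a b. g a b c)) = \<Delta> x (\<lambda>a y. \<Delta> y (\<lambda>b c. g a b c))"
proof -
  let ?T = "tensor H (tensor H H)"
  have 1: "tlift H H ?T (\<lambda>(x, y). tlift H H ?T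
             (\<lambda>(x\<^sub>1, x\<^sub>2). tens H (tensor H H) x\<^sub>1 (tens H H x\<^sub>2 y)) (comul H x)) (comul H x) =
        \<Delta> x (\<lambda>y c. \<Delta> y (\<lambda>a b. tens H (tensor H H) a (tens H H b c)))"
    by (assumption | rule sweq assms lin refl)+
  have 2: "tlift H H ?T (\<lambda>(x, y). tens H (tensor H H) x (comul H y)) (comul H x) =
        \<Delta> x (\<lambda>a y. tens H (tensor H H) a (comul H y))"
    by (assumption | rule sweq assms lin refl)+
  have eq: "\<Delta> x (\<lambda>y c. \<Delta> y (\<lambda>a b. tens H (tensor H H) a (tens H H b c))) =
      \<Delta> x (\<lambda>a y. tens H (tensor H H) a (comul H y))"
    using coalgebra_H \<open>x \<in> carrier H\<close> unfolding coalgebra_def 1[symmetric] 2[symmetric] by blast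
  have "sw H (tensor H H) (\<Delta> x (\<lambda>y c. \<Delta> y (\<lambda>a b. tens H (tensor H H) a (tens H H b c))))
      (\<lambda>a t. sw H H t (\<lambda>b c. g a b c)) = \<Delta> x (\<lambda>y c. \<Delta> y (\<lambda>a b. g a b c))"
    by (assumption | rule sweq assms lin refl)+
  moreover have "sw H (tensor H H) (\<Delta> x (\<lambda>a y. tens H (tensor H H) a (comul H y)))
      (\<lambda>a t. sw H H t (\<lambda>b c. g a b c)) = \<Delta> x (\<lambda>a y. \<Delta> y (\<lambda>b c. g a b c))"
    by (assumption | rule sweq assms lin refl)+
  ultimately show ?thesis unfolding eq by simp
qed

lemma counit_l:
  assumes "lin_map H U (\<lambda>a. g a)" "x \<in> carrier H" "vecsp U"
  shows "\<Delta> x (\<lambda>a b. smul U (\<epsilon> a) (g b)) = g x"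
proof -
  have "tlift H H H (\<lambda>(x, y). smul H (\<epsilon> x) y) (comul H x) = \<Delta> x (\<lambda>a b. smul H (\<epsilon> a) b)"
    by (assumption | rule sweq assms lin refl)+
  then have "\<Delta> x (\<lambda>a b. smul H (\<epsilon> a) b) = x"
    using coalgebra_H \<open>x \<in> carrier H\<close> by (simp add: coalgebra_def)
  from sw_smul[OF assms(1) this _ vecsp_H assms(3) vecsp_H] show ?thesis by simp
qed

lemma counit_r:
  assumes "lin_map H U (\<lambda>a. g a)" "x \<in> carrier H" "vecsp U"
  shows "\<Delta> x (\<lambda>a b. smul U (\<epsilon> b) (g a)) = g x"
proof -
  have "tlift H H H (\<lambda>(x, y). smul H (\<epsilon> y) x) (comul H x) = \<Delta> x (\<lambda>a b. smul H (\<epsilon> b) a)"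
    by (assumption | rule sweq assms lin refl)+
  then have "\<Delta> x (\<lambda>a b. smul H (\<epsilon> b) a) = x"
    using coalgebra_H \<open>x \<in> carrier H\<close> by (simp add: coalgebra_def)
  from sw_smul[OF assms(1) this _ vecsp_H assms(3) vecsp_H] show ?thesis by simp
qed

lemma antipode_l:
  assumes "lin_map H U (\<lambda>a. g a)" "x \<in> carrier H" "vecsp U"
  shows "\<Delta> x (\<lambda>a b. g (\<S> a \<cdot> b)) = smul U (\<epsilon> x) (g \<one>)"
proof -
  have "tlift H H H (\<lambda>(x, y). \<S> x \<cdot> y) (comul H x) = \<Delta> x (\<lambda>a b. \<S> a \<cdot> b)"
    by (assumption | rule sweq assms lin refl)+
  then have "smul H (\<epsilon> x) \<one> = \<Delta> x (\<lambda>a b. \<S> a \<cdot> b)"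
    using H \<open>x \<in> carrier H\<close> by (simp add: hopf_algebra_def)
  then have "g (smul H (\<epsilon> x) \<one>) = g (\<Delta> x (\<lambda>a b. \<S> a \<cdot> b))" by simp
  also have "\<dots> = \<Delta> x (\<lambda>a b. g (\<S> a \<cdot> b))"
    by (rule lin_map_sw[OF assms(1)]) (assumption | rule assms lin)+
  finally show ?thesis by (simp add: lin_map_smul[OF assms(1)] unt_in)
qed

lemma antipode_r:
  assumes "lin_map H U (\<lambda>a. g a)" "x \<in> carrier H" "vecsp U"
  shows "\<Delta> x (\<lambda>a b. g (a \<cdot> \<S> b)) = smul U (\<epsilon> x) (g \<one>)"
proof -
  have "tlift H H H (\<lambda>(x, y). x \<cdot> \<S> y) (comul H x) = \<Delta> x (\<lambda>a b. a \<cdot> \<S> b)"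
    by (assumption | rule sweq assms lin refl)+
  then have "smul H (\<epsilon> x) \<one> = \<Delta> x (\<lambda>a b. a \<cdot> \<S> b)"
    using H \<open>x \<in> carrier H\<close> by (simp add: hopf_algebra_def)
  then have "g (smul H (\<epsilon> x) \<one>) = g (\<Delta> x (\<lambda>a b. a \<cdot> \<S> b))" by simp
  also have "\<dots> = \<Delta> x (\<lambda>a b. g (a \<cdot> \<S> b))"
    by (rule lin_map_sw[OF assms(1)]) (assumption | rule assms lin)+
  finally show ?thesis by (simp add: lin_map_smul[OF assms(1)] unt_in)
qed

end

section \<open>Yetter-Drinfeld modules\<close>

text \<open>The space and its two structure maps are separate parameters, not a record: a tensor power then
  is the same space \<open>V\<close> in all statements, whichever record it came with.\<close>

locale yd_mod = hopf_alg H
  for H :: "('k::field, 'h::ab_group_add) hopf" +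
  fixes V :: "('k, 'v::ab_group_add, 'z) vecsp_scheme"
    and \<alpha> :: "'h \<Rightarrow> 'v \<Rightarrow> 'v" and \<delta> :: "'v \<Rightarrow> ('k, 'h \<times> 'v) tens"
  assumes vecsp_V [lin]: "vecsp V"
    and bil_act: "bil H V V \<alpha>"
    and act_one: "v \<in> carrier V \<Longrightarrow> \<alpha> \<one> v = v"
    and act_mul: "x \<in> carrier H \<Longrightarrow> y \<in> carrier H \<Longrightarrow> v \<in> carrier V \<Longrightarrow> \<alpha> (x \<cdot> y) v = \<alpha> x (\<alpha> y v)"
    and lin_coact0: "lin_map V (tensor H V) \<delta>"
    and coassoc_tens: "v \<in> carrier V \<Longrightarrow>
      sw H V (\<delta> v) (\<lambda>a w. \<Delta> a (\<lambda>b c. tens H (tensor H V) b (tens H V c w))) =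
      sw H V (\<delta> v) (\<lambda>a w. tens H (tensor H V) a (\<delta> w))"
    and counit_id: "v \<in> carrier V \<Longrightarrow> sw H V (\<delta> v) (\<lambda>a w. smul V (\<epsilon> a) w) = v"
    and yd_tens: "x \<in> carrier H \<Longrightarrow> v \<in> carrier V \<Longrightarrow>
      \<Delta> x (\<lambda>y z. sw H V (\<delta> (\<alpha> y v)) (\<lambda>a w. tens H V (a \<cdot> z) w)) =
      \<Delta> x (\<lambda>y z. sw H V (\<delta> v) (\<lambda>a w. tens H V (y \<cdot> a) (\<alpha> z w)))"
begin

lemmas lin_act [lin] = bil_l[OF bil_act] bil_r[OF bil_act]
lemmas act_in [lin] = bil_in[OF bil_act]
lemmas lin_coact [lin] = lin_comp[OF lin_coact0]
lemmas coact_in [lin] = lin_map_in[OF lin_coact0]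

lemma coact_coassoc:
  assumes "\<And>b c. b \<in> carrier H \<Longrightarrow> c \<in> carrier V \<Longrightarrow> lin_map H U (\<lambda>a. g a b c)"
    and "\<And>a c. a \<in> carrier H \<Longrightarrow> c \<in> carrier V \<Longrightarrow> lin_map H U (\<lambda>b. g a b c)"
    and "\<And>a b. a \<in> carrier H \<Longrightarrow> b \<in> carrier H \<Longrightarrow> lin_map V U (\<lambda>c. g a b c)"
    and "v \<in> carrier V" "vecsp U"
  shows "sw H V (\<delta> v) (\<lambda>y c. \<Delta> y (\<lambda>a b. g a b c)) = sw H V (\<delta> v) (\<lambda>a y. sw H V (\<delta> y) (\<lambda>b c. g a b c))"
proof -
  have "sw H (tensor H V) (sw H V (\<delta> v) (\<lambda>y c. \<Delta> y (\<lambda>a b. tens H (tensor H V) a (tens H V b c))))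
      (\<lambda>a t. sw H V t (\<lambda>b c. g a b c)) = sw H V (\<delta> v) (\<lambda>y c. \<Delta> y (\<lambda>a b. g a b c))"
    by (assumption | rule sweq assms lin refl)+
  moreover have "sw H (tensor H V) (sw H V (\<delta> v) (\<lambda>a y. tens H (tensor H V) a (\<delta> y)))
      (\<lambda>a t. sw H V t (\<lambda>b c. g a b c)) = sw H V (\<delta> v) (\<lambda>a y. sw H V (\<delta> y) (\<lambda>b c. g a b c))"
    by (assumption | rule sweq assms lin refl)+
  ultimately show ?thesis unfolding coassoc_tens[OF \<open>v \<in> carrier V\<close>] by simp
qed

lemma coact_counit:
  assumes "lin_map V U (\<lambda>a. g a)" "v \<in> carrier V" "vecsp U"
  shows "sw H V (\<delta> v) (\<lambda>a w. smul U (\<epsilon> a) (g w)) = g v"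
  by (rule sw_smul[OF assms(1) counit_id[OF assms(2)]]) (assumption | rule assms lin)+

lemma yd_compat:
  assumes "bil H V U (\<lambda>a w. g a w)" "x \<in> carrier H" "v \<in> carrier V" "vecsp U"
  shows "\<Delta> x (\<lambda>y z. sw H V (\<delta> (\<alpha> y v)) (\<lambda>a w. g (a \<cdot> z) w)) =
      \<Delta> x (\<lambda>y z. sw H V (\<delta> v) (\<lambda>a w. g (y \<cdot> a) (\<alpha> z w)))"
proof -
  have "sw H V (\<Delta> x (\<lambda>y z. sw H V (\<delta> (\<alpha> y v)) (\<lambda>a w. tens H V (a \<cdot> z) w))) g =
      \<Delta> x (\<lambda>y z. sw H V (\<delta> (\<alpha> y v)) (\<lambda>a w. g (a \<cdot> z) w))"
    by (assumption | rule sweq assms lin refl)+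
  moreover have "sw H V (\<Delta> x (\<lambda>y z. sw H V (\<delta> v) (\<lambda>a w. tens H V (y \<cdot> a) (\<alpha> z w)))) g =
      \<Delta> x (\<lambda>y z. sw H V (\<delta> v) (\<lambda>a w. g (y \<cdot> a) (\<alpha> z w)))"
    by (assumption | rule sweq assms lin refl)+
  ultimately show ?thesis unfolding yd_tens[OF assms(2,3)] by simp
qed

end

context hopf_alg
begin

lemma yd_mod_trivial:
  assumes V: "vecsp V"
  shows "yd_mod H V (\<lambda>x. smul V (\<epsilon> x)) (tens H V \<one>)"
proof unfold_locales
  show "vecsp V" by fact
  show "bil H V V (\<lambda>x. smul V (\<epsilon> x))" by (assumption | rule V lin)+
  show "lin_map V (tensor H V) (tens H V \<one>)" by (assumption | rule V lin)+
  fix v assume v: "v \<in> carrier V"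
  show "smul V (\<epsilon> \<one>) v = v" by (simp add: counit_unt smul_simps V)
  show "smul V (\<epsilon> (x \<cdot> y)) v = smul V (\<epsilon> x) (smul V (\<epsilon> y) v)"
    if "x \<in> carrier H" "y \<in> carrier H" for x y
    using that by (simp add: counit_mul smul_simps V)
  let ?T = "tensor H (tensor H V)"
  have "sw H V (tens H V \<one> v) (\<lambda>a w. \<Delta> a (\<lambda>b c. tens H (tensor H V) b (tens H V c w))) =
      \<Delta> \<one> (\<lambda>b c. tens H (tensor H V) b (tens H V c v))" (is "?l = _")
    by (assumption | rule sweq v V lin refl)+
  also have "\<dots> = tens H (tensor H V) \<one> (tens H V \<one> v)"
    by (rule comul_one[where U = ?T]) (assumption | rule v V lin)+
  also have "\<dots> = sw H V (tens H V \<one> v) (\<lambda>a w. tens H (tensor H V) a (tens H V \<one> w))"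
    by (rule sym) (assumption | rule sweq v V lin refl)+
  finally show "?l = \<dots>" .
  have "sw H V (tens H V \<one> v) (\<lambda>a w. smul V (\<epsilon> a) w) = smul V (\<epsilon> \<one>) v"
    by (assumption | rule sweq v V lin refl)+
  then show "sw H V (tens H V \<one> v) (\<lambda>a w. smul V (\<epsilon> a) w) = v"
    by (simp add: counit_unt smul_simps V)
  fix x assume x: "x \<in> carrier H"
  have "\<Delta> x (\<lambda>y z. sw H V (tens H V \<one> (smul V (\<epsilon> y) v)) (\<lambda>a w. tens H V (a \<cdot> z) w)) =
      \<Delta> x (\<lambda>y z. tens H V (\<one> \<cdot> z) (smul V (\<epsilon> y) v))" (is "?l = _")
    by (rule sw_cong) (assumption | rule sweq v V x lin refl)+
  also have "\<dots> = \<Delta> x (\<lambda>y z. smul (tensor H V) (\<epsilon> y) (tens H V z v))"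
    by (rule sw_cong) (simp_all add: mul_unt lin_map_smul[OF lin_tens_r[OF _ lin_id]] v vecsp_H)
  also have "\<dots> = tens H V x v"
    by (rule counit_l) (assumption | rule v V x lin)+
  also have "\<dots> = \<Delta> x (\<lambda>y z. smul (tensor H V) (\<epsilon> z) (tens H V y v))"
    by (rule sym, rule counit_r) (assumption | rule v V x lin)+
  also have "\<dots> = \<Delta> x (\<lambda>y z. tens H V (y \<cdot> \<one>) (smul V (\<epsilon> z) v))"
    by (rule sw_cong) (simp_all add: mul_unt lin_map_smul[OF lin_tens_r[OF _ lin_id]] v vecsp_H)
  also have "\<dots> = \<Delta> x (\<lambda>y z. sw H V (tens H V \<one> v) (\<lambda>a w. tens H V (y \<cdot> a) (smul V (\<epsilon> z) w)))"
    by (rule sym, rule sw_cong) (assumption | rule sweq v V x lin refl)+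
  finally show "?l = \<dots>" .
qed

end

definition tact where
  "tact H V \<alpha> W \<beta> x z =
     sw V W z (\<lambda>v w. sw H H (comul H x) (\<lambda>y z. tens V W (\<alpha> y v) (\<beta> z w)))"

definition tcoact where
  "tcoact H V \<delta> W \<gamma> z = sw V W z (\<lambda>v w. sw H V (\<delta> v) (\<lambda>a v0. sw H W (\<gamma> w) (\<lambda>b w0.
     tens H (tensor V W) (mul H a b) (tens V W v0 w0))))"

locale yd_mod_pair = hopf_alg H + V: yd_mod H V \<alpha> \<delta> + W: yd_mod H W \<beta> \<gamma>
  for H :: "('k::field, 'h::ab_group_add) hopf"
    and V :: "('k, 'v::ab_group_add, 'y) vecsp_scheme" and \<alpha> \<delta>
    and W :: "('k, 'w::ab_group_add, 'z) vecsp_scheme" and \<beta> \<gamma>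
begin

abbreviation VW where "VW \<equiv> tensor V W"
abbreviation act2 where "act2 \<equiv> tact H V \<alpha> W \<beta>"
abbreviation coact2 where "coact2 \<equiv> tcoact H V \<delta> W \<gamma>"

lemma bil_act2: "bil H VW VW act2"
  unfolding tact_def by (assumption | rule lin)+

lemma lin_coact2: "lin_map VW (tensor H VW) coact2"
  unfolding tcoact_def by (assumption | rule lin)+

lemmas act2_lin [lin] = bil_l[OF bil_act2] bil_r[OF bil_act2] bil_in[OF bil_act2]
lemmas coact2_lin [lin] = lin_comp[OF lin_coact2] lin_map_in[OF lin_coact2]

lemma act2_tens:
  assumes "x \<in> carrier H" "v \<in> carrier V" "w \<in> carrier W"
  shows "act2 x (tens V W v w) = \<Delta> x (\<lambda>y z. tens V W (\<alpha> y v) (\<beta> z w))"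
  unfolding tact_def by (assumption | rule sweq assms lin refl)+

lemma coact2_tens:
  assumes "v \<in> carrier V" "w \<in> carrier W"
  shows "coact2 (tens V W v w) = sw H V (\<delta> v) (\<lambda>a v0. sw H W (\<gamma> w) (\<lambda>b w0.
     tens H (tensor V W) (mul H a b) (tens V W v0 w0)))"
  unfolding tcoact_def by (assumption | rule sweq assms lin refl)+

lemma sw_coact2_tens:
  assumes "v \<in> carrier V" "w \<in> carrier W" "bil H VW U (\<lambda>a s. g a s)" "vecsp U"
  shows "sw H VW (coact2 (tens V W v w)) (\<lambda>a s. g a s) =
    sw H V (\<delta> v) (\<lambda>a v0. sw H W (\<gamma> w) (\<lambda>b w0. g (a \<cdot> b) (tens V W v0 w0)))"
  unfolding coact2_tens[OF assms(1,2)] by (assumption | rule sweq assms lin refl)+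

lemma act2_one: 
  assumes "s \<in> carrier VW"
  shows "act2 \<one> s = s"
proof (rule tensor_ext[where U = VW, OF _ _ _ assms], ((assumption | rule lin)+)[2])
  fix v w assume vw: "v \<in> carrier V" "w \<in> carrier W"
  have "act2 \<one> (tens V W v w) = \<Delta> \<one> (\<lambda>y z. tens V W (\<alpha> y v) (\<beta> z w))"
    by (rule act2_tens) (assumption | rule vw lin)+
  also have "\<dots> = tens V W (\<alpha> \<one> v) (\<beta> \<one> w)"
    by (rule comul_one[where U = VW]) (assumption | rule vw lin)+
  finally show "act2 \<one> (tens V W v w) = tens V W v w" by (simp add: V.act_one W.act_one vw)
qed (rule lin)

lemma act2_mul: 
  assumes "s \<in> carrier VW" and x: "x \<in> carrier H" and y: "y \<in> carrier H"
  shows "act2 (x \<cdot> y) s = act2 x (act2 y s)"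
proof (rule tensor_ext[where U = VW, OF _ _ _ assms(1)], ((assumption | rule x y lin)+)[2])
  fix v w assume vw: "v \<in> carrier V" "w \<in> carrier W"
  have "act2 (x \<cdot> y) (tens V W v w) = \<Delta> (x \<cdot> y) (\<lambda>a b. tens V W (\<alpha> a v) (\<beta> b w))"
    by (rule act2_tens) (assumption | rule x y vw lin)+
  also have "\<dots> = \<Delta> x (\<lambda>a b. \<Delta> y (\<lambda>c d. tens V W (\<alpha> (a \<cdot> c) v) (\<beta> (b \<cdot> d) w)))"
    by (rule comul_mul) (assumption | rule x y vw lin)+
  also have "\<dots> = \<Delta> x (\<lambda>a b. \<Delta> y (\<lambda>c d. tens V W (\<alpha> a (\<alpha> c v)) (\<beta> b (\<beta> d w))))"
    by (intro sw_cong vecsp_H) (simp add: V.act_mul W.act_mul vw)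
  also have "\<dots> = \<Delta> y (\<lambda>c d. \<Delta> x (\<lambda>a b. tens V W (\<alpha> a (\<alpha> c v)) (\<beta> b (\<beta> d w))))"
    by (rule sw_swap)
  also have "\<dots> = \<Delta> y (\<lambda>c d. act2 x (tens V W (\<alpha> c v) (\<beta> d w)))"
    by (rule sw_cong, rule sym, rule act2_tens) (assumption | rule x y vw lin)+
  also have "\<dots> = act2 x (\<Delta> y (\<lambda>c d. tens V W (\<alpha> c v) (\<beta> d w)))"
    by (rule sym, rule lin_map_sw[where U = VW]) (assumption | rule x y vw lin)+
  also have "\<dots> = act2 x (act2 y (tens V W v w))"
    using vw y by (simp add: act2_tens)
  finally show "act2 (x \<cdot> y) (tens V W v w) = \<dots>" .
qed (rule lin)

text \<open>Multiplicativity of the comultiplication separates the two factors; coassociativity of \<open>W\<close> and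
  of \<open>V\<close> is then applied to each of them.\<close>

lemma coact2_coassoc: 
  assumes s: "s \<in> carrier VW"
  shows "sw H VW (coact2 s) (\<lambda>a w. \<Delta> a (\<lambda>b c. tens H (tensor H VW) b (tens H VW c w))) =
         sw H VW (coact2 s) (\<lambda>a w. tens H (tensor H VW) a (coact2 w))"
proof (rule tensor_ext[OF _ _ _ s])
  let ?T = "tensor H (tensor H VW)"
  let ?t = "\<lambda>a b v w. tens H (tensor H VW) a (tens H VW b (tens V W v w))"
  show "lin_map VW ?T (\<lambda>s. sw H VW (coact2 s) (\<lambda>a w. \<Delta> a (\<lambda>b c. tens H (tensor H VW) b (tens H VW c w))))"
    "lin_map VW ?T (\<lambda>s. sw H VW (coact2 s) (\<lambda>a w. tens H (tensor H VW) a (coact2 w)))" 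
    by (assumption | rule lin)+
  fix v w assume vw: "v \<in> carrier V" "w \<in> carrier W"
  have "sw H VW (coact2 (tens V W v w)) (\<lambda>a w. \<Delta> a (\<lambda>b c. tens H (tensor H VW) b (tens H VW c w))) =
    sw H V (\<delta> v) (\<lambda>a v. sw H W (\<gamma> w) (\<lambda>b w. \<Delta> (a \<cdot> b) (\<lambda>c d. ?t c d v w)))" (is "?l = _")
    by (rule sw_coact2_tens) (assumption | rule vw lin)+
  also have "\<dots> = sw H V (\<delta> v) (\<lambda>a v. sw H W (\<gamma> w) (\<lambda>b w.
      \<Delta> a (\<lambda>a1 a2. \<Delta> b (\<lambda>b1 b2. ?t (a1 \<cdot> b1) (a2 \<cdot> b2) v w))))"
    by (intro sw_cong, rule comul_mul) (assumption | rule vw lin)+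
  also have "\<dots> = sw H V (\<delta> v) (\<lambda>a v. \<Delta> a (\<lambda>a1 a2. sw H W (\<gamma> w) (\<lambda>b w.
      \<Delta> b (\<lambda>b1 b2. ?t (a1 \<cdot> b1) (a2 \<cdot> b2) v w))))"
    by (subst sw_swap) (rule refl)
  also have "\<dots> = sw H V (\<delta> v) (\<lambda>a v. \<Delta> a (\<lambda>a1 a2. sw H W (\<gamma> w) (\<lambda>b1 w. sw H W (\<gamma> w)
      (\<lambda>b2 w. ?t (a1 \<cdot> b1) (a2 \<cdot> b2) v w))))"
    by (rule sw_cong, rule sw_cong, rule W.coact_coassoc) (assumption | rule vw lin)+
  also have "\<dots> = sw H V (\<delta> v) (\<lambda>a1 v. sw H V (\<delta> v) (\<lambda>a2 v. sw H W (\<gamma> w) (\<lambda>b1 w. sw H W (\<gamma> w)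
      (\<lambda>b2 w. ?t (a1 \<cdot> b1) (a2 \<cdot> b2) v w))))"
    by (rule V.coact_coassoc[where U = ?T]) (assumption | rule vw lin)+
  also have "\<dots> = sw H V (\<delta> v) (\<lambda>a1 v. sw H W (\<gamma> w) (\<lambda>b1 w. sw H V (\<delta> v) (\<lambda>a2 v. sw H W (\<gamma> w)
      (\<lambda>b2 w. ?t (a1 \<cdot> b1) (a2 \<cdot> b2) v w))))"
    by (subst sw_swap) (rule refl)
  also have "\<dots> = sw H V (\<delta> v) (\<lambda>a1 v. sw H W (\<gamma> w) (\<lambda>b1 w. 
      tens H (tensor H VW) (a1 \<cdot> b1) (coact2 (tens V W v w))))"
  proof (intro sw_cong)
    fix a v b w assume *: "a \<in> carrier H" "v \<in> carrier V" "b \<in> carrier H" "w \<in> carrier W"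
    show "sw H V (\<delta> v) (\<lambda>a2 v. sw H W (\<gamma> w) (\<lambda>b2 w. ?t (a \<cdot> b) (a2 \<cdot> b2) v w)) =
       tens H (tensor H VW) (a \<cdot> b) (coact2 (tens V W v w))"
      unfolding coact2_tens[OF *(2,4)]
      by (subst lin_map_sw[where U = "tensor H VW" and U' = ?T], (assumption | rule * lin)+,
          rule sw_cong, subst lin_map_sw[where U = "tensor H VW" and U' = ?T],
          (assumption | rule * lin refl)+)
  qed (rule lin)+
  also have "\<dots> = sw H VW (coact2 (tens V W v w)) (\<lambda>a w. tens H (tensor H VW) a (coact2 w))"
    by (rule sym, rule sw_coact2_tens) (assumption | rule vw lin)+
  finally show "?l = \<dots>" .
qed (rule lin)

lemma coact2_counit:
  assumes s: "s \<in> carrier VW"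
  shows "sw H VW (coact2 s) (\<lambda>a w. smul VW (\<epsilon> a) w) = s"
proof (rule tensor_ext[where U = VW, OF _ _ _ s], ((assumption | rule lin)+)[2])
  fix v w assume vw: "v \<in> carrier V" "w \<in> carrier W"
  have "sw H VW (coact2 (tens V W v w)) (\<lambda>a w. smul VW (\<epsilon> a) w) =
     sw H V (\<delta> v) (\<lambda>a v. sw H W (\<gamma> w) (\<lambda>b w. smul VW (\<epsilon> (a \<cdot> b)) (tens V W v w)))" (is "?l = _")
    by (rule sw_coact2_tens) (assumption | rule vw lin)+
  also have "\<dots> = sw H V (\<delta> v) (\<lambda>a v. sw H W (\<gamma> w) (\<lambda>b w. smul VW (\<epsilon> b) (smul VW (\<epsilon> a) (tens V W v w))))"
    by (intro sw_cong vecsp_H) (simp add: counit_mul smul_simps(3)[OF vecsp_tensor, of V W, simplified] mult.commute)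
  also have "\<dots> = sw H V (\<delta> v) (\<lambda>a v. smul VW (\<epsilon> a) (tens V W v w))"
    by (intro sw_cong, rule W.coact_counit) (assumption | rule vw lin)+
  also have "\<dots> = tens V W v w"
    by (rule V.coact_counit) (assumption | rule vw lin)+
  finally show "?l = tens V W v w" .
qed (rule lin)

text \<open>With \<open>h\<^sub>1 \<otimes> h\<^sub>2 \<otimes> h\<^sub>3\<close> distributed over \<open>v\<close>, \<open>w\<close> and the right end, the condition for \<open>W\<close> moves
  \<open>h\<^sub>3\<close> between the coefficients of \<open>v\<close> and \<open>w\<close>, and the condition for \<open>V\<close> moves it on to the left
  end. Coassociativity regroups the three factors before each step.\<close>

lemma yd2:
  assumes s: "s \<in> carrier VW" and x: "x \<in> carrier H"
  shows "\<Delta> x (\<lambda>y z. sw H VW (coact2 (act2 y s)) (\<lambda>a w. tens H VW (a \<cdot> z) w)) =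
      \<Delta> x (\<lambda>y z. sw H VW (coact2 s) (\<lambda>a w. tens H VW (y \<cdot> a) (act2 z w)))"
proof (rule tensor_ext[OF _ _ _ s])
  let ?T = "tensor H VW"
  show "lin_map VW ?T (\<lambda>s. \<Delta> x (\<lambda>y z. sw H VW (coact2 (act2 y s)) (\<lambda>a w. tens H VW (a \<cdot> z) w)))"
     "lin_map VW ?T (\<lambda>s. \<Delta> x (\<lambda>y z. sw H VW (coact2 s) (\<lambda>a w. tens H VW (y \<cdot> a) (act2 z w))))"
    by (assumption | rule x lin)+
  fix v w assume vw: "v \<in> carrier V" "w \<in> carrier W"
  let ?t = "\<lambda>a v w. tens H VW a (tens V W v w)"
  have "\<Delta> x (\<lambda>y z. sw H VW (coact2 (act2 y (tens V W v w))) (\<lambda>a w. tens H VW (a \<cdot> z) w)) =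
    \<Delta> x (\<lambda>y z. \<Delta> y (\<lambda>y1 y2. sw H V (\<delta> (\<alpha> y1 v)) (\<lambda>a v. sw H W (\<gamma> (\<beta> y2 w)) (\<lambda>b w. ?t (a \<cdot> b \<cdot> z) v w))))" (is "?l = _")
  proof (rule sw_cong)
    fix y z assume yz: "y \<in> carrier H" "z \<in> carrier H"
    have "sw H VW (coact2 (\<Delta> y (\<lambda>y z. tens V W (\<alpha> y v) (\<beta> z w)))) (\<lambda>a w. tens H VW (a \<cdot> z) w) =
       \<Delta> y (\<lambda>y1 y2. sw H VW (coact2 (tens V W (\<alpha> y1 v) (\<beta> y2 w))) (\<lambda>a w. tens H VW (a \<cdot> z) w))"
      by (rule lin_map_sw[where U = VW and U' = ?T]) (assumption | rule vw yz lin)+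
    also have "\<dots> = \<Delta> y (\<lambda>y1 y2. sw H V (\<delta> (\<alpha> y1 v)) (\<lambda>a v. sw H W (\<gamma> (\<beta> y2 w)) (\<lambda>b w. ?t (a \<cdot> b \<cdot> z) v w)))"
      by (intro sw_cong, rule sw_coact2_tens) (assumption | rule vw yz lin)+
    finally show "sw H VW (coact2 (act2 y (tens V W v w))) (\<lambda>a w. tens H VW (a \<cdot> z) w) = \<dots>"
      using yz vw by (simp add: act2_tens)
  qed (rule lin)
  also have "\<dots> = \<Delta> x (\<lambda>y z. \<Delta> z (\<lambda>z1 z2. sw H V (\<delta> (\<alpha> y v)) (\<lambda>a v. sw H W (\<gamma> (\<beta> z1 w)) (\<lambda>b w. ?t (a \<cdot> b \<cdot> z2) v w))))"
    by (rule coassoc[where U = ?T]) (assumption | rule vw x lin)+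
  also have "\<dots> = \<Delta> x (\<lambda>y z. sw H V (\<delta> (\<alpha> y v)) (\<lambda>a v. \<Delta> z (\<lambda>z1 z2. sw H W (\<gamma> (\<beta> z1 w)) (\<lambda>b w. ?t (a \<cdot> (b \<cdot> z2)) v w))))"
    by (subst (2) sw_swap, intro sw_cong vecsp_H) (simp add: mul_assoc)
  also have "\<dots> = \<Delta> x (\<lambda>y z. sw H V (\<delta> (\<alpha> y v)) (\<lambda>a v. \<Delta> z (\<lambda>z1 z2. sw H W (\<gamma> w) (\<lambda>b w. ?t (a \<cdot> (z1 \<cdot> b)) v (\<beta> z2 w)))))"
    by (rule sw_cong, rule sw_cong, rule W.yd_compat[where U = ?T]) (assumption | rule vw x lin)+
  also have "\<dots> = \<Delta> x (\<lambda>y z. \<Delta> z (\<lambda>z1 z2. sw H V (\<delta> (\<alpha> y v)) (\<lambda>a v. sw H W (\<gamma> w) (\<lambda>b w. ?t (a \<cdot> z1 \<cdot> b) v (\<beta> z2 w)))))"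
    by (subst (2) sw_swap, intro sw_cong vecsp_H) (simp add: mul_assoc)
  also have "\<dots> = \<Delta> x (\<lambda>y z. \<Delta> y (\<lambda>y1 y2. sw H V (\<delta> (\<alpha> y1 v)) (\<lambda>a v. sw H W (\<gamma> w) (\<lambda>b w. ?t (a \<cdot> y2 \<cdot> b) v (\<beta> z w)))))"
    by (rule sym, rule coassoc[where U = ?T]) (assumption | rule vw x lin)+
  also have "\<dots> = \<Delta> x (\<lambda>y z. \<Delta> y (\<lambda>y1 y2. sw H V (\<delta> v) (\<lambda>a v. sw H W (\<gamma> w) (\<lambda>b w. ?t (y1 \<cdot> a \<cdot> b) (\<alpha> y2 v) (\<beta> z w)))))"
    by (rule sw_cong, rule V.yd_compat[where U = ?T]) (assumption | rule vw x lin)+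
  also have "\<dots> = \<Delta> x (\<lambda>y z. \<Delta> z (\<lambda>z1 z2. sw H V (\<delta> v) (\<lambda>a v. sw H W (\<gamma> w) (\<lambda>b w. ?t (y \<cdot> a \<cdot> b) (\<alpha> z1 v) (\<beta> z2 w)))))"
    by (rule coassoc[where U = ?T]) (assumption | rule vw x lin)+
  also have "\<dots> = \<Delta> x (\<lambda>y z. sw H V (\<delta> v) (\<lambda>a v. sw H W (\<gamma> w) (\<lambda>b w. \<Delta> z (\<lambda>z1 z2. ?t (y \<cdot> a \<cdot> b) (\<alpha> z1 v) (\<beta> z2 w)))))"
    by (rule sw_cong, subst sw_swap, rule sw_cong, rule sw_swap) (rule lin)+
  also have "\<dots> = \<Delta> x (\<lambda>y z. sw H V (\<delta> v) (\<lambda>a v. sw H W (\<gamma> w) (\<lambda>b w. tens H VW (y \<cdot> (a \<cdot> b)) (act2 z (tens V W v w)))))"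
  proof (intro sw_cong)
    fix y z a v b w assume *: "y \<in> carrier H" "z \<in> carrier H" "a \<in> carrier H" "v \<in> carrier V" "b \<in> carrier H" "w \<in> carrier W"
    show "\<Delta> z (\<lambda>z1 z2. ?t (y \<cdot> a \<cdot> b) (\<alpha> z1 v) (\<beta> z2 w)) = tens H VW (y \<cdot> (a \<cdot> b)) (act2 z (tens V W v w))"
      unfolding act2_tens[OF *(2,4,6)] mul_assoc[OF *(1,3,5), symmetric]
      by (rule sym, rule lin_map_sw[where U = VW and U' = ?T]) (assumption | rule * lin)+
  qed (rule lin)+
  also have "\<dots> = \<Delta> x (\<lambda>y z. sw H VW (coact2 (tens V W v w)) (\<lambda>a w. tens H VW (y \<cdot> a) (act2 z w)))"
    by (rule sw_cong, rule sym, rule sw_coact2_tens) (assumption | rule vw x lin)+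
  finally show "?l = \<dots>" .
qed (rule lin)

lemma yd_mod_tensor: "yd_mod H VW act2 coact2"
  by (unfold_locales)
    (assumption | rule vecsp_tensor bil_act2 lin_coact2 act2_one act2_mul coact2_coassoc coact2_counit yd2)+

end

section \<open>Morphisms of Yetter-Drinfeld modules\<close>

lemma sw_map:
  assumes "lin_map V X f" "bil V' X U (\<lambda>a w. g a w)" "vecsp U" "vecsp V'"
  shows "sw V' X (sw V' V t (\<lambda>a w. tens V' X a (f w))) (\<lambda>a w. g a w) = sw V' V t (\<lambda>a w. g a (f w))"
  by (assumption | rule sweq assms lin_map_in[OF assms(1)] lin refl)+

context yd_mod
begin

text \<open>Maps defined by \<open>tlift\<close> have unspecified values outside the carrier, so the structure maps of
  the tensor powers can only be identified with computed ones on the carrier.\<close>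

lemma yd_mod_cong:
  assumes \<alpha>': "\<And>x v. x \<in> carrier H \<Longrightarrow> v \<in> carrier V \<Longrightarrow> \<alpha>' x v = \<alpha> x v"
    and \<delta>': "\<And>v. v \<in> carrier V \<Longrightarrow> \<delta>' v = \<delta> v"
  shows "yd_mod H V \<alpha>' \<delta>'"
proof unfold_locales
  show "vecsp V" by (rule lin)
  show "bil H V V \<alpha>'"
    by (rule bilI; rule lin_map_cong[rotated 2], rule \<alpha>'[symmetric]) (assumption | rule lin)+
  show "lin_map V (tensor H V) \<delta>'"
    by (rule lin_map_cong[rotated 2], rule \<delta>'[symmetric]) (assumption | rule lin)+
  fix v assume v: "v \<in> carrier V"
  show "\<alpha>' \<one> v = v" using v by (simp add: \<alpha>' act_one unt_in)
  show "\<alpha>' (x \<cdot> y) v = \<alpha>' x (\<alpha>' y v)" if "x \<in> carrier H" "y \<in> carrier H" for x y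
    using v that by (simp add: \<alpha>' act_mul mul_in act_in)
  show "sw H V (\<delta>' v) (\<lambda>a w. smul V (\<epsilon> a) w) = v"
    using v by (simp add: \<delta>' counit_id)
  have "sw H V (\<delta> v) (\<lambda>a w. tens H (tensor H V) a (\<delta> w)) =
     sw H V (\<delta> v) (\<lambda>a w. tens H (tensor H V) a (\<delta>' w))"
    by (intro sw_cong vecsp_H) (simp add: \<delta>')
  then show "sw H V (\<delta>' v) (\<lambda>a w. \<Delta> a (\<lambda>b c. tens H (tensor H V) b (tens H V c w))) =
      sw H V (\<delta>' v) (\<lambda>a w. tens H (tensor H V) a (\<delta>' w))"
    using v by (simp add: \<delta>' coassoc_tens)
  fix x assume x: "x \<in> carrier H"
  have "\<Delta> x (\<lambda>y z. sw H V (\<delta>' (\<alpha>' y v)) (\<lambda>a w. tens H V (a \<cdot> z) w)) =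
      \<Delta> x (\<lambda>y z. sw H V (\<delta> (\<alpha> y v)) (\<lambda>a w. tens H V (a \<cdot> z) w))" (is "?l = _")
    by (intro sw_cong[OF _ vecsp_H]) (simp add: \<alpha>' \<delta>' v act_in)
  also have "\<dots> = \<Delta> x (\<lambda>y z. sw H V (\<delta>' v) (\<lambda>a w. tens H V (y \<cdot> a) (\<alpha>' z w)))"
    unfolding yd_tens[OF x v] \<delta>'[OF v] by (intro sw_cong[OF _ vecsp_H]) (simp add: \<alpha>')
  finally show "?l = \<dots>" .
qed

end

definition yd_hom where
  "yd_hom H V \<alpha> \<delta> W \<beta> \<gamma> f \<longleftrightarrow> lin_map V W f \<and>
     (\<forall>x\<in>carrier H. \<forall>v\<in>carrier V. f (\<alpha> x v) = \<beta> x (f v)) \<and>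
     (\<forall>v\<in>carrier V. \<gamma> (f v) = sw H V (\<delta> v) (\<lambda>a x. tens H W a (f x)))"

lemma yd_homD:
  assumes "yd_hom H V \<alpha> \<delta> W \<beta> \<gamma> f"
  shows "lin_map V W f" "x \<in> carrier H \<Longrightarrow> v \<in> carrier V \<Longrightarrow> f (\<alpha> x v) = \<beta> x (f v)"
    "v \<in> carrier V \<Longrightarrow> \<gamma> (f v) = sw H V (\<delta> v) (\<lambda>a x. tens H W a (f x))"
  using assms by (auto simp: yd_hom_def)

lemma yd_hom_coact:
  assumes f: "yd_hom H V \<alpha> \<delta> W \<beta> \<gamma> f" and "bil H W U (\<lambda>a w. g a w)" "v \<in> carrier V"
    "vecsp U" "vecsp H"
  shows "sw H W (\<gamma> (f v)) (\<lambda>a w. g a w) = sw H V (\<delta> v) (\<lambda>a w. g a (f w))"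
  unfolding yd_homD(3)[OF f assms(3)]
  by (assumption | rule sweq assms lin_map_in[OF yd_homD(1)[OF f]] lin refl)+

lemma yd_hom_comp:
  assumes f: "yd_hom H V \<alpha> \<delta> W \<beta> \<gamma> f" and g: "yd_hom H W \<beta> \<gamma> X \<chi> \<xi> g" 
    and [lin]: "vecsp H"
  shows "yd_hom H V \<alpha> \<delta> X \<chi> \<xi> (\<lambda>v. g (f v))"
  unfolding yd_hom_def
proof (intro conjI ballI)
  show "lin_map V X (\<lambda>v. g (f v))" by (rule lin_comp[OF yd_homD(1)[OF g] yd_homD(1)[OF f]])
  fix v assume v: "v \<in> carrier V"
  have fv: "f v \<in> carrier W" using lin_map_in[OF yd_homD(1)[OF f] v] .
  show "g (f (\<alpha> x v)) = \<chi> x (g (f v))" if "x \<in> carrier H" for x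
    using that v fv by (simp add: yd_homD(2)[OF f] yd_homD(2)[OF g])
  have "\<xi> (g (f v)) = sw H W (\<gamma> (f v)) (\<lambda>a x. tens H X a (g x))"
    by (rule yd_homD(3)[OF g fv])
  also have "\<dots> = sw H V (\<delta> v) (\<lambda>a x. tens H X a (g (f x)))"
    by (rule yd_hom_coact[OF f]) (assumption | rule v lin_comp[OF yd_homD(1)[OF g]] lin_map_in[OF yd_homD(1)[OF g]] lin)+
  finally show "\<xi> (g (f v)) = \<dots>" .
qed

context yd_mod
begin

text \<open>This carries the structure of \<open>V \<otimes> V\<^bsup>\<otimes>n\<^esup>\<close> to \<open>V\<^bsup>\<otimes>(n+1)\<^esup>\<close>.\<close>

lemma yd_mod_transport:
  assumes X: "vecsp X" and f: "lin_map V X f" and f': "lin_map X V f'"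
    and inv: "\<And>v. v \<in> carrier V \<Longrightarrow> f' (f v) = v" "\<And>x. x \<in> carrier X \<Longrightarrow> f (f' x) = x"
  defines "\<beta> \<equiv> \<lambda>x v. f (\<alpha> x (f' v))" and "\<gamma> \<equiv> \<lambda>v. sw H V (\<delta> (f' v)) (\<lambda>a w. tens H X a (f w))"
  shows "yd_mod H X \<beta> \<gamma>" "yd_hom H V \<alpha> \<delta> X \<beta> \<gamma> f" "yd_hom H X \<beta> \<gamma> V \<alpha> \<delta> f'"
proof -
  note [lin] = X lin_comp[OF f] lin_comp[OF f'] lin_map_in[OF f] lin_map_in[OF f']
  have bil\<beta>: "bil H X X \<beta>" and lin\<gamma>: "lin_map X (tensor H X) \<gamma>"
    unfolding \<beta>_def \<gamma>_def by (assumption | rule lin)+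
  note [lin] = bil_l[OF bil\<beta>] bil_r[OF bil\<beta>] bil_in[OF bil\<beta>] lin_comp[OF lin\<gamma>] lin_map_in[OF lin\<gamma>]
  have \<gamma>_eq: "\<gamma> x = sw H V (\<delta> (f' x)) (\<lambda>a w. tens H X a (f w))" for x
    by (simp add: \<gamma>_def)
  note sw\<gamma> = sw_map[OF f, where V' = H and t = "\<delta> (f' x)" for x, folded \<gamma>_eq]
  show f_hom: "yd_hom H V \<alpha> \<delta> X \<beta> \<gamma> f"
    using f by (simp add: yd_hom_def \<beta>_def \<gamma>_def inv)
  have ff': "sw H V (\<delta> (f' x)) (\<lambda>a w. tens H V a (f' (f w))) = \<delta> (f' x)" if "x \<in> carrier X" for x
  proof -
    have "sw H V (\<delta> (f' x)) (\<lambda>a w. tens H V a (f' (f w))) = sw H V (\<delta> (f' x)) (\<lambda>a w. tens H V a w)"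
      by (intro sw_cong vecsp_H) (simp add: inv)
    also have "\<dots> = \<delta> (f' x)" by (rule sw_tens_id) (assumption | rule lin that)+
    finally show ?thesis .
  qed
  show f'_hom: "yd_hom H X \<beta> \<gamma> V \<alpha> \<delta> f'"
    unfolding yd_hom_def
  proof (intro conjI ballI f')
    fix v x assume "x \<in> carrier X"
    show "\<delta> (f' x) = sw H X (\<gamma> x) (\<lambda>a x. tens H V a (f' x))"
      by (subst sw\<gamma>[where U = "tensor H V"]) (assumption | rule \<open>x \<in> carrier X\<close> lin ff'[symmetric])+
  next
    fix v x assume "v \<in> carrier H" "x \<in> carrier X"
    then show "f' (\<beta> v x) = \<alpha> v (f' x)" unfolding \<beta>_def by (intro inv) (assumption | rule lin)+
  qed
  show "yd_mod H X \<beta> \<gamma>"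
  proof unfold_locales
    show "vecsp X" "bil H X X \<beta>" "lin_map X (tensor H X) \<gamma>" by fact+
    fix x assume x: "x \<in> carrier X"
    have x': "f' x \<in> carrier V" using x by (rule lin)
    show "\<beta> \<one> x = x" using x' by (simp add: \<beta>_def act_one inv x)
    show "\<beta> (g \<cdot> h) x = \<beta> g (\<beta> h x)" if "g \<in> carrier H" "h \<in> carrier H" for g h
      using that x' by (simp add: \<beta>_def act_mul inv act_in)
    have "sw H X (\<gamma> x) (\<lambda>a w. smul X (\<epsilon> a) w) = sw H V (\<delta> (f' x)) (\<lambda>a w. smul X (\<epsilon> a) (f w))" (is "?l = _")
      by (rule sw\<gamma>) (assumption | rule x lin)+
    also have "\<dots> = f (f' x)"
      by (rule coact_counit) (assumption | rule x lin)+
    finally show "?l = x" by (simp add: inv x)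
    let ?T = "tensor H (tensor H X)"
    have "sw H X (\<gamma> x) (\<lambda>a w. \<Delta> a (\<lambda>b c. tens H (tensor H X) b (tens H X c w))) =
      sw H V (\<delta> (f' x)) (\<lambda>a w. \<Delta> a (\<lambda>b c. tens H (tensor H X) b (tens H X c (f w))))" (is "?l = _")
      by (rule sw\<gamma>[where U = ?T]) (assumption | rule x lin)+
    also have "\<dots> = sw H V (\<delta> (f' x)) (\<lambda>a w. sw H V (\<delta> w) (\<lambda>b w. tens H (tensor H X) a (tens H X b (f w))))"
      by (rule coact_coassoc[where U = ?T]) (assumption | rule x lin)+
    also have "\<dots> = sw H V (\<delta> (f' x)) (\<lambda>a w. tens H (tensor H X) a (\<gamma> (f w)))"
      unfolding yd_homD(3)[OF f_hom]
    proof (rule sw_cong[OF _ vecsp_H])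
      fix a w assume aw: "a \<in> carrier H" "w \<in> carrier V"
      show "sw H V (\<delta> w) (\<lambda>b w. tens H (tensor H X) a (tens H X b (f w))) = tens H (tensor H X) a (\<gamma> (f w))"
        unfolding yd_homD(3)[OF f_hom aw(2)]
        by (rule sym, rule lin_map_sw[where U = "tensor H X" and U' = ?T]) (assumption | rule aw lin)+
    qed
    also have "\<dots> = sw H X (\<gamma> x) (\<lambda>a w. tens H (tensor H X) a (\<gamma> w))"
      by (rule sym, rule sw\<gamma>[where U = ?T]) (assumption | rule x lin)+
    finally show "?l = \<dots>" .
    fix h assume h: "h \<in> carrier H"
    have "\<Delta> h (\<lambda>y z. sw H X (\<gamma> (\<beta> y x)) (\<lambda>a w. tens H X (a \<cdot> z) w)) =
      \<Delta> h (\<lambda>y z. sw H V (\<delta> (\<alpha> y (f' x))) (\<lambda>a w. tens H X (a \<cdot> z) (f w)))" (is "?l = _")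
      by (rule sw_cong, subst sw\<gamma>[where U = "tensor H X"])
        (assumption | rule x h lin | simp only: yd_homD(2)[OF f'_hom] x)+
    also have "\<dots> = \<Delta> h (\<lambda>y z. sw H V (\<delta> (f' x)) (\<lambda>a w. tens H X (y \<cdot> a) (f (\<alpha> z w))))"
      by (rule yd_compat) (assumption | rule x h lin)+
    also have "\<dots> = \<Delta> h (\<lambda>y z. sw H V (\<delta> (f' x)) (\<lambda>a w. tens H X (y \<cdot> a) (\<beta> z (f w))))"
      by (intro sw_cong[OF _ vecsp_H]) (simp add: yd_homD(2)[OF f_hom])
    also have "\<dots> = \<Delta> h (\<lambda>y z. sw H X (\<gamma> x) (\<lambda>a w. tens H X (y \<cdot> a) (\<beta> z w)))"
      by (rule sw_cong, rule sym, rule sw\<gamma>[where U = "tensor H X"]) (assumption | rule x h lin)+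
    finally show "?l = \<dots>" .
  qed
qed

end

context yd_mod_pair
begin

text \<open>The two sides of each compatibility are linear, so that pure tensors suffice. The face maps of
  the Hochschild complex are composed of the three kinds of morphisms obtained from this
  criterion: \<open>id \<otimes> f\<close>, \<open>\<epsilon>\<^sub>B \<otimes> id\<close> and \<open>m \<otimes> id\<close>.\<close>

lemma yd_hom_tensorI:
  assumes X: "yd_mod H X \<chi> \<xi>" and F: "lin_map VW X F"
    and act: "\<And>x v w. x \<in> carrier H \<Longrightarrow> v \<in> carrier V \<Longrightarrow> w \<in> carrier W \<Longrightarrow>
      \<Delta> x (\<lambda>y z. F (tens V W (\<alpha> y v) (\<beta> z w))) = \<chi> x (F (tens V W v w))"
    and coact: "\<And>v w. v \<in> carrier V \<Longrightarrow> w \<in> carrier W \<Longrightarrow>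
      sw H V (\<delta> v) (\<lambda>a v. sw H W (\<gamma> w) (\<lambda>b w. tens H X (a \<cdot> b) (F (tens V W v w)))) = \<xi> (F (tens V W v w))"
  shows "yd_hom H VW act2 coact2 X \<chi> \<xi> F"
  unfolding yd_hom_def
proof (intro conjI ballI F)
  interpret X: yd_mod H X \<chi> \<xi> by fact
  note [lin] = lin_comp[OF F] lin_map_in[OF F]
  fix s assume s: "s \<in> carrier VW"
  show "F (act2 x s) = \<chi> x (F s)" if x: "x \<in> carrier H" for x
  proof (rule tensor_ext[where U = X, OF _ _ _ s], ((assumption | rule x lin)+)[2])
    fix v w assume vw: "v \<in> carrier V" "w \<in> carrier W"
    show "F (act2 x (tens V W v w)) = \<chi> x (F (tens V W v w))"
      unfolding act2_tens[OF x vw] act[OF x vw, symmetric]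
      by (rule lin_map_sw[where U = VW and U' = X]) (assumption | rule x vw lin)+
  qed (rule lin)
  show "\<xi> (F s) = sw H VW (coact2 s) (\<lambda>a x. tens H X a (F x))"
  proof (rule tensor_ext[where U = "tensor H X", OF _ _ _ s], ((assumption | rule lin)+)[2])
    fix v w assume vw: "v \<in> carrier V" "w \<in> carrier W"
    show "\<xi> (F (tens V W v w)) = sw H VW (coact2 (tens V W v w)) (\<lambda>a x. tens H X a (F x))"
      unfolding coact[OF vw, symmetric] by (rule sym, rule sw_coact2_tens) (assumption | rule vw lin)+
  qed (rule lin)
qed

end

locale yd_mod_triple = yd_mod_pair H V \<alpha> \<delta> W \<beta> \<gamma> + X: yd_mod H X \<chi> \<xi>
  for H :: "('k::field, 'h::ab_group_add) hopf"
    and V :: "('k, 'v::ab_group_add, 'y) vecsp_scheme" and \<alpha> \<delta>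
    and W :: "('k, 'w::ab_group_add, 'z) vecsp_scheme" and \<beta> \<gamma>
    and X :: "('k, 'x::ab_group_add, 'u) vecsp_scheme" and \<chi> \<xi>
begin

sublocale VX: yd_mod_pair H V \<alpha> \<delta> X \<chi> \<xi> ..

lemma yd_hom_id_tensor:
  assumes f: "yd_hom H W \<beta> \<gamma> X \<chi> \<xi> f"
  defines "F \<equiv> \<lambda>z. sw V W z (\<lambda>v w. tens V X v (f w))"
  shows "yd_hom H (tensor V W) act2 coact2 (tensor V X) VX.act2 VX.coact2 F"
    "v \<in> carrier V \<Longrightarrow> w \<in> carrier W \<Longrightarrow> F (tens V W v w) = tens V X v (f w)"
proof -
  let ?VX = "tensor V X"
  note [lin] = lin_comp[OF yd_homD(1)[OF f]] lin_map_in[OF yd_homD(1)[OF f]]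
  show Ft: "F (tens V W v w) = tens V X v (f w)" if "v \<in> carrier V" "w \<in> carrier W" for v w
    unfolding F_def by (assumption | rule sweq lin that refl)+
  show "yd_hom H VW act2 coact2 ?VX VX.act2 VX.coact2 F"
  proof (rule yd_hom_tensorI[OF VX.yd_mod_tensor])
    show "lin_map VW ?VX F" unfolding F_def by (assumption | rule lin)+
    fix v w assume vw: "v \<in> carrier V" "w \<in> carrier W"
    show "\<Delta> x (\<lambda>y z. F (tens V W (\<alpha> y v) (\<beta> z w))) = VX.act2 x (F (tens V W v w))" if x: "x \<in> carrier H" for x
    proof -
      have "\<Delta> x (\<lambda>y z. F (tens V W (\<alpha> y v) (\<beta> z w))) = \<Delta> x (\<lambda>y z. tens V X (\<alpha> y v) (\<chi> z (f w)))"
        by (intro sw_cong[OF _ vecsp_H]) (simp add: Ft vw V.act_in W.act_in yd_homD(2)[OF f])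
      also have "\<dots> = VX.act2 x (F (tens V W v w))"
        unfolding Ft[OF vw] by (rule sym, rule VX.act2_tens) (assumption | rule x vw lin)+
      finally show ?thesis .
    qed
    have "sw H V (\<delta> v) (\<lambda>a v. sw H W (\<gamma> w) (\<lambda>b w. tens H ?VX (a \<cdot> b) (F (tens V W v w)))) =
        sw H V (\<delta> v) (\<lambda>a v. sw H W (\<gamma> w) (\<lambda>b w. tens H ?VX (a \<cdot> b) (tens V X v (f w))))" (is "?l = _")
      by (intro sw_cong[OF _ vecsp_H]) (simp add: Ft)
    also have "\<dots> = sw H V (\<delta> v) (\<lambda>a v. sw H X (\<xi> (f w)) (\<lambda>b w. tens H ?VX (a \<cdot> b) (tens V X v w)))"
      by (rule sw_cong, rule yd_hom_coact[OF f, symmetric]) (assumption | rule vw lin)+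
    also have "\<dots> = VX.coact2 (F (tens V W v w))"
      unfolding Ft[OF vw] by (rule sym, rule VX.coact2_tens) (assumption | rule vw lin)+
    finally show "?l = VX.coact2 (F (tens V W v w))" .
  qed
qed

end

context yd_mod_pair
begin

lemma yd_hom_counit_tensor:
  assumes e: "yd_hom H V \<alpha> \<delta> ground (\<lambda>x c. \<epsilon> x * c) (tens H ground \<one>) e"
  defines "F \<equiv> \<lambda>z. sw V W z (\<lambda>v w. smul W (e v) w)"
  shows "yd_hom H VW act2 coact2 W \<beta> \<gamma> F"
    "v \<in> carrier V \<Longrightarrow> w \<in> carrier W \<Longrightarrow> F (tens V W v w) = smul W (e v) w"
proof -
  note [lin] = lin_comp[OF yd_homD(1)[OF e]]
  show Ft: "F (tens V W v w) = smul W (e v) w" if "v \<in> carrier V" "w \<in> carrier W" for v w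
    unfolding F_def by (assumption | rule sweq lin that refl)+
  show "yd_hom H VW act2 coact2 W \<beta> \<gamma> F"
  proof (rule yd_hom_tensorI[OF W.yd_mod_axioms])
    show "lin_map VW W F" unfolding F_def by (assumption | rule lin)+
    fix v w assume vw: "v \<in> carrier V" "w \<in> carrier W"
    show "\<Delta> x (\<lambda>y z. F (tens V W (\<alpha> y v) (\<beta> z w))) = \<beta> x (F (tens V W v w))" if x: "x \<in> carrier H" for x
    proof -
      have "\<Delta> x (\<lambda>y z. F (tens V W (\<alpha> y v) (\<beta> z w))) = \<Delta> x (\<lambda>y z. smul W (\<epsilon> y) (\<beta> z (smul W (e v) w)))"
        using lin_map_smul[OF bil_r[OF W.bil_act _ lin_id]]
        by (intro sw_cong[OF _ vecsp_H])
          (simp add: Ft vw V.act_in W.act_in yd_homD(2)[OF e] smul_simps[OF W.vecsp_V])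
      also have "\<dots> = \<beta> x (F (tens V W v w))"
        unfolding Ft[OF vw] by (rule counit_l) (assumption | rule x vw lin)+
      finally show ?thesis .
    qed
    have "sw H V (\<delta> v) (\<lambda>a v. sw H W (\<gamma> w) (\<lambda>b w. tens H W (a \<cdot> b) (F (tens V W v w)))) =
        sw H V (\<delta> v) (\<lambda>a v. sw H W (\<gamma> w) (\<lambda>b w. tens H W (a \<cdot> b) (smul W (e v) w)))" (is "?l = _")
      by (intro sw_cong[OF _ vecsp_H]) (simp add: Ft)
    also have "\<dots> = sw H ground (tens H ground \<one> (e v)) (\<lambda>a c. sw H W (\<gamma> w) (\<lambda>b w0. tens H W (a \<cdot> b) (smul W c w0)))"
      by (rule sym, rule yd_hom_coact[OF e]) (assumption | rule vw lin)+
    also have "\<dots> = sw H W (\<gamma> w) (\<lambda>b w0. tens H W (\<one> \<cdot> b) (smul W (e v) w0))"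
      by (assumption | rule sweq vw lin refl)+
    also have "\<dots> = sw H W (\<gamma> w) (\<lambda>b w0. smul (tensor H W) (e v) (tens H W b w0))"
      by (intro sw_cong[OF _ vecsp_H]) (simp add: mul_unt lin_map_smul[OF bil_r[OF bil_tens _ lin_id]])
    also have "\<dots> = smul (tensor H W) (e v) (sw H W (\<gamma> w) (\<lambda>b w0. tens H W b w0))"
      by (rule sym, rule lin_map_sw[where f = "smul (tensor H W) (e v)" and U = "tensor H W" and U' = "tensor H W"])
        (assumption | rule vw lin)+
    also have "\<dots> = smul (tensor H W) (e v) (\<gamma> w)"
      by (simp only: sw_tens_id[OF W.coact_in[OF vw(2)] vecsp_H])
    also have "\<dots> = \<gamma> (F (tens V W v w))"
      by (simp add: Ft vw lin_map_smul[OF W.lin_coact0])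
    finally show "?l = \<gamma> (F (tens V W v w))" .
  qed
qed

end

context yd_mod_pair
begin

lemma yd_hom_mult_tensor:
  assumes M: "yd_hom H (tensor V V) (tact H V \<alpha> V \<alpha>) (tcoact H V \<delta> V \<delta>) V \<alpha> \<delta> M"
  defines "F \<equiv> \<lambda>z. sw V (tensor V W) z (\<lambda>u s. sw V W s (\<lambda>v w. tens V W (M (tens V V u v)) w))"
  shows "yd_hom H (tensor V VW) (tact H V \<alpha> VW act2) (tcoact H V \<delta> VW coact2) VW act2 coact2 F"
    "u \<in> carrier V \<Longrightarrow> v \<in> carrier V \<Longrightarrow> w \<in> carrier W \<Longrightarrow>
      F (tens V VW u (tens V W v w)) = tens V W (M (tens V V u v)) w"
proof -
  interpret VV: yd_mod_pair H V \<alpha> \<delta> V \<alpha> \<delta> ..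
  interpret VW: yd_mod H VW act2 coact2 by (rule yd_mod_tensor)
  interpret V_VW: yd_mod_pair H V \<alpha> \<delta> VW act2 coact2 ..
  let ?m = "\<lambda>u v. M (tens V V u v)"
  note [lin] = lin_comp[OF yd_homD(1)[OF M]] lin_map_in[OF yd_homD(1)[OF M]]
  have linF: "lin_map (tensor V VW) VW F" unfolding F_def by (assumption | rule lin)+
  note [lin] = lin_comp[OF linF] lin_map_in[OF linF]
  show Ft: "F (tens V VW u (tens V W v w)) = tens V W (?m u v) w"
    if "u \<in> carrier V" "v \<in> carrier V" "w \<in> carrier W" for u v w
    unfolding F_def by (assumption | rule sweq lin that refl)+
  have Mact: "\<alpha> x (?m u v) = \<Delta> x (\<lambda>y z. ?m (\<alpha> y u) (\<alpha> z v))"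
    if that: "x \<in> carrier H" "u \<in> carrier V" "v \<in> carrier V" for x u v
  proof -
    have "\<alpha> x (?m u v) = M (VV.act2 x (tens V V u v))"
      by (rule yd_homD(2)[OF M, symmetric]) (assumption | rule that lin)+
    also have "\<dots> = \<Delta> x (\<lambda>y z. ?m (\<alpha> y u) (\<alpha> z v))"
      unfolding VV.act2_tens[OF that]
      by (rule lin_map_sw[where U = "tensor V V" and U' = V]) (assumption | rule that lin)+
    finally show ?thesis .
  qed
  show "yd_hom H (tensor V VW) V_VW.act2 V_VW.coact2 VW act2 coact2 F"
  proof (rule V_VW.yd_hom_tensorI[OF VW.yd_mod_axioms linF])
    fix u s assume u: "u \<in> carrier V" and s: "s \<in> carrier VW"
    show "\<Delta> x (\<lambda>y z. F (tens V VW (\<alpha> y u) (act2 z s))) = act2 x (F (tens V VW u s))"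
      if x: "x \<in> carrier H" for x
    proof (rule tensor_ext[where U = VW, OF _ _ _ s], ((assumption | rule x u lin)+)[2])
      fix v w assume vw: "v \<in> carrier V" "w \<in> carrier W"
      have "\<Delta> x (\<lambda>y z. F (tens V VW (\<alpha> y u) (act2 z (tens V W v w)))) =
          \<Delta> x (\<lambda>y z. \<Delta> z (\<lambda>z1 z2. F (tens V VW (\<alpha> y u) (tens V W (\<alpha> z1 v) (\<beta> z2 w)))))" (is "?l = _")
      proof (rule sw_cong[OF _ vecsp_H])
        fix y z assume yz: "y \<in> carrier H" "z \<in> carrier H"
        show "F (tens V VW (\<alpha> y u) (act2 z (tens V W v w))) =
           \<Delta> z (\<lambda>z1 z2. F (tens V VW (\<alpha> y u) (tens V W (\<alpha> z1 v) (\<beta> z2 w))))"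
          unfolding act2_tens[OF yz(2) vw]
          by (rule lin_map_sw[where U = VW and U' = VW]) (assumption | rule x u yz vw lin)+
      qed
      also have "\<dots> = \<Delta> x (\<lambda>y z. \<Delta> z (\<lambda>z1 z2. tens V W (?m (\<alpha> y u) (\<alpha> z1 v)) (\<beta> z2 w)))"
        by (intro sw_cong[OF _ vecsp_H]) (simp add: Ft u vw V.act_in W.act_in)
      also have "\<dots> = \<Delta> x (\<lambda>y z. \<Delta> y (\<lambda>y1 y2. tens V W (?m (\<alpha> y1 u) (\<alpha> y2 v)) (\<beta> z w)))"
        by (rule sym, rule coassoc[where U = VW]) (assumption | rule x u vw lin)+
      also have "\<dots> = \<Delta> x (\<lambda>y z. tens V W (\<alpha> y (?m u v)) (\<beta> z w))"
      proof (rule sw_cong[OF _ vecsp_H])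
        fix y z assume yz: "y \<in> carrier H" "z \<in> carrier H"
        show "\<Delta> y (\<lambda>y1 y2. tens V W (?m (\<alpha> y1 u) (\<alpha> y2 v)) (\<beta> z w)) = tens V W (\<alpha> y (?m u v)) (\<beta> z w)"
          unfolding Mact[OF yz(1) u vw(1)]
          by (rule sym, rule lin_map_sw[where U = V and U' = VW]) (assumption | rule x u yz vw lin)+
      qed
      also have "\<dots> = act2 x (F (tens V VW u (tens V W v w)))"
        unfolding Ft[OF u vw] by (rule sym, rule act2_tens) (assumption | rule x u vw lin)+
      finally show "?l = act2 x (F (tens V VW u (tens V W v w)))" .
    qed (rule lin)
    show "sw H V (\<delta> u) (\<lambda>a u. sw H VW (coact2 s) (\<lambda>b s. tens H VW (a \<cdot> b) (F (tens V VW u s)))) =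
        coact2 (F (tens V VW u s))"
    proof (rule tensor_ext[where U = "tensor H VW", OF _ _ _ s], ((assumption | rule u lin)+)[2])
      fix v w assume vw: "v \<in> carrier V" "w \<in> carrier W"
      have "sw H V (\<delta> u) (\<lambda>a u. sw H VW (coact2 (tens V W v w)) (\<lambda>b s. tens H VW (a \<cdot> b) (F (tens V VW u s)))) =
          sw H V (\<delta> u) (\<lambda>a u. sw H V (\<delta> v) (\<lambda>b v. sw H W (\<gamma> w) (\<lambda>c w.
          tens H VW (a \<cdot> (b \<cdot> c)) (F (tens V VW u (tens V W v w))))))" (is "?l = _")
        by (rule sw_cong, rule sw_coact2_tens) (assumption | rule u vw lin)+
      also have "\<dots> = sw H V (\<delta> u) (\<lambda>a u. sw H V (\<delta> v) (\<lambda>b v. sw H W (\<gamma> w) (\<lambda>c w.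
          tens H VW (a \<cdot> b \<cdot> c) (tens V W (?m u v) w))))"
        by (intro sw_cong[OF _ vecsp_H]) (simp add: Ft mul_assoc)
      also have "\<dots> = sw H (tensor V V) (VV.coact2 (tens V V u v)) (\<lambda>a s. sw H W (\<gamma> w) (\<lambda>c w.
          tens H VW (a \<cdot> c) (tens V W (M s) w)))"
        by (rule sym, rule VV.sw_coact2_tens) (assumption | rule u vw lin)+
      also have "\<dots> = sw H V (\<delta> (?m u v)) (\<lambda>a v. sw H W (\<gamma> w) (\<lambda>c w. tens H VW (a \<cdot> c) (tens V W v w)))"
        by (rule sym, rule yd_hom_coact[OF M]) (assumption | rule u vw lin)+
      also have "\<dots> = coact2 (F (tens V VW u (tens V W v w)))"
        unfolding Ft[OF u vw] by (rule sym, rule coact2_tens) (assumption | rule u vw lin)+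
      finally show "?l = coact2 (F (tens V VW u (tens V W v w)))" .
    qed (rule lin)
  qed
qed

end

section \<open>Tensor powers\<close>

lemma words_0 [simp]: "words V 0 = {[]}"
  by (auto simp: words_def)

lemma words_Suc: "vs \<in> words V (Suc n) \<longleftrightarrow> (\<exists>u us. vs = u # us \<and> u \<in> carrier V \<and> us \<in> words V n)"
  by (cases vs) (auto simp: words_def)

lemma words_Cons [simp]: "u # us \<in> words V (Suc n) \<longleftrightarrow> u \<in> carrier V \<and> us \<in> words V n"
  by (auto simp: words_def)

lemma words_update: "vs \<in> words V n \<Longrightarrow> v \<in> carrier V \<Longrightarrow> vs[i := v] \<in> words V n"
  by (auto simp: words_def dest: set_update_subset_insert[THEN subsetD])

lemma multilin_mapI:
  assumes "\<And>vs. vs \<in> words V n \<Longrightarrow> g vs \<in> carrier U"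
    and "\<And>i vs. i < n \<Longrightarrow> vs \<in> words V n \<Longrightarrow> lin_map V U (\<lambda>v. g (vs[i := v]))"
  shows "multilin_map V n U g"
  using assms by (simp add: multilin_map_def)

lemma wtens_in [lin]: "vs \<in> words V n \<Longrightarrow> wtens V n vs \<in> carrier (tpow V n)"
proof -
  interpret V: vector_space fscale by (rule vector_space_fscale)
  show "vs \<in> words V n \<Longrightarrow> ?thesis"
    by (auto simp: tpow_def wtens_def tens_space_def intro!: V.span_base)
qed

lemma multilin_wtens:
  assumes "vecsp V"
  shows "multilin_map V n (tpow V n) (wtens V n)"
proof (rule multilin_mapI)
  fix i vs assume i: "i < n" and vs: "vs \<in> words V n"
  show "lin_map V (tpow V n) (\<lambda>v. wtens V n (vs[i := v]))"
  proof (rule lin_mapI)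
    fix x y assume xy: "x \<in> carrier V" "y \<in> carrier V"
    show "wtens V n (vs[i := x + y]) = wtens V n (vs[i := x]) + wtens V n (vs[i := y])"
    proof
      fix \<beta>
      have "\<beta> (vs[i := x + y]) = \<beta> (vs[i := x]) + \<beta> (vs[i := y])" if "multilin_map V n ground \<beta>"
        by (rule lin_map_add[where f = "\<lambda>v. \<beta> (vs[i := v])" and V = V])
          (use that xy i vs in \<open>auto simp: multilin_map_def\<close>)
      then show "wtens V n (vs[i := x + y]) \<beta> = (wtens V n (vs[i := x]) + wtens V n (vs[i := y])) \<beta>"
        by (simp add: wtens_def pure_tens_def multilin_forms_def)
    qed
  next
    fix c x assume xy: "x \<in> carrier V"
    show "wtens V n (vs[i := smul V c x]) = smul (tpow V n) c (wtens V n (vs[i := x]))"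
    proof
      fix \<beta>
      have "\<beta> (vs[i := smul V c x]) = smul ground c (\<beta> (vs[i := x]))" if "multilin_map V n ground \<beta>"
        by (rule lin_map_smul[where f = "\<lambda>v. \<beta> (vs[i := v])" and V = V])
          (use that xy i vs in \<open>auto simp: multilin_map_def\<close>)
      then show "wtens V n (vs[i := smul V c x]) \<beta> = smul (tpow V n) c (wtens V n (vs[i := x])) \<beta>"
        by (simp add: wtens_def pure_tens_def multilin_forms_def fscale_def)
    qed
  qed (rule wtens_in words_update vs assms | assumption)+
qed (rule lin)

lemma lin_wtens:
  assumes "vecsp V" "i < n" "vs \<in> words V n"
  shows "lin_map V (tpow V n) (\<lambda>v. wtens V n (vs[i := v]))"
  using multilin_wtens[OF assms(1), of n] assms(2,3) by (simp add: multilin_map_def)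

lemma multilin_comp_wtens:
  assumes "vecsp V" "lin_map (tpow V n) U L" "\<And>vs. vs \<in> words V n \<Longrightarrow> g vs = L (wtens V n vs)"
  shows "multilin_map V n U g"
proof (rule multilin_mapI)
  fix vs assume "vs \<in> words V n"
  then show "g vs \<in> carrier U" using assms by (simp add: lin_map_in wtens_in)
next
  fix i vs assume *: "i < n" "vs \<in> words V n"
  have "lin_map V U (\<lambda>v. L (wtens V n (vs[i := v])))"
    by (rule lin_comp[OF assms(2)], rule lin_wtens) fact+
  then show "lin_map V U (\<lambda>v. g (vs[i := v]))"
    by (rule lin_map_cong) (simp_all add: assms words_update *)
qed

text \<open>Multilinearity of \<open>g\<close> need not be checked argument by argument when a linear map with the values
  of \<open>g\<close> on words is already known.\<close>

lemma wlift_eqI: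
  assumes "vecsp V" "lin_map (tpow V n) U L" "\<And>vs. vs \<in> words V n \<Longrightarrow> g vs = L (wtens V n vs)"
    "t \<in> carrier (tpow V n)" "vecsp U"
  shows "wlift V n U g t = L t"
  using tpow_universal(3)[OF assms(5) multilin_comp_wtens[OF assms(1-3)] assms(2) _ assms(4)] assms(3)
  by simp

lemma multilin_tens_hd_tl:
  assumes "vecsp V"
  shows "multilin_map V (Suc n) (tensor V (tpow V n)) (\<lambda>vs. tens V (tpow V n) (hd vs) (wtens V n (tl vs)))"
proof (rule multilin_mapI)
  fix vs assume "vs \<in> words V (Suc n)"
  then show "tens V (tpow V n) (hd vs) (wtens V n (tl vs)) \<in> carrier (tensor V (tpow V n))"
    by (auto simp: words_Suc intro!: lin)
next
  fix i vs assume *: "i < Suc n" "vs \<in> words V (Suc n)"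
  then obtain u us where us: "vs = u # us" "u \<in> carrier V" "us \<in> words V n" by (auto simp: words_Suc)
  show "lin_map V (tensor V (tpow V n)) (\<lambda>v. tens V (tpow V n) (hd (vs[i := v])) (wtens V n (tl (vs[i := v]))))"
  proof (cases i)
    case 0
    then show ?thesis unfolding us by simp (assumption | rule us lin)+
  next
    case (Suc j)
    then show ?thesis using * unfolding us by simp (assumption | rule us assms lin_wtens lin)+
  qed
qed

lemma multilin_wtens_Cons:
  assumes "vecsp V" "v \<in> carrier V"
  shows "multilin_map V n (tpow V (Suc n)) (\<lambda>vs. wtens V (Suc n) (v # vs))"
proof (rule multilin_mapI)
  fix vs assume "vs \<in> words V n"
  then show "wtens V (Suc n) (v # vs) \<in> carrier (tpow V (Suc n))"
    using assms by (auto intro!: wtens_in)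
next
  fix i vs assume *: "i < n" "vs \<in> words V n"
  show "lin_map V (tpow V (Suc n)) (\<lambda>x. wtens V (Suc n) (v # vs[i := x]))"
    using lin_wtens[of V "Suc i" "Suc n" "v # vs"] * assms by simp
qed

lemma
  assumes "vecsp V"
  shows lin_tsplit: "lin_map (tpow V (Suc n)) (tensor V (tpow V n)) (tsplit V n)"
    and tsplit_wtens: "v \<in> carrier V \<Longrightarrow> vs \<in> words V n \<Longrightarrow>
      tsplit V n (wtens V (Suc n) (v # vs)) = tens V (tpow V n) v (wtens V n vs)"
  using tpow_universal(1,2)[OF vecsp_tensor multilin_tens_hd_tl[OF assms]] unfolding tsplit_def by auto

text \<open>The map \<open>(v, t) \<mapsto> v \<otimes> t\<close> from \<open>V \<times> V\<^bsup>\<otimes>n\<^esup>\<close> to \<open>V\<^bsup>\<otimes>(n+1)\<^esup>\<close>. For fixed \<open>v\<close> it is linear by construction;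
  linearity in \<open>v\<close> is an identity between linear maps in \<open>t\<close>, to be compared on words.\<close>

lemma tcons:
  assumes "vecsp V"
  defines "c \<equiv> \<lambda>n v. wlift V n (tpow V (Suc n)) (\<lambda>vs. wtens V (Suc n) (v # vs))"
  shows "bil V (tpow V n) (tpow V (Suc n)) (c n)"
    and "v \<in> carrier V \<Longrightarrow> vs \<in> words V n \<Longrightarrow> c n v (wtens V n vs) = wtens V (Suc n) (v # vs)"
proof -
  have linc: "lin_map (tpow V n) (tpow V (Suc n)) (c n v)" if "v \<in> carrier V" for v
    unfolding c_def by (rule tpow_universal(1)) (simp_all add: multilin_wtens_Cons assms that)
  have c: "c n v (wtens V n vs) = wtens V (Suc n) (v # vs)" if "v \<in> carrier V" "vs \<in> words V n" for v vs
    unfolding c_def by (rule tpow_universal(2)) (simp_all add: multilin_wtens_Cons assms that)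
  show "v \<in> carrier V \<Longrightarrow> vs \<in> words V n \<Longrightarrow> c n v (wtens V n vs) = wtens V (Suc n) (v # vs)"
    by (rule c)
  have linV: "lin_map V (tpow V (Suc n)) (\<lambda>v. wtens V (Suc n) (v # vs))" if "vs \<in> words V n" for vs
    using lin_wtens[of V 0 "Suc n" "0 # vs"] that assms vecsp_zero[of V] by simp
  show "bil V (tpow V n) (tpow V (Suc n)) (c n)"
  proof (rule bilI)
    fix t assume t: "t \<in> carrier (tpow V n)"
    show "lin_map V (tpow V (Suc n)) (\<lambda>v. c n v t)"
    proof (rule lin_mapI)
      fix x assume "x \<in> carrier V"
      then show "c n x t \<in> carrier (tpow V (Suc n))" by (rule lin_map_in[OF linc t])
    next
      fix x y assume xy: "x \<in> carrier V" "y \<in> carrier V"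
      show "c n (x + y) t = c n x t + c n y t"
      proof (rule tpow_ext[where g = "\<lambda>t. c n x t + c n y t", OF _ _ _ t vecsp_tpow])
        fix vs assume vs: "vs \<in> words V n"
        show "c n (x + y) (wtens V n vs) = c n x (wtens V n vs) + c n y (wtens V n vs)"
          by (simp only: c vs xy vecsp_add assms(1) lin_map_add[OF linV])
      qed (assumption | rule linc lin_add vecsp_add xy assms(1) vecsp_tpow)+
    next
      fix k x assume xy: "x \<in> carrier V"
      show "c n (smul V k x) t = smul (tpow V (Suc n)) k (c n x t)"
      proof (rule tpow_ext[where g = "\<lambda>t. smul (tpow V (Suc n)) k (c n x t)", OF _ _ _ t vecsp_tpow])
        fix vs assume vs: "vs \<in> words V n"
        show "c n (smul V k x) (wtens V n vs) = smul (tpow V (Suc n)) k (c n x (wtens V n vs))"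
          by (simp only: c vs xy vecsp_smul assms(1) lin_map_smul[OF linV])
      qed (assumption | rule linc lin_smul_r vecsp_smul xy assms(1) vecsp_tpow)+
    qed
  qed (rule linc)
qed

lemma
  assumes V: "vecsp V"
  shows lin_tjoin: "lin_map (tensor V (tpow V n)) (tpow V (Suc n)) (tjoin V n)"
    and tjoin_wtens: "v \<in> carrier V \<Longrightarrow> vs \<in> words V n \<Longrightarrow>
      tjoin V n (tens V (tpow V n) v (wtens V n vs)) = wtens V (Suc n) (v # vs)"
  using tensor_universal(1,2)[OF vecsp_tpow tcons(1)[OF V]] tcons(2)[OF V]
  unfolding tjoin_def by (auto simp: wtens_in)

lemma tjoin_tsplit:
  assumes V: "vecsp V" and t: "t \<in> carrier (tpow V (Suc n))"
  shows "tjoin V n (tsplit V n t) = t"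
  by (rule tpow_ext[OF lin_comp[OF lin_tjoin lin_tsplit] lin_id _ t])
    (auto simp: words_Suc tjoin_wtens tsplit_wtens V)

lemma tsplit_tjoin:
  assumes V: "vecsp V" and s: "s \<in> carrier (tensor V (tpow V n))"
  shows "tsplit V n (tjoin V n s) = s"
proof (rule tensor_ext[OF lin_comp[OF lin_tsplit lin_tjoin] lin_id _ s])
  fix v t assume v: "v \<in> carrier V" and t: "t \<in> carrier (tpow V n)"
  show "tsplit V n (tjoin V n (tens V (tpow V n) v t)) = tens V (tpow V n) v t"
    by (rule tpow_ext[OF _ _ _ t])
      (assumption | rule lin_comp[OF lin_tsplit] lin_comp[OF lin_tjoin] v V lin |
        simp add: tjoin_wtens tsplit_wtens V v)+
qed (simp_all add: V)

section \<open>Tensor powers as Yetter-Drinfeld modules and the face maps\<close>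

lemma (in hopf_alg) yd_mod_of_yd_module:
  fixes V :: "('k, 'v::ab_group_add, 'h, 'z) ydmod_scheme"
  assumes "yd_module H V"
  shows "yd_mod H V (act V) (coact V)"
proof -
  let ?T = "tensor H (tensor H V)"
  note V = assms[unfolded yd_module_def]
  have [lin]: "vecsp V" and bil: "bil H V V (act V)" and coact: "lin_map V (tensor H V) (coact V)"
    by (rule V[THEN conjunct1] V[THEN conjunct2, THEN conjunct1]
        V[THEN conjunct2, THEN conjunct2, THEN conjunct2, THEN conjunct2, THEN conjunct1])+
  note V4 = V[THEN conjunct2, THEN conjunct2, THEN conjunct2, THEN conjunct2]
  note [lin] = bil_l[OF bil] bil_r[OF bil] bil_in[OF bil] lin_comp[OF coact] lin_map_in[OF coact]
  show ?thesis
  proof unfold_locales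
    fix v assume v: "v \<in> carrier V"
    have "tlift H V ?T (\<lambda>(a, w). tlift H H ?T
             (\<lambda>(a\<^sub>1, a\<^sub>2). tens H (tensor H V) a\<^sub>1 (tens H V a\<^sub>2 w)) (comul H a)) (coact V v) =
       sw H V (coact V v) (\<lambda>a w. \<Delta> a (\<lambda>b c. tens H (tensor H V) b (tens H V c w)))"
      by (assumption | rule sweq v lin refl)+
    moreover have "tlift H V ?T (\<lambda>(a, w). tens H (tensor H V) a (coact V w)) (coact V v) =
       sw H V (coact V v) (\<lambda>a w. tens H (tensor H V) a (coact V w))"
      by (assumption | rule sweq v lin refl)+
    ultimately show "sw H V (coact V v) (\<lambda>a w. \<Delta> a (\<lambda>b c. tens H (tensor H V) b (tens H V c w))) =
        sw H V (coact V v) (\<lambda>a w. tens H (tensor H V) a (coact V w))"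
      using V4[THEN conjunct2, THEN conjunct1, rule_format, OF v] by (simp only:)
    have "tlift H V V (\<lambda>(a, w). smul V (\<epsilon> a) w) (coact V v) = sw H V (coact V v) (\<lambda>a w. smul V (\<epsilon> a) w)"
      by (assumption | rule sweq v lin refl)+
    then show "sw H V (coact V v) (\<lambda>a w. smul V (\<epsilon> a) w) = v"
      using V4[THEN conjunct2, THEN conjunct2, THEN conjunct1, rule_format, OF v] by (simp only:)
    fix x assume x: "x \<in> carrier H"
    have "tlift H H (tensor H V) (\<lambda>(h\<^sub>1, h\<^sub>2). tlift H V (tensor H V)
          (\<lambda>(a, w). tens H V (mul H a h\<^sub>2) w) (coact V (act V h\<^sub>1 v))) (comul H x) =
        \<Delta> x (\<lambda>y z. sw H V (coact V (act V y v)) (\<lambda>a w. tens H V (a \<cdot> z) w))"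
      by (assumption | rule sweq v x lin refl)+
    moreover have "tlift H H (tensor H V) (\<lambda>(h\<^sub>1, h\<^sub>2). tlift H V (tensor H V)
          (\<lambda>(a, w). tens H V (mul H h\<^sub>1 a) (act V h\<^sub>2 w)) (coact V v)) (comul H x) =
        \<Delta> x (\<lambda>y z. sw H V (coact V v) (\<lambda>a w. tens H V (y \<cdot> a) (act V z w)))"
      by (assumption | rule sweq v x lin refl)+
    ultimately show "\<Delta> x (\<lambda>y z. sw H V (coact V (act V y v)) (\<lambda>a w. tens H V (a \<cdot> z) w)) =
        \<Delta> x (\<lambda>y z. sw H V (coact V v) (\<lambda>a w. tens H V (y \<cdot> a) (act V z w)))"
      using V4[THEN conjunct2, THEN conjunct2, THEN conjunct2, rule_format, OF x v] by (simp only:)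
  qed (rule bil coact V[THEN conjunct1] V[THEN conjunct2, THEN conjunct2, THEN conjunct1, rule_format]
      V[THEN conjunct2, THEN conjunct2, THEN conjunct2, THEN conjunct1, rule_format]; assumption?)+
qed

lemma (in yd_mod_pair) yd_tensor_eq:
  assumes V': "carrier V' = carrier V" "smul V' = smul V" "act V' = \<alpha>" "coact V' = \<delta>"
    and W': "carrier W' = carrier W" "smul W' = smul W" "act W' = \<beta>" "coact W' = \<gamma>"
  shows "carrier (yd_tensor H V' W') = carrier VW" "smul (yd_tensor H V' W') = smul VW"
    "s \<in> carrier VW \<Longrightarrow> x \<in> carrier H \<Longrightarrow> act (yd_tensor H V' W') x s = act2 x s"
    "s \<in> carrier VW \<Longrightarrow> coact (yd_tensor H V' W') s = coact2 s"
proof -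
  have T: "tensor V' W' = VW" "tens V' W' = tens V W"
    by (rule tensor_cong; rule V' W')+
  have L: "tlift V' W' X = tlift V W X" for X :: "('k, 'u::ab_group_add, 'x) vecsp_scheme"
    by (rule tlift_cong) (use V' W' in simp_all)
  have LV: "tlift H V' X = tlift H V X" for X :: "('k, 'u::ab_group_add, 'x) vecsp_scheme"
    by (rule tlift_cong) (use V' in simp_all)
  have LW: "tlift H W' X = tlift H W X" for X :: "('k, 'u::ab_group_add, 'x) vecsp_scheme"
    by (rule tlift_cong) (use W' in simp_all)
  show "carrier (yd_tensor H V' W') = carrier VW" "smul (yd_tensor H V' W') = smul VW"
    by (simp_all add: yd_tensor_def T)
  assume s: "s \<in> carrier VW"
  show "act (yd_tensor H V' W') x s = act2 x s" if x: "x \<in> carrier H"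
    by (simp only: yd_tensor_def ydmod.simps T L V' W' tact_def) (assumption | rule sweq s x lin refl)+
  show "coact (yd_tensor H V' W') s = coact2 s"
    by (simp only: yd_tensor_def ydmod.simps T L LV LW V' W' tcoact_def)
      (assumption | rule sweq s lin refl)+
qed

abbreviation pow_hom where
  "pow_hom H V m n \<equiv> yd_hom H (tpow V m) (act (yd_pow H V m)) (coact (yd_pow H V m))
     (tpow V n) (act (yd_pow H V n)) (coact (yd_pow H V n))"

lemma yd_pow_simps [simp]:
  "carrier (yd_pow H V n) = carrier (tpow V n)" "smul (yd_pow H V n) = smul (tpow V n)"
  by (cases n; simp)+

locale yd_mod_powers = yd_mod H V "act V" "coact V"
  for H :: "('k::field, 'h::ab_group_add) hopf"
    and V :: "('k, 'v::ab_group_add, 'h, 'z) ydmod_scheme"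
begin

abbreviation "actn n \<equiv> act (yd_pow H V n)"
abbreviation "coactn n \<equiv> coact (yd_pow H V n)"

lemma yd_pow_Suc:
  assumes "yd_mod H (tpow V n) (actn n) (coactn n)"
  shows "yd_mod H (tpow V (Suc n)) (actn (Suc n)) (coactn (Suc n))"
    and "yd_hom H (tensor V (tpow V n)) (tact H V (act V) (tpow V n) (actn n))
      (tcoact H V (coact V) (tpow V n) (coactn n)) (tpow V (Suc n)) (actn (Suc n)) (coactn (Suc n)) (tjoin V n)"
    and "yd_hom H (tpow V (Suc n)) (actn (Suc n)) (coactn (Suc n)) (tensor V (tpow V n))
      (tact H V (act V) (tpow V n) (actn n)) (tcoact H V (coact V) (tpow V n) (coactn n)) (tsplit V n)"
proof -
  interpret P: yd_mod H "tpow V n" "actn n" "coactn n" by fact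
  interpret V_P: yd_mod_pair H V "act V" "coact V" "tpow V n" "actn n" "coactn n" ..
  interpret T: yd_mod H V_P.VW V_P.act2 V_P.coact2 by (rule V_P.yd_mod_tensor)
  let ?P = "tpow V (Suc n)"
  note join = lin_tjoin[OF vecsp_V, of n] and split = lin_tsplit[OF vecsp_V, of n]
  note T = T.yd_mod_transport[where f = "tjoin V n" and f' = "tsplit V n" and X = ?P,
      OF vecsp_tpow join split tsplit_tjoin[OF vecsp_V] tjoin_tsplit[OF vecsp_V]]
  note [lin] = lin_comp[OF join] lin_map_in[OF join] lin_map_in[OF split]
  have act: "actn (Suc n) x t = tjoin V n (V_P.act2 x (tsplit V n t))" if "x \<in> carrier H" "t \<in> carrier ?P" for x t
    using V_P.yd_tensor_eq(3)[of V "yd_pow H V n"] lin_map_in[OF split] that by simp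
  have coact: "coactn (Suc n) t = sw H V_P.VW (V_P.coact2 (tsplit V n t)) (\<lambda>a s. tens H ?P a (tjoin V n s))"
    if t: "t \<in> carrier ?P" for t
  proof -
    have "coactn (Suc n) t = tlift H V_P.VW (tensor H ?P) (\<lambda>(a, s). tens H ?P a (tjoin V n s)) (V_P.coact2 (tsplit V n t))"
      using V_P.yd_tensor_eq(4)[of V "yd_pow H V n"] lin_map_in[OF split t] by simp
    also have "\<dots> = sw H V_P.VW (V_P.coact2 (tsplit V n t)) (\<lambda>a s. tens H ?P a (tjoin V n s))"
      by (assumption | rule sweq t lin refl)+
    finally show ?thesis .
  qed
  interpret X: yd_mod H ?P "\<lambda>x t. tjoin V n (V_P.act2 x (tsplit V n t))"
      "\<lambda>t. sw H V_P.VW (V_P.coact2 (tsplit V n t)) (\<lambda>a s. tens H ?P a (tjoin V n s))" by (rule T(1))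
  show "yd_mod H ?P (actn (Suc n)) (coactn (Suc n))"
    by (rule X.yd_mod_cong) (rule act coact; assumption)+
  show "yd_hom H V_P.VW V_P.act2 V_P.coact2 ?P (actn (Suc n)) (coactn (Suc n)) (tjoin V n)"
    using T(2) unfolding yd_hom_def
    by (simp add: act coact lin_map_in[OF join] del: yd_pow.simps)
  show "yd_hom H ?P (actn (Suc n)) (coactn (Suc n)) V_P.VW V_P.act2 V_P.coact2 (tsplit V n)"
    using T(3) unfolding yd_hom_def
    by (simp add: act coact lin_map_in[OF split] del: yd_pow.simps)
qed

lemma yd_mod_pow: "yd_mod H (tpow V n) (actn n) (coactn n)"
proof (induction n)
  case 0
  then show ?case using yd_mod_trivial[of "tpow V 0"] by simp
next
  case (Suc n)
  then show ?case by (rule yd_pow_Suc)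
qed

lemma yd_mod_pair_pow: "yd_mod_pair H V (act V) (coact V) (tpow V n) (actn n) (coactn n)"
  by (intro yd_mod_pair.intro hopf_alg_axioms yd_mod_axioms yd_mod_pow)

lemmas tjoin_hom = yd_pow_Suc(2)[OF yd_mod_pow]
lemmas tsplit_hom = yd_pow_Suc(3)[OF yd_mod_pow]

text \<open>The morphism is \<open>id \<otimes> f\<close>. The scalar \<open>c\<close> occurs because the last face map sends a word to a multiple
  of a word.\<close>

lemma pow_hom_Cons:
  assumes f: "pow_hom H V m n f"
  shows "\<exists>g. pow_hom H V (Suc m) (Suc n) g \<and> (\<forall>v\<in>carrier V. \<forall>vs\<in>words V m. \<forall>ws\<in>words V n. \<forall>c.
    f (wtens V m vs) = smul (tpow V n) c (wtens V n ws) \<longrightarrow>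
    g (wtens V (Suc m) (v # vs)) = smul (tpow V (Suc n)) c (wtens V (Suc n) (v # ws)))"
proof -
  interpret yd_mod_triple H V "act V" "coact V" "tpow V m" "actn m" "coactn m" "tpow V n" "actn n" "coactn n"
    by (intro yd_mod_triple.intro yd_mod_pair_pow yd_mod_pow)
  note T = yd_hom_id_tensor[OF f]
  let ?g = "\<lambda>t. tjoin V n (sw V (tpow V m) (tsplit V m t) (\<lambda>v w. tens V (tpow V n) v (f w)))"
  have "pow_hom H V (Suc m) (Suc n) ?g"
    by (rule yd_hom_comp[OF tsplit_hom yd_hom_comp[OF T(1) tjoin_hom]]) (rule lin)+
  moreover have "?g (wtens V (Suc m) (v # vs)) = smul (tpow V (Suc n)) c (wtens V (Suc n) (v # ws))"
    if "v \<in> carrier V" "vs \<in> words V m" "ws \<in> words V n" "f (wtens V m vs) = smul (tpow V n) c (wtens V n ws)"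
    for v vs ws c
  proof -
    have "?g (wtens V (Suc m) (v # vs)) = tjoin V n (tens V (tpow V n) v (smul (tpow V n) c (wtens V n ws)))"
      using that by (simp only: tsplit_wtens vecsp_V T(2) wtens_in)
    also have "\<dots> = smul (tpow V (Suc n)) c (tjoin V n (tens V (tpow V n) v (wtens V n ws)))"
      by (rule lin_map_smul[where f = "\<lambda>t. tjoin V n (tens V (tpow V n) v t)"])
        (assumption | rule that lin lin_comp[OF lin_tjoin])+
    finally show ?thesis using that by (simp only: tjoin_wtens vecsp_V)
  qed
  ultimately show ?thesis by blast
qed

lemma counit_face_first:
  assumes e: "yd_hom H V (act V) (coact V) ground (\<lambda>x c. \<epsilon> x * c) (tens H ground \<one>) e"
  shows "\<exists>F. pow_hom H V (Suc n) n F \<and> (\<forall>vs\<in>words V (Suc n).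
    F (wtens V (Suc n) vs) = smul (tpow V n) (e (hd vs)) (wtens V n (tl vs)))"
proof -
  interpret yd_mod_pair H V "act V" "coact V" "tpow V n" "actn n" "coactn n" by (rule yd_mod_pair_pow)
  note T = yd_hom_counit_tensor[OF e]
  show ?thesis
    by (rule exI, rule conjI, rule yd_hom_comp[OF tsplit_hom T(1)], rule lin)
      (auto simp: words_Suc tsplit_wtens vecsp_V T(2) wtens_in simp del: smul_tensor)
qed

text \<open>For \<open>n = 0\<close> the first and the last face map coincide; tensoring with the identity on the left
  gives the last face map in the next degree.\<close>

lemma counit_face_last:
  assumes e: "yd_hom H V (act V) (coact V) ground (\<lambda>x c. \<epsilon> x * c) (tens H ground \<one>) e"
  shows "\<exists>F. pow_hom H V (Suc n) n F \<and> (\<forall>vs\<in>words V (Suc n).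
    F (wtens V (Suc n) vs) = smul (tpow V n) (e (last vs)) (wtens V n (butlast vs)))"
proof (induction n)
  case 0
  obtain F where F: "pow_hom H V (Suc 0) 0 F" "\<And>vs. vs \<in> words V (Suc 0) \<Longrightarrow>
    F (wtens V (Suc 0) vs) = smul (tpow V 0) (e (hd vs)) (wtens V 0 (tl vs))"
    using counit_face_first[OF e, of 0] by blast
  have "hd vs = last vs \<and> tl vs = butlast vs" if "vs \<in> words V (Suc 0)" for vs
    using that by (auto simp: words_Suc)
  with F show ?case by (intro exI[of _ F]) simp
next
  case (Suc n)
  then obtain F where F: "pow_hom H V (Suc n) n F" "\<And>vs. vs \<in> words V (Suc n) \<Longrightarrow>
    F (wtens V (Suc n) vs) = smul (tpow V n) (e (last vs)) (wtens V n (butlast vs))" by blast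
  obtain G where G: "pow_hom H V (Suc (Suc n)) (Suc n) G" "\<And>v vs ws c. v \<in> carrier V \<Longrightarrow> vs \<in> words V (Suc n) \<Longrightarrow>
    ws \<in> words V n \<Longrightarrow> F (wtens V (Suc n) vs) = smul (tpow V n) c (wtens V n ws) \<Longrightarrow>
    G (wtens V (Suc (Suc n)) (v # vs)) = smul (tpow V (Suc n)) c (wtens V (Suc n) (v # ws))"
    using pow_hom_Cons[OF F(1)] by blast
  have "G (wtens V (Suc (Suc n)) vs) = smul (tpow V (Suc n)) (e (last vs)) (wtens V (Suc n) (butlast vs))"
    if vs: "vs \<in> words V (Suc (Suc n))" for vs
  proof -
    obtain u us where us: "vs = u # us" "u \<in> carrier V" "us \<in> words V (Suc n)"
      using vs by (subst (asm) words_Suc) blast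
    moreover have "us \<noteq> []" "butlast us \<in> words V n"
      using us(3) by (auto simp: words_def dest: in_set_butlastD)
    ultimately show ?thesis using G(2)[OF us(2,3) _ F(2)[OF us(3)]] by simp
  qed
  with G(1) show ?case by blast
qed

text \<open>Multiplication in the first two places is \<open>m \<otimes> id\<close> on \<open>V \<otimes> (V \<otimes> V\<^bsup>\<otimes>k\<^esup>)\<close>; all further places are
  reached by tensoring with the identity on the left.\<close>

lemma mult_face:
  assumes M: "yd_hom H (tensor V V) (tact H V (act V) V (act V)) (tcoact H V (coact V) V (coact V))
    V (act V) (coact V) M"
    and i: "i < n"
  defines "m \<equiv> \<lambda>u v. M (tens V V u v)"
  shows "\<exists>F. pow_hom H V (Suc n) n F \<and> (\<forall>vs\<in>words V (Suc n).
    F (wtens V (Suc n) vs) = wtens V n (take i vs @ m (vs ! i) (vs ! Suc i) # drop (Suc (Suc i)) vs))"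
  using i
proof (induction i arbitrary: n)
  case 0
  then obtain k where n: "n = Suc k" by (cases n) auto
  interpret P: yd_mod_pair H V "act V" "coact V" "tpow V k" "actn k" "coactn k" by (rule yd_mod_pair_pow)
  interpret VP: yd_mod H P.VW P.act2 P.coact2 by (rule P.yd_mod_tensor)
  interpret T: yd_mod_triple H V "act V" "coact V" "tpow V n" "actn n" "coactn n" P.VW P.act2 P.coact2
    by (intro yd_mod_triple.intro yd_mod_pair_pow VP.yd_mod_axioms)
  note split = T.yd_hom_id_tensor[OF tsplit_hom[of k, folded n]]
  note mult = P.yd_hom_mult_tensor[OF M]
  note hom = yd_hom_comp[OF tsplit_hom yd_hom_comp[OF split(1) yd_hom_comp[OF mult(1) tjoin_hom[of k, folded n]]]]
  show ?case
  proof (intro exI conjI ballI)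
    show "pow_hom H V (Suc n) n (\<lambda>t. tjoin V k
      (sw V P.VW (sw V (tpow V n) (tsplit V n t) (\<lambda>v w. tens V P.VW v (tsplit V k w)))
        (\<lambda>u s. sw V (tpow V k) s (\<lambda>v w. tens V (tpow V k) (M (tens V V u v)) w))))"
      by (rule hom) (rule lin)+
    fix vs assume "vs \<in> words V (Suc n)"
    then obtain u v ws where vs: "vs = u # v # ws" "u \<in> carrier V" "v \<in> carrier V" "ws \<in> words V k"
      unfolding n words_Suc by blast
    have uv: "m u v \<in> carrier V"
      unfolding m_def by (rule lin_map_in[OF yd_homD(1)[OF M]]) (assumption | rule vs lin)+
    have w: "v # ws \<in> words V n" using vs by (simp add: n)
    have "tsplit V n (wtens V (Suc n) vs) = tens V (tpow V n) u (wtens V n (v # ws))"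
      unfolding vs(1) by (rule tsplit_wtens[OF vecsp_V vs(2) w])
    moreover have "sw V (tpow V n) (tens V (tpow V n) u (wtens V n (v # ws))) (\<lambda>v w. tens V P.VW v (tsplit V k w)) =
      tens V P.VW u (tens V (tpow V k) v (wtens V k ws))"
      using split(2)[OF vs(2) wtens_in[OF w]] tsplit_wtens[OF vecsp_V vs(3,4)] by (simp only: n)
    moreover note mult(2)[OF vs(2,3) wtens_in[OF vs(4)]]
    moreover note tjoin_wtens[OF vecsp_V uv vs(4)]
    ultimately show "tjoin V k
      (sw V P.VW (sw V (tpow V n) (tsplit V n (wtens V (Suc n) vs)) (\<lambda>v w. tens V P.VW v (tsplit V k w)))
        (\<lambda>u s. sw V (tpow V k) s (\<lambda>v w. tens V (tpow V k) (M (tens V V u v)) w))) =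
      wtens V n (take 0 vs @ m (vs ! 0) (vs ! Suc 0) # drop (Suc (Suc 0)) vs)"
      by (simp add: m_def vs(1) n)
  qed
next
  case (Suc i)
  then obtain k where n: "n = Suc k" "i < k" by (cases n) auto
  let ?w = "\<lambda>i vs. take i vs @ m (vs ! i) (vs ! Suc i) # drop (Suc (Suc i)) vs"
  obtain F where F: "pow_hom H V (Suc k) k F" "\<And>vs. vs \<in> words V (Suc k) \<Longrightarrow>
    F (wtens V (Suc k) vs) = wtens V k (?w i vs)" using Suc.IH[OF n(2)] by blast
  obtain G where G: "pow_hom H V (Suc (Suc k)) (Suc k) G" "\<And>v vs ws c. v \<in> carrier V \<Longrightarrow> vs \<in> words V (Suc k) \<Longrightarrow>
    ws \<in> words V k \<Longrightarrow> F (wtens V (Suc k) vs) = smul (tpow V k) c (wtens V k ws) \<Longrightarrow>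
    G (wtens V (Suc (Suc k)) (v # vs)) = smul (tpow V (Suc k)) c (wtens V (Suc k) (v # ws))"
    using pow_hom_Cons[OF F(1)] by blast
  have "G (wtens V (Suc n) vs) = wtens V n (?w (Suc i) vs)" if vs: "vs \<in> words V (Suc n)" for vs
  proof -
    obtain u us where us: "vs = u # us" "u \<in> carrier V" "us \<in> words V (Suc k)"
      using vs unfolding n by (subst (asm) words_Suc) blast
    have len: "length us = Suc k" "set us \<subseteq> carrier V" using us(3) by (auto simp: words_def)
    have "m (us ! i) (us ! Suc i) \<in> carrier V"
      unfolding m_def by (rule lin_map_in[OF yd_homD(1)[OF M]])
        (rule lin subsetD[OF len(2)] nth_mem | simp add: len n(2) less_SucI)+
    then have "?w i us \<in> words V k"
      using len n(2) by (auto simp: words_def dest: in_set_takeD in_set_dropD)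
    moreover have one: "smul (tpow V j) 1 t = t" for j t
      by (rule smul_simps(4)) simp
    ultimately show ?thesis
      using G(2)[OF us(2,3), of "?w i us" 1] F(2)[OF us(3)] unfolding one by (simp add: us(1) n)
  qed
  with G(1) show ?case unfolding n by blast
qed

end

section \<open>The Drinfeld double acting on Yetter-Drinfeld modules\<close>

text \<open>Application as a constant: a rule for the linearity of \<open>ev f x\<close> can be found by its head symbol,
  whereas the bare application \<open>f x\<close> would match every term.\<close>

definition ev :: "('v \<Rightarrow> 'k) \<Rightarrow> 'v \<Rightarrow> 'k" where
  "ev f x = f x"

lemma bil_ev: "bil (dual V) V ground ev"
  by (rule bilI) (auto simp: lin_map_def fscale_def ev_def dual_def)

lemmas lin_ev [lin] = bil_l[OF bil_ev] bil_r[OF bil_ev]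

lemma restr_cong [sweq]:
  "(\<And>x. x \<in> carrier V \<Longrightarrow> f x = g x) \<Longrightarrow> restr V (\<lambda>x. f x) = restr V (\<lambda>x. g x)"
  by (auto simp: restr_def)

lemma ev_restr: "x \<in> carrier V \<Longrightarrow> ev (restr V f) x = f x"
  by (simp add: ev_def restr_def)

context hopf_alg
begin

abbreviation dbl where "dbl \<equiv> drinfeld_double H"
abbreviation DD where "DD \<equiv> tensor (dual H) H"

text \<open>With \<open>x = h\<^sub>1\<close> and \<open>y = h\<^sub>3\<close> this is the factor in \<open>H\<^sup>*\<close> of the product \<open>(f \<otimes> h) (g \<otimes> l)\<close>, whose factor
  in \<open>H\<close> is \<open>h\<^sub>2 l\<close>.\<close>

definition twist where
  "twist f g x y = restr H (\<lambda>z. \<Delta> z (\<lambda>z1 z2. ev g (\<S> x \<cdot> z1 \<cdot> y) * ev f z2))"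

definition dmul where
  "dmul d e = sw (dual H) H d (\<lambda>f h. sw (dual H) H e (\<lambda>g l.
     \<Delta> h (\<lambda>x k. \<Delta> k (\<lambda>y z. tens (dual H) H (twist f g x z) (y \<cdot> l)))))"

definition dcounit where
  "dcounit d = sw (dual H) H d (\<lambda>f h. ev f \<one> * \<epsilon> h)"

lemma bil_dmul: "bil DD DD DD dmul"
  unfolding dmul_def twist_def by (assumption | rule lin)+

lemmas lin_dmul [lin] = bil_l[OF bil_dmul] bil_r[OF bil_dmul] bil_in[OF bil_dmul]

lemma lin_dcounit: "lin_map DD ground dcounit"
  unfolding dcounit_def by (assumption | rule lin)+

lemmas lin_dcounit' [lin] = lin_comp[OF lin_dcounit]

lemma twist_in [lin]:
  "f \<in> carrier (dual H) \<Longrightarrow> g \<in> carrier (dual H) \<Longrightarrow> x \<in> carrier H \<Longrightarrow> y \<in> carrier H \<Longrightarrow>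
    twist f g x y \<in> carrier (dual H)"
  unfolding twist_def by (assumption | rule lin)+

lemma double_simps:
  "carrier dbl = carrier DD" "smul dbl = fscale" "unt dbl = tens (dual H) H (restr H \<epsilon>) \<one>"
  by (simp_all add: drinfeld_double_def)

lemma tens_cong_l: "x = y \<Longrightarrow> tens V W x w = tens V W y w"
  by simp

lemma double_mul: "d \<in> carrier DD \<Longrightarrow> e \<in> carrier DD \<Longrightarrow> mul dbl d e = dmul d e"
  unfolding drinfeld_double_def alg.simps dmul_def twist_def
  by (assumption | rule sweq lin refl tens_cong_l | (simp only: ev_def; fail))+

lemma double_counit: "d \<in> carrier DD \<Longrightarrow> counit dbl d = dcounit d"
  unfolding drinfeld_double_def aug_alg.simps dcounit_def
  by (assumption | rule sweq lin refl | (simp only: ev_def; fail))+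

lemma double_unt_in [lin]: "tens (dual H) H (restr H \<epsilon>) \<one> \<in> carrier DD"
  by (assumption | rule lin)+

lemma dcounit_tens: "f \<in> carrier (dual H) \<Longrightarrow> h \<in> carrier H \<Longrightarrow> dcounit (tens (dual H) H f h) = ev f \<one> * \<epsilon> h"
  unfolding dcounit_def by (assumption | rule sweq lin refl)+

lemma dcounit_unt: "dcounit (tens (dual H) H (restr H \<epsilon>) \<one>) = 1"
proof -
  have "dcounit (tens (dual H) H (restr H \<epsilon>) \<one>) = ev (restr H \<epsilon>) \<one> * \<epsilon> \<one>"
    by (rule dcounit_tens) (assumption | rule lin)+
  then show ?thesis by (simp add: ev_restr unt_in counit_unt)
qed

lemma dmul_tens:
  assumes "f \<in> carrier (dual H)" "h \<in> carrier H" "g \<in> carrier (dual H)" "l \<in> carrier H"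
  shows "dmul (tens (dual H) H f h) (tens (dual H) H g l) =
    \<Delta> h (\<lambda>x k. \<Delta> k (\<lambda>y z. tens (dual H) H (twist f g x z) (y \<cdot> l)))"
  unfolding dmul_def twist_def by (assumption | rule sweq assms lin refl)+

text \<open>After \<open>h\<^sub>2\<close> is absorbed by the counit, \<open>g (S(h\<^sub>1) h\<^sub>2)\<close> collapses to \<open>\<epsilon>(h) g(1)\<close>.\<close>

lemma dcounit_mul:
  assumes d: "d \<in> carrier DD" and e: "e \<in> carrier DD"
  shows "dcounit (dmul d e) = dcounit d * dcounit e"
proof (rule tensor_ext[where f = "\<lambda>d. dcounit (dmul d e)" and U = ground, OF _ _ _ d], ((assumption | rule e lin)+)[2])
  fix f h assume f: "f \<in> carrier (dual H)" and h: "h \<in> carrier H"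
  show "dcounit (dmul (tens (dual H) H f h) e) = dcounit (tens (dual H) H f h) * dcounit e"
  proof (rule tensor_ext[where U = ground, OF _ _ _ e], ((assumption | rule f h lin)+)[2])
    fix g l assume g: "g \<in> carrier (dual H)" and l: "l \<in> carrier H"
    have tw: "ev (twist f g x z) \<one> = ev g (\<S> x \<cdot> z) * ev f \<one>" if "x \<in> carrier H" "z \<in> carrier H" for x z
    proof -
      have "ev (twist f g x z) \<one> = \<Delta> \<one> (\<lambda>z1 z2. ev g (\<S> x \<cdot> z1 \<cdot> z) * ev f z2)"
        unfolding twist_def by (rule ev_restr) (rule lin)
      also have "\<dots> = ev g (\<S> x \<cdot> \<one> \<cdot> z) * ev f \<one>"
        by (rule comul_one[where U = ground]) (assumption | rule that f g lin)+
      finally show ?thesis using that by (simp add: mul_unt antipode_in)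
    qed
    have "dcounit (dmul (tens (dual H) H f h) (tens (dual H) H g l)) =
      \<Delta> h (\<lambda>x k. \<Delta> k (\<lambda>y z. dcounit (tens (dual H) H (twist f g x z) (y \<cdot> l))))" (is "?l = _")
      unfolding dmul_tens[OF f h g l]
      by (subst lin_map_sw[OF lin_dcounit], (assumption | rule f g h l lin)+, rule sw_cong,
          subst lin_map_sw[OF lin_dcounit]) (assumption | rule f g h l lin refl)+
    also have "\<dots> = \<Delta> h (\<lambda>x k. \<Delta> k (\<lambda>y z. smul ground (\<epsilon> y) (ev g (\<S> x \<cdot> z) * ev f \<one> * \<epsilon> l)))"
      by (intro sw_cong[OF _ vecsp_H]) (simp add: dcounit_tens twist_in mul_in f g h l tw counit_mul)
    also have "\<dots> = \<Delta> h (\<lambda>x k. ev g (\<S> x \<cdot> k) * ev f \<one> * \<epsilon> l)"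
      by (rule sw_cong, rule counit_l) (assumption | rule f g h l lin)+
    also have "\<dots> = smul ground (\<epsilon> h) (ev g \<one> * ev f \<one> * \<epsilon> l)"
      by (rule antipode_l) (assumption | rule f g h l lin)+
    also have "\<dots> = dcounit (tens (dual H) H f h) * dcounit (tens (dual H) H g l)"
      by (simp add: dcounit_tens f g h l)
    finally show "?l = \<dots>" .
  qed simp
qed simp

end

context yd_mod
begin

definition dact where
  "dact d v = sw (dual H) H d (\<lambda>f h. sw H V (\<delta> (\<alpha> h v)) (\<lambda>a w. smul V (ev f a) w))"

lemma bil_dact: "bil DD V V dact"
  unfolding dact_def by (assumption | rule lin)+

lemmas lin_dact [lin] = bil_l[OF bil_dact] bil_r[OF bil_dact] bil_in[OF bil_dact]

lemma dact_tens:
  assumes "f \<in> carrier (dual H)" "h \<in> carrier H" "v \<in> carrier V"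
  shows "dact (tens (dual H) H f h) v = sw H V (\<delta> (\<alpha> h v)) (\<lambda>a w. smul V (ev f a) w)"
  unfolding dact_def by (assumption | rule sweq assms lin refl)+

lemma dact_H:
  assumes "h \<in> carrier H" "v \<in> carrier V"
  shows "dact (tens (dual H) H (restr H \<epsilon>) h) v = \<alpha> h v"
proof -
  have "dact (tens (dual H) H (restr H \<epsilon>) h) v = sw H V (\<delta> (\<alpha> h v)) (\<lambda>a w. smul V (ev (restr H \<epsilon>) a) w)"
    by (rule dact_tens) (assumption | rule assms lin)+
  also have "\<dots> = sw H V (\<delta> (\<alpha> h v)) (\<lambda>a w. smul V (\<epsilon> a) w)"
    by (intro sw_cong[OF _ vecsp_H]) (simp add: ev_restr)
  also have "\<dots> = \<alpha> h v"
    by (rule counit_id) (assumption | rule assms lin)+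
  finally show ?thesis .
qed

lemma dact_one: "v \<in> carrier V \<Longrightarrow> dact (tens (dual H) H (restr H \<epsilon>) \<one>) v = v"
  by (simp add: dact_H unt_in act_one)

lemma double_act_eq:
  assumes V': "carrier V' = carrier V" "smul V' = smul V" "act V' = \<alpha>" "coact V' = \<delta>"
    and "d \<in> carrier DD" "v \<in> carrier V"
  shows "double_act H V' d v = dact d v"
proof -
  have "tlift (dual H) H V' = tlift (dual H) H V" "tlift H V' V' = tlift H V V"
    by (rule tlift_cong; rule refl V')+
  then show ?thesis
    unfolding double_act_def dact_def V'
    by (simp only:) (assumption | rule sweq assms lin refl | (simp only: ev_def; fail))+
qed

text \<open>Put \<open>u = l v\<close>. The left side is \<open>g (S(h\<^sub>1) (h\<^sub>2 u)\<^bsub>-1\<^esub> h\<^sub>3) f ((h\<^sub>2 u)\<^bsub>0,-1\<^esub>) (h\<^sub>2 u)\<^bsub>0,0\<^esub>\<close>. The Yetter-Drinfeld condition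
  replaces \<open>(h\<^sub>2 u)\<^bsub>-1\<^esub> h\<^sub>3 \<otimes> (h\<^sub>2 u)\<^sub>0\<close> by \<open>h\<^sub>2 u\<^bsub>-1\<^esub> \<otimes> h\<^sub>3 u\<^sub>0\<close>, whereupon the antipode cancels \<open>h\<^sub>1\<close> against
  \<open>h\<^sub>2\<close>.\<close>

lemma dact_mul:
  assumes d: "d \<in> carrier DD" and e: "e \<in> carrier DD" and v: "v \<in> carrier V"
  shows "dact (dmul d e) v = dact d (dact e v)"
proof (rule tensor_ext[where f = "\<lambda>d. dact (dmul d e) v" and U = V, OF _ _ _ d], ((assumption | rule e v lin)+)[2])
  fix f h assume f: "f \<in> carrier (dual H)" and h: "h \<in> carrier H"
  show "dact (dmul (tens (dual H) H f h) e) v = dact (tens (dual H) H f h) (dact e v)"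
  proof (rule tensor_ext[where U = V, OF _ _ _ e], ((assumption | rule f h v lin)+)[2])
    fix g l assume g: "g \<in> carrier (dual H)" and l: "l \<in> carrier H"
    define u where "u = \<alpha> l v"
    have u: "u \<in> carrier V" unfolding u_def by (assumption | rule l v lin)+
    note * = f h g l v u
    have "dact (dmul (tens (dual H) H f h) (tens (dual H) H g l)) v =
      \<Delta> h (\<lambda>x k. \<Delta> k (\<lambda>y z. dact (tens (dual H) H (twist f g x z) (y \<cdot> l)) v))" (is "?l = _")
      unfolding dmul_tens[OF f h g l]
      by (subst lin_map_sw[where f = "\<lambda>d. dact d v" and U = DD and U' = V], (assumption | rule * lin)+, rule sw_cong,
          subst lin_map_sw[where f = "\<lambda>d. dact d v" and U = DD and U' = V]) (assumption | rule * lin refl)+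
    also have "\<dots> = \<Delta> h (\<lambda>x k. \<Delta> k (\<lambda>y z. sw H V (\<delta> (\<alpha> y u)) (\<lambda>a w.
        \<Delta> a (\<lambda>a1 a2. smul V (ev g (\<S> x \<cdot> a1 \<cdot> z) * ev f a2) w))))"
    proof (intro sw_cong[OF _ vecsp_H])
      fix x k y z assume xyz: "x \<in> carrier H" "k \<in> carrier H" "y \<in> carrier H" "z \<in> carrier H"
      have "dact (tens (dual H) H (twist f g x z) (y \<cdot> l)) v =
         sw H V (\<delta> (\<alpha> (y \<cdot> l) v)) (\<lambda>a w. smul V (ev (twist f g x z) a) w)" (is "?l = _")
        by (rule dact_tens) (assumption | rule * xyz lin)+
      also have "\<dots> = sw H V (\<delta> (\<alpha> y u)) (\<lambda>a w. smul V (ev (twist f g x z) a) w)"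
        using xyz by (simp add: u_def act_mul l v)
      also have "\<dots> = sw H V (\<delta> (\<alpha> y u)) (\<lambda>a w. \<Delta> a (\<lambda>a1 a2. smul V (ev g (\<S> x \<cdot> a1 \<cdot> z) * ev f a2) w))"
      proof (rule sw_cong[OF _ vecsp_H])
        fix a w assume aw: "a \<in> carrier H" "w \<in> carrier V"
        show "smul V (ev (twist f g x z) a) w = \<Delta> a (\<lambda>a1 a2. smul V (ev g (\<S> x \<cdot> a1 \<cdot> z) * ev f a2) w)"
          unfolding twist_def ev_restr[OF aw(1)]
          by (rule lin_map_sw[where f = "\<lambda>c. smul V c w" and U = ground and U' = V])
            (assumption | rule * xyz aw lin)+
      qed
      finally show "?l = \<dots>" .
    qed
    also have "\<dots> = \<Delta> h (\<lambda>x k. \<Delta> k (\<lambda>y z. sw H V (\<delta> (\<alpha> y u)) (\<lambda>a w. sw H V (\<delta> w) (\<lambda>b w.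
        smul V (ev g (\<S> x \<cdot> (a \<cdot> z)) * ev f b) w))))"
    proof (rule sw_cong[OF _ vecsp_H], rule sw_cong[OF _ vecsp_H])
      fix x k y z assume xyz: "x \<in> carrier H" "k \<in> carrier H" "y \<in> carrier H" "z \<in> carrier H"
      have "sw H V (\<delta> (\<alpha> y u)) (\<lambda>a w. \<Delta> a (\<lambda>a1 a2. smul V (ev g (\<S> x \<cdot> a1 \<cdot> z) * ev f a2) w)) =
        sw H V (\<delta> (\<alpha> y u)) (\<lambda>a w. sw H V (\<delta> w) (\<lambda>b w. smul V (ev g (\<S> x \<cdot> a \<cdot> z) * ev f b) w))" (is "?l = _")
        by (rule coact_coassoc[where U = V]) (assumption | rule * xyz lin)+
      also have "\<dots> = sw H V (\<delta> (\<alpha> y u)) (\<lambda>a w. sw H V (\<delta> w) (\<lambda>b w. smul V (ev g (\<S> x \<cdot> (a \<cdot> z)) * ev f b) w))"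
        by (intro sw_cong[OF _ vecsp_H]) (simp add: mul_assoc xyz antipode_in)
      finally show "?l = \<dots>" .
    qed
    also have "\<dots> = \<Delta> h (\<lambda>x k. \<Delta> k (\<lambda>y z. sw H V (\<delta> u) (\<lambda>a w. sw H V (\<delta> (\<alpha> z w)) (\<lambda>b w.
        smul V (ev g (\<S> x \<cdot> (y \<cdot> a)) * ev f b) w))))"
      by (rule sw_cong, rule yd_compat[where U = V]) (assumption | rule * lin)+
    also have "\<dots> = \<Delta> h (\<lambda>k z. \<Delta> k (\<lambda>x y. sw H V (\<delta> u) (\<lambda>a w. sw H V (\<delta> (\<alpha> z w)) (\<lambda>b w.
        smul V (ev g (\<S> x \<cdot> (y \<cdot> a)) * ev f b) w))))"
      by (rule sym, rule coassoc[where U = V]) (assumption | rule * lin)+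
    also have "\<dots> = \<Delta> h (\<lambda>k z. \<Delta> k (\<lambda>x y. sw H V (\<delta> u) (\<lambda>a w. sw H V (\<delta> (\<alpha> z w)) (\<lambda>b w.
        smul V (ev g (\<S> x \<cdot> y \<cdot> a) * ev f b) w))))"
      by (intro sw_cong[OF _ vecsp_H]) (simp add: mul_assoc antipode_in)
    also have "\<dots> = \<Delta> h (\<lambda>k z. smul V (\<epsilon> k) (sw H V (\<delta> u) (\<lambda>a w. sw H V (\<delta> (\<alpha> z w)) (\<lambda>b w.
        smul V (ev g (\<one> \<cdot> a) * ev f b) w))))"
      by (rule sw_cong, rule antipode_l) (assumption | rule * lin)+
    also have "\<dots> = sw H V (\<delta> u) (\<lambda>a w. sw H V (\<delta> (\<alpha> h w)) (\<lambda>b w. smul V (ev g (\<one> \<cdot> a) * ev f b) w))"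
      by (rule counit_l) (assumption | rule * lin)+
    also have "\<dots> = sw H V (\<delta> u) (\<lambda>a w. sw H V (\<delta> (\<alpha> h w)) (\<lambda>b w. smul V (ev g a) (smul V (ev f b) w)))"
      by (intro sw_cong[OF _ vecsp_H]) (simp add: mul_unt smul_simps vecsp_V)
    also have "\<dots> = sw H V (\<delta> u) (\<lambda>a w. smul V (ev g a) (dact (tens (dual H) H f h) w))"
    proof (intro sw_cong[OF _ vecsp_H])
      fix a w assume aw: "a \<in> carrier H" "w \<in> carrier V"
      show "sw H V (\<delta> (\<alpha> h w)) (\<lambda>b w. smul V (ev g a) (smul V (ev f b) w)) =
        smul V (ev g a) (dact (tens (dual H) H f h) w)"
        unfolding dact_tens[OF f h aw(2)]
        by (rule sym, rule lin_map_sw[where f = "smul V (ev g a)" and U = V and U' = V])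
          (assumption | rule * aw lin)+
    qed
    also have "\<dots> = sw H V (\<delta> u) (\<lambda>a w. dact (tens (dual H) H f h) (smul V (ev g a) w))"
      by (rule sw_cong, rule sym, rule lin_map_smul[OF bil_r[OF bil_dact _ lin_id]]) (assumption | rule * lin)+
    also have "\<dots> = dact (tens (dual H) H f h) (dact (tens (dual H) H g l) v)"
      unfolding dact_tens[OF g l v] u_def
      by (rule sym, rule lin_map_sw[where U = V and U' = V]) (assumption | rule * lin)+
    finally show "?l = \<dots>" .
  qed (rule lin)
qed (rule lin)

lemma hom_dact:
  assumes F: "yd_hom H V \<alpha> \<delta> W \<beta> \<gamma> F" and W: "yd_mod H W \<beta> \<gamma>"
    and d: "d \<in> carrier DD" and v: "v \<in> carrier V"
  shows "F (dact d v) = yd_mod.dact H W \<beta> \<gamma> d (F v)"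
proof -
  interpret W: yd_mod H W \<beta> \<gamma> by fact
  note [lin] = lin_comp[OF yd_homD(1)[OF F]] lin_map_in[OF yd_homD(1)[OF F]]
  have "F (dact d v) = sw (dual H) H d (\<lambda>f h. F (sw H V (\<delta> (\<alpha> h v)) (\<lambda>a w. smul V (ev f a) w)))"
    unfolding dact_def by (rule lin_map_sw[OF yd_homD(1)[OF F]]) (assumption | rule v lin)+
  also have "\<dots> = sw (dual H) H d (\<lambda>f h. sw H W (\<gamma> (\<beta> h (F v))) (\<lambda>a w. smul W (ev f a) w))"
  proof (rule sw_cong[OF _ vecsp_dual])
    fix f h assume f: "f \<in> carrier (dual H)" and h: "h \<in> carrier H"
    have "F (sw H V (\<delta> (\<alpha> h v)) (\<lambda>a w. smul V (ev f a) w)) = sw H V (\<delta> (\<alpha> h v)) (\<lambda>a w. F (smul V (ev f a) w))" (is "?l = _")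
      by (rule lin_map_sw[OF yd_homD(1)[OF F]]) (assumption | rule v f h lin)+
    also have "\<dots> = sw H V (\<delta> (\<alpha> h v)) (\<lambda>a w. smul W (ev f a) (F w))"
      by (intro sw_cong[OF _ vecsp_H] lin_map_smul[OF yd_homD(1)[OF F]])
    also have "\<dots> = sw H W (\<gamma> (F (\<alpha> h v))) (\<lambda>a w. smul W (ev f a) w)"
      by (rule sym, rule yd_hom_coact[OF F]) (assumption | rule v f h lin)+
    finally show "?l = sw H W (\<gamma> (\<beta> h (F v))) (\<lambda>a w. smul W (ev f a) w)"
      using h v by (simp add: yd_homD(2)[OF F])
  qed
  finally show ?thesis by (simp add: W.dact_def)
qed

text \<open>The elements \<open>\<epsilon> \<otimes> h\<close> of \<open>D(H)\<close> express \<open>H\<close>-linearity. The elements \<open>g \<otimes> 1\<close> express that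
  \<open>F(v\<^sub>0) v\<^bsub>-1\<^esub>\<close> and \<open>F(v) 1\<close> have the same image under every linear form \<open>g\<close> on \<open>H\<close>, which is
  colinearity.\<close>

lemma hom_ground_iff:
  assumes F: "lin_map V ground F"
  shows "yd_hom H V \<alpha> \<delta> ground (\<lambda>x c. \<epsilon> x * c) (tens H ground \<one>) F \<longleftrightarrow>
    (\<forall>d\<in>carrier DD. \<forall>v\<in>carrier V. F (dact d v) = dcounit d * F v)"
proof
  assume hom: "yd_hom H V \<alpha> \<delta> ground (\<lambda>x c. \<epsilon> x * c) (tens H ground \<one>) F"
  interpret k: yd_mod H "ground :: ('k, 'k) vecsp" "\<lambda>x c. \<epsilon> x * c" "tens H ground \<one>"
    using yd_mod_trivial[OF vecsp_ground] by simp
  have "k.dact d c = dcounit d * c" if "d \<in> carrier DD" for d c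
  proof -
    have "k.dact d c = sw (dual H) H d (\<lambda>f h. ev f \<one> * \<epsilon> h * c)"
      unfolding k.dact_def
      by (rule sw_cong) (assumption | rule sweq that lin | simp add: mult.assoc; fail)+
    also have "\<dots> = dcounit d * c"
      unfolding dcounit_def by (rule sym, rule lin_map_sw[where U = ground and U' = ground and f = "\<lambda>x. x * c"])
        (assumption | rule that lin)+
    finally show ?thesis .
  qed
  then show "\<forall>d\<in>carrier DD. \<forall>v\<in>carrier V. F (dact d v) = dcounit d * F v"
    using hom_dact[OF hom k.yd_mod_axioms] by simp
next
  assume inv: "\<forall>d\<in>carrier DD. \<forall>v\<in>carrier V. F (dact d v) = dcounit d * F v"
  note [lin] = lin_comp[OF F]
  show "yd_hom H V \<alpha> \<delta> ground (\<lambda>x c. \<epsilon> x * c) (tens H ground \<one>) F"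
    unfolding yd_hom_def
  proof (intro conjI ballI F)
    fix h v assume hv: "h \<in> carrier H" "v \<in> carrier V"
    have "tens (dual H) H (restr H \<epsilon>) h \<in> carrier DD" "restr H \<epsilon> \<in> carrier (dual H)"
      by (assumption | rule hv lin)+
    then show "F (\<alpha> h v) = \<epsilon> h * F v"
      using inv hv by (simp add: dact_H[OF hv, symmetric] dcounit_tens ev_restr unt_in counit_unt)
  next
    fix v assume v: "v \<in> carrier V"
    have one: "tens H ground a c = tens H ground (smul H c a) 1" if "a \<in> carrier H" for a c
      using lin_map_smul[where f = "\<lambda>a. tens H ground a 1", OF bil_l[OF bil_tens in_ground lin_id] that, of c]
        lin_map_smul[where f = "tens H ground a", OF bil_r[OF bil_tens that lin_id] in_ground, of c 1] by simp
    have "sw H V (\<delta> v) (\<lambda>a w. smul H (F w) a) = smul H (F v) \<one>"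
    proof (rule vecsp_eqI[OF vecsp_H])
      fix g assume g: "lin_map H ground g" "\<And>x. x \<notin> carrier H \<Longrightarrow> g x = 0"
      then have gd: "g \<in> carrier (dual H)" by (simp add: dual_def)
      have d: "tens (dual H) H g \<one> \<in> carrier DD" by (assumption | rule gd lin)+
      have "g (sw H V (\<delta> v) (\<lambda>a w. smul H (F w) a)) = sw H V (\<delta> v) (\<lambda>a w. g (smul H (F w) a))" (is "?l = _")
        by (rule lin_map_sw[OF g(1)]) (assumption | rule v lin)+
      also have "\<dots> = sw H V (\<delta> v) (\<lambda>a w. F (smul V (ev g a) w))"
        by (intro sw_cong[OF _ vecsp_H]) (simp add: lin_map_smul[OF g(1)] lin_map_smul[OF F] ev_def)
      also have "\<dots> = F (dact (tens (dual H) H g \<one>) v)"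
        unfolding dact_tens[OF gd unt_in v] act_one[OF v]
        by (rule sym, rule lin_map_sw[OF F]) (assumption | rule v gd lin)+
      also have "\<dots> = g (smul H (F v) \<one>)"
        using inv d v by (simp add: dcounit_tens gd unt_in counit_unt lin_map_smul[OF g(1)] ev_def)
      finally show "?l = \<dots>" .
    qed (assumption | rule v lin)+
    then have "tens H ground \<one> (F v) = tens H ground (sw H V (\<delta> v) (\<lambda>a w. smul H (F w) a)) 1"
      by (simp add: one unt_in)
    also have "\<dots> = sw H V (\<delta> v) (\<lambda>a w. tens H ground (smul H (F w) a) 1)"
      by (rule lin_map_sw[where U = H and U' = "tensor H ground"]) (assumption | rule v lin)+
    also have "\<dots> = sw H V (\<delta> v) (\<lambda>a w. tens H ground a (F w))"
      by (intro sw_cong[OF _ vecsp_H] one[symmetric])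
    finally show "tens H ground \<one> (F v) = \<dots>" .
  qed
qed

end

section \<open>Integrals\<close>

lemma sum_mem: "(\<And>p. p \<in> I \<Longrightarrow> g p \<in> carrier V) \<Longrightarrow> vecsp V \<Longrightarrow> sum g I \<in> carrier V"
  by (induction I rule: infinite_finite_induct) (auto intro: vecsp_zero vecsp_add)

lemma lin_map_sum:
  assumes "lin_map V W f" "vecsp V" "vecsp W" "\<And>p. p \<in> I \<Longrightarrow> g p \<in> carrier V"
  shows "f (sum g I) = (\<Sum>p\<in>I. f (g p))"
  using assms(4)
  by (induction I rule: infinite_finite_induct)
    (auto simp: lin_map_zero[OF assms(1-3)] lin_map_add[OF assms(1)] sum_mem[OF _ assms(2)])

lemma span_vanish:
  assumes X: "vecsp X" and U: "vecsp U" and L: "lin_map X U L" and S: "S \<subseteq> carrier X"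
    and 0: "\<And>s. s \<in> S \<Longrightarrow> L s = 0" and x: "x \<in> module.span (smul X) S"
  shows "L x = 0"
proof -
  interpret X: vector_space "smul X" by (rule vecsp_vector_space[OF X])
  have "x \<in> carrier X \<and> L x = 0"
    using x
  proof (induction rule: X.span_induct_alt)
    case base
    show ?case using lin_map_zero[OF L X U] vecsp_zero[OF X] by simp
  next
    case (step c s x)
    then show ?case
      using S 0 vecsp_smul[of s X c] X
      by (auto simp: vecsp_add lin_map_add[OF L] lin_map_smul[OF L] smul_simps[OF U])
  qed
  then show ?thesis ..
qed

lemma separating_functional:
  assumes U: "vecsp U" and D: "module.subspace (smul U) D" and x: "x \<notin> D"
  shows "\<exists>\<phi>. lin_map U ground \<phi> \<and> (\<forall>y\<in>D. \<phi> y = 0) \<and> \<phi> x = 1"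
proof -
  interpret p: vector_space_pair "smul U" "(*) :: 'a \<Rightarrow> 'a \<Rightarrow> 'a"
    by (intro vector_space_pair.intro vecsp_vector_space[OF U] vector_space_ground)
  obtain A where A: "A \<subseteq> D" "p.vs1.independent A" "D \<subseteq> p.vs1.span A"
    by (rule p.vs1.maximal_independent_subset)
  have "p.vs1.span A \<subseteq> D" using A(1) D by (simp add: p.vs1.span_minimal)
  then have xA: "x \<notin> p.vs1.span A" using x by auto
  have ind: "p.vs1.independent (insert x A)"
    using A(2) xA by (simp add: p.vs1.independent_insert)
  have "x \<notin> A" using xA by (auto intro: p.vs1.span_base)
  define \<phi> where "\<phi> = p.construct (insert x A) (\<lambda>b. if b = x then 1 else 0)"
  have lin: "Vector_Spaces.linear (smul U) (*) \<phi>"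
    unfolding \<phi>_def by (rule p.linear_construct[OF ind])
  have "\<phi> b = (if b = x then 1 else 0)" if "b \<in> insert x A" for b
    unfolding \<phi>_def by (rule p.construct_basis[OF ind that])
  then have "\<phi> x = 1" "\<And>b. b \<in> A \<Longrightarrow> \<phi> b = 0" using \<open>x \<notin> A\<close> by auto
  moreover have "\<phi> y = 0" if "y \<in> D" for y
    by (rule p.linear_eq_0_on_span[OF lin, of A]) (use calculation A(3) that in auto)
  moreover have "lin_map U ground \<phi>"
    using lin unfolding linear_iff_module_hom
    by (auto simp: lin_map_def module_hom.add module_hom.scale)
  ultimately show ?thesis by blast
qed

text \<open>Expand the second tensor factors in a basis of \<open>W\<close>; finitely many basis vectors occur in the chosen
  representation of \<open>t\<close>.\<close>

lemma tensor_coordinates: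
  assumes V: "vecsp V" and W: "vecsp W" and t: "t \<in> carrier (tensor V W)"
  shows "\<exists>T \<phi>. finite T \<and> T \<subseteq> carrier W \<and> (\<forall>b\<in>T. lin_map W ground (\<phi> b)) \<and>
    t = (\<Sum>b\<in>T. tens V W (sw V W t (\<lambda>v w. smul V (\<phi> b w) v)) b)"
proof -
  interpret W: vector_space "smul W" by (rule vecsp_vector_space[OF W])
  note [lin] = V W
  obtain A where A: "A \<subseteq> carrier W" "W.independent A" "carrier W \<subseteq> W.span A"
    by (rule W.maximal_independent_subset)
  let ?\<phi> = "\<lambda>b w. W.representation A w b"
  define T where "T = (\<Union>p\<in>set (tens_rep V W t). {b. ?\<phi> b (snd p) \<noteq> 0})"
  have fin: "finite T" unfolding T_def by (simp add: W.finite_representation)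
  have TA: "T \<subseteq> A" unfolding T_def using W.representation_ne_zero by blast
  have \<phi>: "lin_map W ground (?\<phi> b)" for b
    using A(3) by (intro lin_mapI) (auto simp: W.representation_add[OF A(2)] W.representation_scale[OF A(2)] subset_iff)
  note [lin] = lin_comp[OF \<phi>]
  have ps: "fst p \<in> carrier V" "snd p \<in> carrier W" if "p \<in> set (tens_rep V W t)" for p
    using tens_rep(1)[OF V, of W t] that by auto
  have coord: "(\<Sum>b\<in>T. smul W (?\<phi> b (snd p)) b) = snd p" if p: "p \<in> set (tens_rep V W t)" for p
  proof -
    have "snd p \<in> W.span A" using ps(2)[OF p] A(3) by blast
    then have "(\<Sum>b | ?\<phi> b (snd p) \<noteq> 0. smul W (?\<phi> b (snd p)) b) = snd p"
      by (rule W.sum_nonzero_representation_eq[OF A(2)])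
    moreover have "(\<Sum>b | ?\<phi> b (snd p) \<noteq> 0. smul W (?\<phi> b (snd p)) b) = (\<Sum>b\<in>T. smul W (?\<phi> b (snd p)) b)"
      using p by (intro sum.mono_neutral_left fin) (auto simp: T_def)
    ultimately show ?thesis by simp
  qed
  have TW: "b \<in> carrier W" if "b \<in> T" for b using TA A(1) that by auto
  have "(\<Sum>b\<in>T. tens V W (sw V W t (\<lambda>v w. smul V (?\<phi> b w) v)) b) =
      (\<Sum>b\<in>T. sw V W t (\<lambda>v w. tens V W v (smul W (?\<phi> b w) b)))"
  proof (rule sum.cong[OF refl])
    fix b assume "b \<in> T"
    then have b: "b \<in> carrier W" by (rule TW)
    have "tens V W (sw V W t (\<lambda>v w. smul V (?\<phi> b w) v)) b = sw V W t (\<lambda>v w. tens V W (smul V (?\<phi> b w) v) b)" (is "?l = _")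
      by (rule lin_map_sw[where U = V and U' = "tensor V W"]) (assumption | rule b lin)+
    also have "\<dots> = sw V W t (\<lambda>v w. tens V W v (smul W (?\<phi> b w) b))"
      by (intro sw_cong[OF _ V]) (simp add: lin_map_smul[OF bil_l[OF bil_tens _ lin_id]]
          lin_map_smul[OF bil_r[OF bil_tens _ lin_id]] b)
    finally show "?l = \<dots>" .
  qed
  also have "\<dots> = (\<Sum>p\<leftarrow>tens_rep V W t. \<Sum>b\<in>T. tens V W (fst p) (smul W (?\<phi> b (snd p)) b))"
    unfolding sw_def by (simp add: sum_list_sum_nth sum.swap[of _ _ T])
  also have "\<dots> = (\<Sum>p\<leftarrow>tens_rep V W t. tens V W (fst p) (snd p))"
  proof (intro arg_cong[of _ _ sum_list] map_cong refl)
    fix p assume p: "p \<in> set (tens_rep V W t)"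
    have "(\<Sum>b\<in>T. tens V W (fst p) (smul W (?\<phi> b (snd p)) b)) = tens V W (fst p) (\<Sum>b\<in>T. smul W (?\<phi> b (snd p)) b)"
      by (rule lin_map_sum[OF bil_r[OF bil_tens ps(1)[OF p] lin_id] W vecsp_tensor, symmetric])
        (rule vecsp_smul[OF TW W])
    then show "(\<Sum>b\<in>T. tens V W (fst p) (smul W (?\<phi> b (snd p)) b)) = tens V W (fst p) (snd p)"
      using coord[OF p] by simp
  qed
  also have "\<dots> = t" using tens_rep(2)[OF V t] by simp
  finally show ?thesis using fin TW \<phi> by (intro exI[of _ T] exI[of _ ?\<phi>]) auto
qed

text \<open>If all slices \<open>(id \<otimes> \<phi>) t\<close> lie in \<open>N\<close>, then \<open>t\<close> lies in \<open>N \<otimes> W\<close>.\<close>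

lemma sw_vanish:
  assumes V: "vecsp V" and W: "vecsp W" and U: "vecsp U" and t: "t \<in> carrier (tensor V W)"
    and g: "bil V W U g"
    and N: "\<And>u w. u \<in> N \<Longrightarrow> w \<in> carrier W \<Longrightarrow> g u w = 0"
    and slices: "\<And>\<phi>. lin_map W ground \<phi> \<Longrightarrow> sw V W t (\<lambda>v w. smul V (\<phi> w) v) \<in> N"
  shows "sw V W t g = 0"
proof -
  note [lin] = V W
  obtain T \<phi> where T: "finite T" "T \<subseteq> carrier W" and \<phi>: "\<forall>b\<in>T. lin_map W ground (\<phi> b)"
    and eq: "t = (\<Sum>b\<in>T. tens V W (sw V W t (\<lambda>v w. smul V (\<phi> b w) v)) b)"
    using tensor_coordinates[OF V W t] by (elim exE conjE)
  define u where "u b = sw V W t (\<lambda>v w. smul V (\<phi> b w) v)" for b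
  have u: "u b \<in> carrier V" for b unfolding u_def by (assumption | rule lin)+
  have L: "lin_map (tensor V W) U (\<lambda>t. sw V W t g)" by (rule lin_sw[OF g U V])
  have "sw V W (\<Sum>b\<in>T. tens V W (u b) b) g = (\<Sum>b\<in>T. sw V W (tens V W (u b) b) g)"
    by (rule lin_map_sum[OF L vecsp_tensor U]) (use u T(2) in \<open>auto intro: tens_in\<close>)
  also have "\<dots> = 0"
  proof (rule sum.neutral, rule ballI)
    fix b assume b: "b \<in> T"
    have "sw V W (tens V W (u b) b) g = g (u b) b"
      by (rule sw_tens) (use u b T(2) g U V in auto)
    also have "\<dots> = 0" using N[OF slices[OF bspec[OF \<phi> b]]] b T(2) by (auto simp: u_def)
    finally show "sw V W (tens V W (u b) b) g = 0" .
  qed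
  finally show ?thesis using eq by (simp add: u_def)
qed

context hopf_alg
begin

definition two_sided_integral where
  "two_sided_integral t \<longleftrightarrow> t \<in> carrier H \<and> \<epsilon> t = 1 \<and>
     (\<forall>h\<in>carrier H. h \<cdot> t = smul H (\<epsilon> h) t \<and> t \<cdot> h = smul H (\<epsilon> h) t)"

lemma mul_smul:
  assumes "x \<in> carrier H" "y \<in> carrier H"
  shows "smul H c x \<cdot> y = smul H c (x \<cdot> y)" "x \<cdot> smul H c y = smul H c (x \<cdot> y)"
  using lin_map_smul[OF bil_l[OF bil_mul assms(2) lin_id] assms(1)]
    lin_map_smul[OF bil_r[OF bil_mul assms(1) lin_id] assms(2)] by auto

lemma mul_add:
  assumes "x \<in> carrier H" "y \<in> carrier H" "z \<in> carrier H"
  shows "(x + y) \<cdot> z = x \<cdot> z + y \<cdot> z" "z \<cdot> (x + y) = z \<cdot> x + z \<cdot> y"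
  using lin_map_add[OF bil_l[OF bil_mul assms(3) lin_id] assms(1,2)]
    lin_map_add[OF bil_r[OF bil_mul assms(3) lin_id] assms(1,2)] by auto

lemma mul_diff:
  assumes "x \<in> carrier H" "y \<in> carrier H" "z \<in> carrier H"
  shows "(x - y) \<cdot> z = x \<cdot> z - y \<cdot> z" "z \<cdot> (x - y) = z \<cdot> x - z \<cdot> y"
  using lin_map_diff[OF bil_l[OF bil_mul assms(3) lin_id] vecsp_H vecsp_H assms(1,2)]
    lin_map_diff[OF bil_r[OF bil_mul assms(3) lin_id] vecsp_H vecsp_H assms(1,2)] by auto

lemmas counit_lin = lin_map_add[OF lin_counit0] lin_map_diff[OF lin_counit0 vecsp_H vecsp_ground]
  lin_map_smul[OF lin_counit0] lin_map_zero[OF lin_counit0 vecsp_H vecsp_ground]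

lemma module_H: "module (smul H)"
  by (rule vecsp_module[OF vecsp_H])

lemma subspaceI:
  assumes "0 \<in> S" "\<And>x y. x \<in> S \<Longrightarrow> y \<in> S \<Longrightarrow> x + y \<in> S" "\<And>c x. x \<in> S \<Longrightarrow> smul H c x \<in> S"
  shows "module.subspace (smul H) S"
  using assms by (simp add: module.subspace_def[OF module_H])

text \<open>A complement of the left ideal \<open>ker \<epsilon>\<close> contains \<open>t\<close> with \<open>1 - t \<in> ker \<epsilon>\<close>, and \<open>h t - \<epsilon>(h) t\<close> lies in both,
  so \<open>t\<close> is a left integral. For each \<open>h\<close> the element \<open>t h - \<epsilon>(h) t\<close> is a left integral of counit zero.
  These elements form a left ideal \<open>N\<close> with \<open>N N = 0\<close>, and a complemented left ideal of square zero
  is zero: if \<open>1 = n + j\<close> with \<open>j\<close> in the complement, then \<open>x = x n + x j = x j\<close> for \<open>x \<in> N\<close> lies in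
  the complement, too.\<close>

lemma two_sided_integral_exists:
  assumes ss: "semisimple_algebra H"
  shows "\<exists>t. two_sided_integral t"
proof -
  note smulH = smul_simps[OF vecsp_H]
  let ?left = "\<lambda>x. \<forall>h\<in>carrier H. h \<cdot> x = smul H (\<epsilon> h) x"
  define I where "I = {x \<in> carrier H. \<epsilon> x = 0}"
  define N where "N = {x \<in> carrier H. \<epsilon> x = 0 \<and> ?left x}"
  have zero: "h \<cdot> 0 = 0" if "h \<in> carrier H" for h
    using mul_smul(2)[OF that unt_in, of 0] by (simp add: smulH)
  have I: "left_ideal H I"
    unfolding left_ideal_def
    by (intro conjI subspaceI)
      (auto simp: I_def counit_lin counit_mul mul_in vecsp_zero[OF vecsp_H] vecsp_add[OF _ _ vecsp_H] vecsp_smul[OF _ vecsp_H])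
  have N: "left_ideal H N"
    unfolding left_ideal_def
    by (intro conjI subspaceI)
      (auto simp: N_def counit_lin counit_mul mul_in vecsp_zero[OF vecsp_H] vecsp_add[OF _ _ vecsp_H]
        vecsp_smul[OF _ vecsp_H] mul_add mul_smul zero smulH mult.commute)
  obtain J where J: "left_ideal H J" "I \<inter> J = {0}" "I + J = carrier H"
    using ss I unfolding semisimple_algebra_def by blast
  obtain N' where N': "left_ideal H N'" "N \<inter> N' = {0}" "N + N' = carrier H"
    using ss N unfolding semisimple_algebra_def by blast
  have N0: "x = 0" if x: "x \<in> N" for x
  proof -
    obtain n j where nj: "n \<in> N" "j \<in> N'" "\<one> = n + j"
      using N'(3) unt_in by (metis set_plus_elim)
    have in_H: "x \<in> carrier H" "n \<in> carrier H" "j \<in> carrier H"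
      using x nj N'(1) by (auto simp: N_def left_ideal_def)
    have "x = x \<cdot> (n + j)" using in_H by (simp add: nj(3)[symmetric] mul_unt)
    also have "\<dots> = smul H (\<epsilon> x) n + x \<cdot> j" using nj(1) in_H by (simp add: mul_add N_def)
    also have "\<dots> = x \<cdot> j" using x by (simp add: N_def smulH)
    finally have "x = x \<cdot> j" .
    moreover have "x \<cdot> j \<in> N'" using N'(1) nj(2) in_H by (auto simp: left_ideal_def)
    ultimately have "x \<in> N'" by simp
    with x N'(2) show ?thesis by auto
  qed
  obtain i t where it: "i \<in> I" "t \<in> J" "\<one> = i + t"
    using J(3) unt_in by (metis set_plus_elim)
  have t: "t \<in> carrier H" and i: "i \<in> carrier H" "\<epsilon> i = 0"
    using it J(1) by (auto simp: I_def left_ideal_def)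
  have et: "\<epsilon> t = 1" using counit_unt counit_lin(1)[OF i(1) t] i by (simp add: it(3)[symmetric])
  have left: "h \<cdot> t = smul H (\<epsilon> h) t" if h: "h \<in> carrier H" for h
  proof -
    have subJ: "module.subspace (smul H) J" and mJ: "h \<cdot> t \<in> J"
      using J(1) it(2) h by (auto simp: left_ideal_def)
    have "h \<cdot> t - smul H (\<epsilon> h) t \<in> J"
      by (intro module.subspace_diff[OF module_H subJ] module.subspace_scale[OF module_H subJ] mJ it(2))
    moreover have "h \<cdot> t - smul H (\<epsilon> h) t \<in> I"
      using h t et by (simp add: I_def vecsp_diff[OF _ _ vecsp_H] mul_in vecsp_smul[OF _ vecsp_H] counit_lin counit_mul)
    ultimately have "h \<cdot> t - smul H (\<epsilon> h) t \<in> {0}" using J(2) by blast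
    then show ?thesis by simp
  qed
  have right: "t \<cdot> h = smul H (\<epsilon> h) t" if h: "h \<in> carrier H" for h
  proof -
    have in_H: "t \<cdot> h - smul H (\<epsilon> h) t \<in> carrier H"
      using h t by (simp add: vecsp_diff[OF _ _ vecsp_H] mul_in vecsp_smul[OF _ vecsp_H])
    have "x \<cdot> (t \<cdot> h - smul H (\<epsilon> h) t) = smul H (\<epsilon> x) (t \<cdot> h - smul H (\<epsilon> h) t)"
      if x: "x \<in> carrier H" for x
      using x h t by (simp add: mul_diff mul_in vecsp_smul[OF _ vecsp_H] mul_assoc[symmetric] left mul_smul
          smulH mult.commute)
    then have "t \<cdot> h - smul H (\<epsilon> h) t \<in> N"
      using h t et in_H by (simp add: N_def mul_in vecsp_smul[OF _ vecsp_H] counit_lin counit_mul)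
    from N0[OF this] show ?thesis by simp
  qed
  show ?thesis unfolding two_sided_integral_def using t et left right by blast
qed

text \<open>An integral of the algebra \<open>H\<^sup>*\<close>.\<close>

definition two_sided_cointegral where
  "two_sided_cointegral l \<longleftrightarrow> l \<in> carrier (dual H) \<and> ev l \<one> = 1 \<and>
     (\<forall>x\<in>carrier H. \<Delta> x (\<lambda>a b. smul H (ev l b) a) = smul H (ev l x) \<one> \<and>
        \<Delta> x (\<lambda>a b. smul H (ev l a) b) = smul H (ev l x) \<one>)"

lemma subcoalgebra_vanish:
  assumes D: "subcoalgebra H D" and x: "x \<in> D" and g: "bil H H U g" and U: "vecsp U"
    and 0: "\<And>u v. u \<in> D \<Longrightarrow> v \<in> D \<Longrightarrow> g u v = 0"
  shows "\<Delta> x g = 0"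
proof -
  let ?S = "{tens H H u v | u v. u \<in> D \<and> v \<in> D}"
  have DH: "D \<subseteq> carrier H" using D by (simp add: subcoalgebra_def)
  show ?thesis
  proof (rule span_vanish[OF vecsp_tensor U lin_sw[OF g U vecsp_H]])
    show "?S \<subseteq> carrier (tensor H H)" using DH by (auto intro: tens_in)
    show "comul H x \<in> module.span (smul (tensor H H)) ?S" using D x by (simp add: subcoalgebra_def)
    fix s assume "s \<in> ?S"
    then obtain u v where uv: "u \<in> D" "v \<in> D" "s = tens H H u v" by blast
    then have "sw H H s g = g u v"
      unfolding uv(3) by (intro sw_tens) (use g DH U vecsp_H in auto)
    then show "sw H H s g = 0" using 0 uv by simp
  qed
qed

text \<open>The form is \<open>1\<close> at the unit and \<open>0\<close> on every simple subcoalgebra that does not contain the unit;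
  the only remaining one is spanned by the unit. Such a form exists if the unit is not in the
  span of the others. To see this, take finitely many of them and a form for each that vanishes
  on it and is \<open>1\<close> at the unit: the convolution product of these forms is again \<open>1\<close> at the unit
  and vanishes on all of them, because \<open>\<Delta>(D) \<subseteq> D \<otimes> D\<close>.\<close>

lemma two_sided_cointegral_exists:
  assumes cs: "cosemisimple_coalgebra H"
  shows "\<exists>l. two_sided_cointegral l"
proof -
  note smulH = smul_simps[OF vecsp_H]
  interpret V: vector_space "smul H" by (rule vecsp_vector_space[OF vecsp_H])
  define kills where "kills \<psi> D \<longleftrightarrow> (\<forall>y\<in>D. \<psi> y = 0)" for \<psi> :: "'h \<Rightarrow> 'k" and D
  define SS where "SS = {D. simple_subcoalgebra H D \<and> \<one> \<notin> D}"
  have sub: "subcoalgebra H D" "module.subspace (smul H) D" "D \<subseteq> carrier H"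
    if "simple_subcoalgebra H D" for D
    using that by (auto simp: simple_subcoalgebra_def subcoalgebra_def)
  have killer: "\<exists>\<psi>. lin_map H ground \<psi> \<and> \<psi> \<one> = 1 \<and> (\<forall>D\<in>set Ds. kills \<psi> D)" if "set Ds \<subseteq> SS" for Ds
    using that
  proof (induction Ds)
    case Nil
    show ?case using lin_counit0 counit_unt by auto
  next
    case (Cons D Ds)
    then obtain \<psi> where \<psi>: "lin_map H ground \<psi>" "\<psi> \<one> = 1" "\<forall>D\<in>set Ds. kills \<psi> D" by auto
    obtain \<phi> where \<phi>: "lin_map H ground \<phi>" "kills \<phi> D" "\<phi> \<one> = 1"
      using separating_functional[OF vecsp_H sub(2)] Cons.prems by (fastforce simp: SS_def kills_def)
    note [lin] = lin_comp[OF \<psi>(1)] lin_comp[OF \<phi>(1)]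
    let ?\<psi> = "\<lambda>x. \<Delta> x (\<lambda>a b. \<phi> a * \<psi> b)"
    have "lin_map H ground ?\<psi>" by (assumption | rule lin)+
    moreover have "?\<psi> \<one> = \<phi> \<one> * \<psi> \<one>"
      by (rule comul_one[where U = ground]) (assumption | rule lin)+
    moreover have "kills ?\<psi> E" if "E \<in> set (D # Ds)" for E
      unfolding kills_def
    proof
      fix x assume x: "x \<in> E"
      have E: "subcoalgebra H E" using Cons.prems that sub(1) by (auto simp: SS_def)
      show "?\<psi> x = 0"
        by (rule subcoalgebra_vanish[OF E x, where U = ground])
          (assumption | rule lin | (use that \<phi> \<psi> in \<open>auto simp: kills_def; fail\<close>))+
    qed
    ultimately show ?case using \<phi> \<psi> by auto
  qed
  have "\<exists>Ds. set Ds \<subseteq> SS \<and> (\<forall>\<psi>. lin_map H ground \<psi> \<longrightarrow> (\<forall>D\<in>set Ds. kills \<psi> D) \<longrightarrow> x \<in> carrier H \<and> \<psi> x = 0)"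
    if "x \<in> V.span (\<Union> SS)" for x
    using that
  proof (induction rule: V.span_induct_alt)
    case base
    show ?case using lin_map_zero[OF _ vecsp_H vecsp_ground] vecsp_zero[OF vecsp_H] by (intro exI[of _ "[]"]) auto
  next
    case (step c y z)
    then obtain D Ds where D: "D \<in> SS" "y \<in> D" and Ds: "set Ds \<subseteq> SS"
      "\<And>\<psi>. lin_map H ground \<psi> \<Longrightarrow> (\<forall>D\<in>set Ds. kills \<psi> D) \<Longrightarrow> z \<in> carrier H \<and> \<psi> z = 0" by blast
    have y: "y \<in> carrier H" using D sub(3) by (auto simp: SS_def)
    have "smul H c y + z \<in> carrier H \<and> \<psi> (smul H c y + z) = 0"
      if "lin_map H ground \<psi>" "\<forall>D\<in>set (D # Ds). kills \<psi> D" for \<psi>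
      using Ds(2)[OF that(1)] that D(2) y vecsp_smul[OF y vecsp_H, of c]
      by (auto simp: kills_def lin_map_add lin_map_smul vecsp_add[OF _ _ vecsp_H])
    with D(1) Ds(1) show ?case by (intro exI[of _ "D # Ds"]) auto
  qed
  then have "\<one> \<notin> V.span (\<Union> SS)" using killer by fastforce
  from separating_functional[OF vecsp_H V.subspace_span this] obtain \<phi> where
    \<phi>: "lin_map H ground \<phi>" "\<phi> \<one> = 1" "\<And>y. y \<in> V.span (\<Union> SS) \<Longrightarrow> \<phi> y = 0" by blast
  note [lin] = lin_comp[OF \<phi>(1)]
  let ?E = "range (\<lambda>c. smul H c \<one>)"
  have E: "subcoalgebra H ?E"
    unfolding subcoalgebra_def
  proof (intro conjI ballI)
    interpret F: vector_space fscale by (rule vector_space_fscale)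
    show "?E \<subseteq> carrier H" by (auto intro: vecsp_smul unt_in vecsp_H)
    show "V.subspace ?E"
    proof (rule subspaceI)
      show "0 \<in> ?E" by (rule image_eqI[of _ _ 0]) (simp_all add: smulH)
    next
      fix x y assume "x \<in> ?E" "y \<in> ?E"
      then show "x + y \<in> ?E" by (auto simp flip: smulH(2))
    next
      fix c x assume "x \<in> ?E"
      then show "smul H c x \<in> ?E" by (auto simp: smulH)
    qed
    fix x assume "x \<in> ?E"
    then obtain c where c: "x = smul H c \<one>" by auto
    have "comul H x = fscale c (tens H H \<one> \<one>)"
      using lin_map_smul[OF lin_comul0 unt_in, of c] by (simp add: c comul_unt)
    moreover have "\<one> \<in> ?E" by (rule image_eqI[of _ _ 1]) (simp_all add: smulH)
    then have "tens H H \<one> \<one> \<in> {tens H H u v | u v. u \<in> ?E \<and> v \<in> ?E}" by blast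
    ultimately show "comul H x \<in> F.span {tens H H u v | u v. u \<in> ?E \<and> v \<in> ?E}"
      by (simp only: F.span_scale F.span_base)
  qed
  have cases: "D \<in> SS \<or> D = ?E" if "simple_subcoalgebra H D" for D
  proof (cases "\<one> \<in> D")
    case True
    then have "?E \<subseteq> D" using module.subspace_scale[OF module_H sub(2)[OF that]] by auto
    moreover have "?E \<noteq> {0}"
    proof
      assume "?E = {0}"
      then have "smul H 1 \<one> = 0" using rangeI[of "\<lambda>c. smul H c \<one>" 1] by blast
      then show False using counit_unt counit_lin(4) by (simp add: smulH)
    qed
    ultimately show ?thesis using that E unfolding simple_subcoalgebra_def by blast
  qed (use that in \<open>auto simp: SS_def\<close>)
  let ?L = "\<lambda>x. \<Delta> x (\<lambda>a b. smul H (\<phi> b) a)" and ?R = "\<lambda>x. \<Delta> x (\<lambda>a b. smul H (\<phi> a) b)"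
  have linL: "lin_map H H ?L" and linR: "lin_map H H ?R" and lin1: "lin_map H H (\<lambda>x. smul H (\<phi> x) \<one>)"
    by (assumption | rule lin)+
  have one: "?L \<one> = smul H (\<phi> \<one>) \<one>" "?R \<one> = smul H (\<phi> \<one>) \<one>"
    by (rule comul_one[where U = H]; (assumption | rule lin)+)+
  have span: "x \<in> carrier H \<and> ?L x = smul H (\<phi> x) \<one> \<and> ?R x = smul H (\<phi> x) \<one>"
    if "x \<in> V.span (\<Union> {D. simple_subcoalgebra H D})" for x
    using that
  proof (induction rule: V.span_induct_alt)
    case base
    show ?case
      using lin_map_zero[OF linL vecsp_H vecsp_H] lin_map_zero[OF linR vecsp_H vecsp_H]
        lin_map_zero[OF lin1 vecsp_H vecsp_H] vecsp_zero[OF vecsp_H] by simp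
  next
    case (step c x y)
    then obtain D where D: "simple_subcoalgebra H D" "x \<in> D" by blast
    have x: "x \<in> carrier H" using sub(3)[OF D(1)] D(2) by auto
    have "?L x = smul H (\<phi> x) \<one> \<and> ?R x = smul H (\<phi> x) \<one>"
    proof (cases "D = ?E")
      case True
      then obtain c where "x = smul H c \<one>" using D(2) by auto
      then show ?thesis
        using one lin_map_smul[OF linL unt_in, of c] lin_map_smul[OF linR unt_in, of c]
          lin_map_smul[OF \<phi>(1) unt_in, of c] by (simp add: smulH)
    next
      case False
      then have "D \<in> SS" using cases[OF D(1)] by simp
      then have 0: "\<phi> y = 0" if "y \<in> D" for y using that by (intro \<phi>(3) V.span_base) auto
      have "?L x = 0" "?R x = 0"
        by (rule subcoalgebra_vanish[OF sub(1)[OF D(1)] D(2), where U = H];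
            (assumption | rule lin | simp add: 0 smulH)+)+
      then show ?thesis by (simp add: 0 D(2) smulH)
    qed
    then show ?case
      using step.IH x vecsp_smul[OF x vecsp_H, of c]
      by (simp add: vecsp_add[OF _ _ vecsp_H] lin_map_add[OF linL] lin_map_add[OF linR] lin_map_add[OF \<phi>(1)]
          lin_map_smul[OF linL] lin_map_smul[OF linR] lin_map_smul[OF \<phi>(1)] smulH)
  qed
  have "two_sided_cointegral (restr H \<phi>)"
    unfolding two_sided_cointegral_def
  proof (intro conjI ballI)
    show "restr H \<phi> \<in> carrier (dual H)" by (assumption | rule lin \<phi>)+
    show "ev (restr H \<phi>) \<one> = 1" by (simp add: ev_restr unt_in \<phi>)
    fix x assume x: "x \<in> carrier H"
    have "\<Delta> x (\<lambda>a b. smul H (ev (restr H \<phi>) b) a) = ?L x" "\<Delta> x (\<lambda>a b. smul H (ev (restr H \<phi>) a) b) = ?R x"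
      by (intro sw_cong[OF _ vecsp_H], simp add: ev_restr)+
    then show "\<Delta> x (\<lambda>a b. smul H (ev (restr H \<phi>) b) a) = smul H (ev (restr H \<phi>) x) \<one>"
      "\<Delta> x (\<lambda>a b. smul H (ev (restr H \<phi>) a) b) = smul H (ev (restr H \<phi>) x) \<one>"
      using span[of x] x cs by (simp_all add: ev_restr cosemisimple_coalgebra_def)
  qed
  then show ?thesis by blast
qed

end

section \<open>An integral of the Drinfeld double\<close>

locale hopf_cointegral = hopf_alg H for H :: "('k::field, 'h::ab_group_add) hopf" +
  fixes l
  assumes l: "two_sided_cointegral l"
begin

lemma l_in [lin]: "l \<in> carrier (dual H)" and l_one: "ev l \<one> = 1"
  using l by (auto simp: two_sided_cointegral_def)

lemma cointegral_r:
  assumes "lin_map H U (\<lambda>a. g a)" "x \<in> carrier H" "vecsp U"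
  shows "\<Delta> x (\<lambda>a b. smul U (ev l b) (g a)) = smul U (ev l x) (g \<one>)"
proof -
  have "\<Delta> x (\<lambda>a b. smul H (ev l b) a) = smul H (ev l x) \<one>"
    using l assms(2) by (simp add: two_sided_cointegral_def)
  from sw_smul[OF assms(1) this _ vecsp_H assms(3) vecsp_H] show ?thesis
    by (simp add: lin_map_smul[OF assms(1) unt_in])
qed

lemma cointegral_l:
  assumes "lin_map H U (\<lambda>a. g a)" "x \<in> carrier H" "vecsp U"
  shows "\<Delta> x (\<lambda>a b. smul U (ev l a) (g b)) = smul U (ev l x) (g \<one>)"
proof -
  have "\<Delta> x (\<lambda>a b. smul H (ev l a) b) = smul H (ev l x) \<one>"
    using l assms(2) by (simp add: two_sided_cointegral_def)
  from sw_smul[OF assms(1) this _ vecsp_H assms(3) vecsp_H] show ?thesis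
    by (simp add: lin_map_smul[OF assms(1) unt_in])
qed

text \<open>\<open>S(a\<^sub>1) l(a\<^sub>2 b) = b\<^sub>1 l(a b\<^sub>2)\<close>: write the left side as \<open>S(a\<^sub>1) a\<^sub>2 b\<^sub>1 l(a\<^sub>3 b\<^sub>2)\<close>, using that \<open>l\<close> is an
  integral, and cancel the antipode.\<close>

lemma cointegral_antipode_l:
  assumes a: "a \<in> carrier H" and b: "b \<in> carrier H"
  shows "\<Delta> a (\<lambda>x y. smul H (ev l (y \<cdot> b)) (\<S> x)) = \<Delta> b (\<lambda>x y. smul H (ev l (a \<cdot> y)) x)"
proof -
  note [lin] = a b
  have "\<Delta> a (\<lambda>x y. smul H (ev l (y \<cdot> b)) (\<S> x)) = \<Delta> a (\<lambda>x y. \<Delta> (y \<cdot> b) (\<lambda>p q. smul H (ev l q) (\<S> x \<cdot> p)))"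
  proof (rule sw_cong[OF _ vecsp_H])
    fix x y assume xy: "x \<in> carrier H" "y \<in> carrier H"
    have "\<Delta> (y \<cdot> b) (\<lambda>p q. smul H (ev l q) (\<S> x \<cdot> p)) = smul H (ev l (y \<cdot> b)) (\<S> x \<cdot> \<one>)"
      by (rule cointegral_r) (assumption | rule xy lin)+
    then show "smul H (ev l (y \<cdot> b)) (\<S> x) = \<Delta> (y \<cdot> b) (\<lambda>p q. smul H (ev l q) (\<S> x \<cdot> p))"
      using xy by (simp add: mul_unt antipode_in)
  qed
  also have "\<dots> = \<Delta> a (\<lambda>x y. \<Delta> y (\<lambda>y1 y2. \<Delta> b (\<lambda>b1 b2. smul H (ev l (y2 \<cdot> b2)) (\<S> x \<cdot> (y1 \<cdot> b1)))))"
    by (rule sw_cong, rule comul_mul) (assumption | rule lin)+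
  also have "\<dots> = \<Delta> a (\<lambda>y z. \<Delta> y (\<lambda>x y. \<Delta> b (\<lambda>b1 b2. smul H (ev l (z \<cdot> b2)) (\<S> x \<cdot> (y \<cdot> b1)))))"
    by (rule sym, rule coassoc[where U = H]) (assumption | rule lin)+
  also have "\<dots> = \<Delta> a (\<lambda>y z. \<Delta> y (\<lambda>x y. \<Delta> b (\<lambda>b1 b2. smul H (ev l (z \<cdot> b2)) (\<S> x \<cdot> y \<cdot> b1))))"
    by (intro sw_cong[OF _ vecsp_H]) (simp add: mul_assoc antipode_in)
  also have "\<dots> = \<Delta> a (\<lambda>y z. smul H (\<epsilon> y) (\<Delta> b (\<lambda>b1 b2. smul H (ev l (z \<cdot> b2)) (\<one> \<cdot> b1))))"
    by (rule sw_cong, rule antipode_l) (assumption | rule lin)+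
  also have "\<dots> = \<Delta> b (\<lambda>b1 b2. smul H (ev l (a \<cdot> b2)) (\<one> \<cdot> b1))"
    by (rule counit_l) (assumption | rule lin)+
  also have "\<dots> = \<Delta> b (\<lambda>b1 b2. smul H (ev l (a \<cdot> b2)) b1)"
    by (intro sw_cong[OF _ vecsp_H]) (simp add: mul_unt)
  finally show ?thesis .
qed

text \<open>\<open>l(a\<^sub>1 b) a\<^sub>2 = l(a b\<^sub>1) S(b\<^sub>2)\<close>: insert \<open>b\<^sub>2 S(b\<^sub>3)\<close> on the right of \<open>a\<^sub>2\<close> and use that \<open>l\<close> is an integral.\<close>

lemma cointegral_antipode_r:
  assumes a: "a \<in> carrier H" and b: "b \<in> carrier H"
  shows "\<Delta> a (\<lambda>x y. smul H (ev l (x \<cdot> b)) y) = \<Delta> b (\<lambda>x y. smul H (ev l (a \<cdot> x)) (\<S> y))"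
proof -
  note [lin] = a b
  have "\<Delta> a (\<lambda>x y. smul H (ev l (x \<cdot> b)) y) =
    \<Delta> b (\<lambda>b1 b2. smul H (\<epsilon> b2) (\<Delta> a (\<lambda>x y. smul H (ev l (x \<cdot> b1)) (y \<cdot> \<one>))))"
  proof -
    have "\<Delta> b (\<lambda>b1 b2. smul H (\<epsilon> b2) (\<Delta> a (\<lambda>x y. smul H (ev l (x \<cdot> b1)) (y \<cdot> \<one>)))) =
      \<Delta> a (\<lambda>x y. smul H (ev l (x \<cdot> b)) (y \<cdot> \<one>))"
      by (rule counit_r) (assumption | rule lin)+
    also have "\<dots> = \<Delta> a (\<lambda>x y. smul H (ev l (x \<cdot> b)) y)"
      by (intro sw_cong[OF _ vecsp_H]) (simp add: mul_unt)
    finally show ?thesis by simp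
  qed
  also have "\<dots> = \<Delta> b (\<lambda>b1 b2. \<Delta> b2 (\<lambda>p q. \<Delta> a (\<lambda>x y. smul H (ev l (x \<cdot> b1)) (y \<cdot> (p \<cdot> \<S> q)))))"
    by (rule sw_cong, rule sym, rule antipode_r) (assumption | rule lin)+
  also have "\<dots> = \<Delta> b (\<lambda>b1 q. \<Delta> b1 (\<lambda>b1 p. \<Delta> a (\<lambda>x y. smul H (ev l (x \<cdot> b1)) (y \<cdot> (p \<cdot> \<S> q)))))"
    by (rule sym, rule coassoc[where U = H]) (assumption | rule lin)+
  also have "\<dots> = \<Delta> b (\<lambda>b1 q. \<Delta> a (\<lambda>x y. \<Delta> b1 (\<lambda>b1 p. smul H (ev l (x \<cdot> b1)) (y \<cdot> p \<cdot> \<S> q))))"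
    by (subst (2) sw_swap, intro sw_cong[OF _ vecsp_H]) (simp add: mul_assoc antipode_in)
  also have "\<dots> = \<Delta> b (\<lambda>b1 q. \<Delta> (a \<cdot> b1) (\<lambda>x y. smul H (ev l x) (y \<cdot> \<S> q)))"
    by (rule sw_cong, rule sym, rule comul_mul) (assumption | rule lin)+
  also have "\<dots> = \<Delta> b (\<lambda>b1 q. smul H (ev l (a \<cdot> b1)) (\<one> \<cdot> \<S> q))"
    by (rule sw_cong, rule cointegral_l) (assumption | rule lin)+
  also have "\<dots> = \<Delta> b (\<lambda>b1 q. smul H (ev l (a \<cdot> b1)) (\<S> q))"
    by (intro sw_cong[OF _ vecsp_H]) (simp add: mul_unt antipode_in)
  finally show ?thesis .
qed

text \<open>The radical of the bilinear form \<open>(u, y) \<mapsto> l(u y)\<close>; it is zero by \<open>cointegral_nondegenerate\<close>.\<close>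

definition radical where
  "radical = {u \<in> carrier H. \<forall>y\<in>carrier H. ev l (u \<cdot> y) = 0}"

text \<open>The radical \<open>N\<close> satisfies \<open>\<Delta>(N) \<subseteq> N \<otimes> H\<close>: by \<open>cointegral_antipode_r\<close>, \<open>l(u\<^sub>1 y) u\<^sub>2 = l(u y\<^sub>1) S(y\<^sub>2) = 0\<close>
  for \<open>u \<in> N\<close>, so every slice of \<open>\<Delta>(u)\<close> lies in \<open>N\<close>.\<close>

lemma radical_vanish:
  assumes u: "u \<in> radical" and g: "bil H H U g" and U: "vecsp U"
    and 0: "\<And>v w. v \<in> radical \<Longrightarrow> w \<in> carrier H \<Longrightarrow> g v w = 0"
  shows "\<Delta> u g = 0"
proof (rule sw_vanish[where N = radical, OF vecsp_H vecsp_H U _ g 0])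
  have uH: "u \<in> carrier H" using u by (simp add: radical_def)
  then show "comul H u \<in> carrier (tensor H H)" by (rule lin)
  fix \<phi> assume \<phi>: "lin_map H ground \<phi>"
  note [lin] = uH lin_comp[OF \<phi>]
  let ?s = "\<Delta> u (\<lambda>v w. smul H (\<phi> w) v)"
  have "ev l (?s \<cdot> y) = 0" if y: "y \<in> carrier H" for y
  proof -
    have "ev l (?s \<cdot> y) = \<Delta> u (\<lambda>v w. ev l (smul H (\<phi> w) v \<cdot> y))"
      by (rule lin_map_sw[where f = "\<lambda>v. ev l (v \<cdot> y)" and U = H and U' = ground]) (assumption | rule y lin)+
    also have "\<dots> = \<Delta> u (\<lambda>v w. \<phi> (smul H (ev l (v \<cdot> y)) w))"
      by (intro sw_cong[OF _ vecsp_H])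
        (simp add: mul_smul y lin_map_smul[OF \<phi>] lin_map_smul[OF bil_r[OF bil_ev l_in lin_id]] mul_in)
    also have "\<dots> = \<phi> (\<Delta> u (\<lambda>v w. smul H (ev l (v \<cdot> y)) w))"
      by (rule sym, rule lin_map_sw[OF \<phi>]) (assumption | rule y lin)+
    also have "\<Delta> u (\<lambda>v w. smul H (ev l (v \<cdot> y)) w) = \<Delta> y (\<lambda>a b. smul H (ev l (u \<cdot> a)) (\<S> b))"
      by (rule cointegral_antipode_r) fact+
    also have "\<dots> = \<Delta> y (\<lambda>a b. 0)"
      using u by (intro sw_cong[OF _ vecsp_H]) (simp add: radical_def smul_simps[OF vecsp_H])
    also have "\<dots> = 0" by (simp add: sw_def)
    finally show ?thesis by (simp add: lin_map_zero[OF \<phi> vecsp_H vecsp_ground])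
  qed
  moreover have "?s \<in> carrier H" by (assumption | rule lin)+
  ultimately show "?s \<in> radical" by (simp add: radical_def)
qed

text \<open>For \<open>u\<close> in the radical, \<open>\<epsilon>(u) = l(u\<^sub>1 S(u\<^sub>2)) = 0\<close> since \<open>u\<^sub>1\<close> lies in the radical as well; but then also
  \<open>u = \<epsilon>(u\<^sub>1) u\<^sub>2 = 0\<close>.\<close>

lemma cointegral_nondegenerate:
  assumes x: "x \<in> carrier H" and 0: "\<And>y. y \<in> carrier H \<Longrightarrow> ev l (x \<cdot> y) = 0"
  shows "x = 0"
proof -
  have eps: "\<epsilon> u = 0" if u: "u \<in> radical" for u
  proof -
    have uH: "u \<in> carrier H" using u by (simp add: radical_def)
    have "\<Delta> u (\<lambda>v w. ev l (v \<cdot> \<S> w)) = 0"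
      by (rule radical_vanish[OF u, where U = ground])
        (assumption | rule lin | simp add: radical_def antipode_in)+
    moreover have "\<Delta> u (\<lambda>v w. ev l (v \<cdot> \<S> w)) = smul ground (\<epsilon> u) (ev l \<one>)"
      by (rule antipode_r) (assumption | rule uH lin)+
    ultimately show ?thesis by (simp add: l_one)
  qed
  have "x \<in> radical" using assms by (simp add: radical_def)
  then have "\<Delta> x (\<lambda>v w. smul H (\<epsilon> v) w) = 0"
    by (rule radical_vanish[where U = H])
      (assumption | rule lin | simp add: eps smul_simps[OF vecsp_H])+
  moreover have "\<Delta> x (\<lambda>v w. smul H (\<epsilon> v) w) = x"
    by (rule counit_l) (assumption | rule x lin)+
  ultimately show ?thesis by simp
qed

text \<open>The identity \<open>g(S(t\<^sub>1) t\<^sub>3) t\<^sub>2 = g(1) t\<close> says that \<open>t\<close> commutes with \<open>g\<close> in \<open>D(H)\<close> up to what a left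
  factor \<open>l\<close> absorbs. As \<open>l\<close> is nondegenerate, it suffices to multiply by \<open>b\<close> and apply \<open>l\<close>:
  \<open>S(t\<^sub>1) l(t\<^sub>2 b) t\<^sub>3 = b\<^sub>1 l(t\<^sub>1 b\<^sub>2) t\<^sub>2 = l(t) b\<^sub>1 S(b\<^sub>2) = l(t) \<epsilon>(b) = l(t b)\<close>.\<close>

lemma integral_conjugation:
  assumes t: "two_sided_integral t" and g: "g \<in> carrier (dual H)"
  shows "\<Delta> t (\<lambda>x k. \<Delta> k (\<lambda>y z. smul H (ev g (\<S> x \<cdot> z)) y)) = smul H (ev g \<one>) t"
    (is "?X = ?Y")
proof -
  have t_mul: "t \<cdot> h = smul H (\<epsilon> h) t" if "h \<in> carrier H" for h
    using t that by (auto simp: two_sided_integral_def)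
  have tH: "t \<in> carrier H" using t by (simp add: two_sided_integral_def)
  note [lin] = tH g
  note ev_smul = lin_map_smul[OF bil_r[OF bil_ev _ lin_id], simplified]
  have XY: "?X \<in> carrier H" "?Y \<in> carrier H" by (assumption | rule lin)+
  have "ev l ((?X - ?Y) \<cdot> b) = 0" if b: "b \<in> carrier H" for b
  proof -
    \<comment> \<open>\<open>l(t\<^sub>1 c) t\<^sub>2 = l(t) S(c)\<close>, because \<open>t\<close> absorbs the other factor of \<open>\<Delta>(c)\<close>.\<close>
    have split: "\<Delta> t (\<lambda>x y. smul H (ev l (x \<cdot> c)) y) = smul H (ev l t) (\<S> c)" if c: "c \<in> carrier H" for c
    proof -
      have "\<Delta> t (\<lambda>x y. smul H (ev l (x \<cdot> c)) y) = \<Delta> c (\<lambda>x y. smul H (ev l (t \<cdot> x)) (\<S> y))"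
        by (rule cointegral_antipode_r) fact+
      also have "\<dots> = \<Delta> c (\<lambda>x y. smul H (\<epsilon> x) (smul H (ev l t) (\<S> y)))"
        by (intro sw_cong[OF _ vecsp_H]) (simp add: t_mul ev_smul l_in tH smul_simps[OF vecsp_H])
      also have "\<dots> = smul H (ev l t) (\<S> c)"
        by (rule counit_l) (assumption | rule c lin)+
      finally show ?thesis .
    qed
    have "ev l (?X \<cdot> b) = \<Delta> t (\<lambda>x k. \<Delta> k (\<lambda>y z. ev g (\<S> x \<cdot> z) * ev l (y \<cdot> b)))"
    proof -
      have L: "lin_map H ground (\<lambda>v. ev l (v \<cdot> b))" by (assumption | rule b lin)+
      have "ev l (?X \<cdot> b) = \<Delta> t (\<lambda>x k. ev l (\<Delta> k (\<lambda>y z. smul H (ev g (\<S> x \<cdot> z)) y) \<cdot> b))"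
        by (rule lin_map_sw[OF L]) (assumption | rule b lin)+
      also have "\<dots> = \<Delta> t (\<lambda>x k. \<Delta> k (\<lambda>y z. ev l (smul H (ev g (\<S> x \<cdot> z)) y \<cdot> b)))"
        by (rule sw_cong, rule lin_map_sw[OF L]) (assumption | rule b lin)+
      also have "\<dots> = \<Delta> t (\<lambda>x k. \<Delta> k (\<lambda>y z. ev g (\<S> x \<cdot> z) * ev l (y \<cdot> b)))"
        by (intro sw_cong[OF _ vecsp_H]) (simp add: mul_smul b ev_smul l_in mul_in)
      finally show ?thesis .
    qed
    also have "\<dots> = \<Delta> t (\<lambda>k z. \<Delta> k (\<lambda>x y. ev g (\<S> x \<cdot> z) * ev l (y \<cdot> b)))"
      by (rule sym, rule coassoc[where U = ground]) (assumption | rule b lin)+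
    also have "\<dots> = \<Delta> t (\<lambda>k z. ev g (\<Delta> k (\<lambda>x y. smul H (ev l (y \<cdot> b)) (\<S> x)) \<cdot> z))"
    proof (rule sw_cong[OF _ vecsp_H])
      fix k z assume kz: "k \<in> carrier H" "z \<in> carrier H"
      have "ev g (\<Delta> k (\<lambda>x y. smul H (ev l (y \<cdot> b)) (\<S> x)) \<cdot> z) =
          \<Delta> k (\<lambda>x y. ev g (smul H (ev l (y \<cdot> b)) (\<S> x) \<cdot> z))"
        by (rule lin_map_sw[where f = "\<lambda>v. ev g (v \<cdot> z)" and U = H and U' = ground])
          (assumption | rule b kz lin)+
      also have "\<dots> = \<Delta> k (\<lambda>x y. ev g (\<S> x \<cdot> z) * ev l (y \<cdot> b))"
        by (intro sw_cong[OF _ vecsp_H]) (simp add: mul_smul kz ev_smul g mul_in antipode_in mult.commute)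
      finally show "\<Delta> k (\<lambda>x y. ev g (\<S> x \<cdot> z) * ev l (y \<cdot> b)) =
          ev g (\<Delta> k (\<lambda>x y. smul H (ev l (y \<cdot> b)) (\<S> x)) \<cdot> z)" by simp
    qed
    also have "\<dots> = \<Delta> t (\<lambda>k z. ev g (\<Delta> b (\<lambda>x y. smul H (ev l (k \<cdot> y)) x) \<cdot> z))"
      by (intro sw_cong[OF _ vecsp_H]) (simp add: cointegral_antipode_l b)
    also have "\<dots> = \<Delta> t (\<lambda>k z. \<Delta> b (\<lambda>x y. ev g (x \<cdot> smul H (ev l (k \<cdot> y)) z)))"
    proof (rule sw_cong[OF _ vecsp_H])
      fix k z assume kz: "k \<in> carrier H" "z \<in> carrier H"
      have "ev g (\<Delta> b (\<lambda>x y. smul H (ev l (k \<cdot> y)) x) \<cdot> z) = \<Delta> b (\<lambda>x y. ev g (smul H (ev l (k \<cdot> y)) x \<cdot> z))"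
        by (rule lin_map_sw[where f = "\<lambda>v. ev g (v \<cdot> z)" and U = H and U' = ground])
          (assumption | rule b kz lin)+
      then show "ev g (\<Delta> b (\<lambda>x y. smul H (ev l (k \<cdot> y)) x) \<cdot> z) = \<Delta> b (\<lambda>x y. ev g (x \<cdot> smul H (ev l (k \<cdot> y)) z))"
        using kz by (simp add: mul_smul cong: sw_cong[OF _ vecsp_H])
    qed
    also have "\<dots> = \<Delta> b (\<lambda>x y. \<Delta> t (\<lambda>k z. ev g (x \<cdot> smul H (ev l (k \<cdot> y)) z)))"
      by (rule sw_swap)
    also have "\<dots> = \<Delta> b (\<lambda>x y. ev g (x \<cdot> \<Delta> t (\<lambda>k z. smul H (ev l (k \<cdot> y)) z)))"
      by (rule sw_cong, rule sym, rule lin_map_sw[where f = "\<lambda>v. ev g (_ \<cdot> v)" and U = H and U' = ground])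
        (assumption | rule b lin)+
    also have "\<dots> = \<Delta> b (\<lambda>x y. ev l t * ev g (x \<cdot> \<S> y))"
      by (intro sw_cong[OF _ vecsp_H]) (simp add: split mul_smul antipode_in ev_smul g mul_in)
    also have "\<dots> = smul ground (\<epsilon> b) (ev l t * ev g \<one>)"
      by (rule antipode_r) (assumption | rule b lin)+
    also have "\<dots> = ev l (?Y \<cdot> b)"
      by (simp add: mul_smul b tH t_mul ev_smul l_in vecsp_smul[OF _ vecsp_H])
    finally have "ev l (?X \<cdot> b) = ev l (?Y \<cdot> b)" .
    then show ?thesis
      using XY b lin_map_diff[OF bil_r[OF bil_ev l_in lin_id] vecsp_H vecsp_ground, of "?X \<cdot> b" "?Y \<cdot> b"]
      by (simp only: mul_diff mul_in diff_self)
  qed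
  then have "?X - ?Y = 0" by (intro cointegral_nondegenerate vecsp_diff XY vecsp_H)
  then show ?thesis by simp
qed

text \<open>In the product \<open>(l \<otimes> t) (g \<otimes> h)\<close> the integral property of \<open>l\<close> turns the factor in \<open>H\<^sup>*\<close> into
  \<open>g(S(t\<^sub>1) t\<^sub>3) l\<close>, so \<open>integral_conjugation\<close> applies, and \<open>t\<close> absorbs \<open>h\<close>.\<close>

lemma double_integral:
  assumes t: "two_sided_integral t"
  defines "\<Lambda> \<equiv> tens (dual H) H l t"
  shows "\<Lambda> \<in> carrier DD" "dcounit \<Lambda> = 1"
    "d \<in> carrier DD \<Longrightarrow> dmul \<Lambda> d = smul DD (dcounit d) \<Lambda>"
proof -
  have t_mul: "t \<cdot> h = smul H (\<epsilon> h) t" if "h \<in> carrier H" for h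
    using t that by (auto simp: two_sided_integral_def)
  have tH: "t \<in> carrier H" and et: "\<epsilon> t = 1" using t by (auto simp: two_sided_integral_def)
  note [lin] = tH
  show \<Lambda>: "\<Lambda> \<in> carrier DD" unfolding \<Lambda>_def by (assumption | rule lin)+
  show "dcounit \<Lambda> = 1" by (simp add: \<Lambda>_def dcounit_tens l_in tH l_one et)
  assume d: "d \<in> carrier DD"
  show "dmul \<Lambda> d = smul DD (dcounit d) \<Lambda>"
  proof (rule tensor_ext[where U = DD, OF _ _ _ d], ((assumption | rule \<Lambda> lin)+)[2])
    fix g h assume g: "g \<in> carrier (dual H)" and h: "h \<in> carrier H"
    note [lin] = g h
    let ?tl = "tens (dual H) H l"
    have twist: "twist l g x z = smul (dual H) (ev g (\<S> x \<cdot> z)) l" if xz: "x \<in> carrier H" "z \<in> carrier H" for x z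
    proof (rule dual_eqI[of _ H])
      show "twist l g x z \<in> carrier (dual H)" "smul (dual H) (ev g (\<S> x \<cdot> z)) l \<in> carrier (dual H)"
        by (assumption | rule xz lin)+
      fix y assume y: "y \<in> carrier H"
      have "ev (twist l g x z) y = \<Delta> y (\<lambda>a b. smul ground (ev l b) (ev g (\<S> x \<cdot> a \<cdot> z)))"
        unfolding twist_def by (simp add: ev_restr y mult.commute)
      also have "\<dots> = smul ground (ev l y) (ev g (\<S> x \<cdot> \<one> \<cdot> z))"
        by (rule cointegral_r) (assumption | rule xz y lin)+
      finally show "twist l g x z y = smul (dual H) (ev g (\<S> x \<cdot> z)) l y"
        using xz by (simp add: mul_unt antipode_in ev_def fscale_def)
    qed
    have "dmul \<Lambda> (tens (dual H) H g h) = \<Delta> t (\<lambda>x k. \<Delta> k (\<lambda>y z. tens (dual H) H (twist l g x z) (y \<cdot> h)))" (is "?l = _")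
      unfolding \<Lambda>_def by (rule dmul_tens) (rule lin)+
    also have "\<dots> = \<Delta> t (\<lambda>x k. \<Delta> k (\<lambda>y z. ?tl (smul H (ev g (\<S> x \<cdot> z)) y \<cdot> h)))"
    proof (intro sw_cong[OF _ vecsp_H])
      fix x k y z assume *: "x \<in> carrier H" "y \<in> carrier H" "z \<in> carrier H"
      have yh: "y \<cdot> h \<in> carrier H" by (rule mul_in) fact+
      show "tens (dual H) H (twist l g x z) (y \<cdot> h) = ?tl (smul H (ev g (\<S> x \<cdot> z)) y \<cdot> h)"
        unfolding twist[OF *(1,3)] mul_smul(1)[OF *(2) h]
          lin_map_smul[OF bil_l[OF bil_tens yh lin_id] l_in] lin_map_smul[OF bil_r[OF bil_tens l_in lin_id] yh] ..
    qed
    also have "\<dots> = ?tl (\<Delta> t (\<lambda>x k. \<Delta> k (\<lambda>y z. smul H (ev g (\<S> x \<cdot> z)) y)) \<cdot> h)"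
    proof -
      have L: "lin_map H DD (\<lambda>v. ?tl (v \<cdot> h))" by (assumption | rule lin)+
      have "?tl (\<Delta> t (\<lambda>x k. \<Delta> k (\<lambda>y z. smul H (ev g (\<S> x \<cdot> z)) y)) \<cdot> h) =
        \<Delta> t (\<lambda>x k. ?tl (\<Delta> k (\<lambda>y z. smul H (ev g (\<S> x \<cdot> z)) y) \<cdot> h))"
        by (rule lin_map_sw[OF L]) (assumption | rule lin)+
      also have "\<dots> = \<Delta> t (\<lambda>x k. \<Delta> k (\<lambda>y z. ?tl (smul H (ev g (\<S> x \<cdot> z)) y \<cdot> h)))"
        by (rule sw_cong, rule lin_map_sw[OF L]) (assumption | rule lin)+
      finally show ?thesis by simp
    qed
    also have "\<dots> = ?tl (smul H (ev g \<one>) t \<cdot> h)"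
      by (simp only: integral_conjugation[OF t g])
    also have "\<dots> = ?tl (smul H (ev g \<one> * \<epsilon> h) t)"
      by (simp add: mul_smul tH h t_mul smul_simps[OF vecsp_H])
    also have "\<dots> = smul DD (ev g \<one> * \<epsilon> h) \<Lambda>"
      unfolding \<Lambda>_def by (rule lin_map_smul[OF bil_r[OF bil_tens l_in lin_id] tH])
    finally show "?l = smul DD (dcounit (tens (dual H) H g h)) \<Lambda>"
      by (simp add: dcounit_tens g h)
  qed (rule lin)
qed

end

section \<open>Quotients of spaces of functions\<close>

lemma mem_coset: "x \<in> z +o N \<longleftrightarrow> x - z \<in> (N :: 'x::ab_group_add set)"
  by (auto simp: elt_set_plus_def) (metis add.commute diff_add_cancel)

definition fun_subspace :: "('v \<Rightarrow> 'k::field) set \<Rightarrow> bool" where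
  "fun_subspace N \<longleftrightarrow> 0 \<in> N \<and> (\<forall>x\<in>N. \<forall>y\<in>N. x + y \<in> N) \<and> (\<forall>c. \<forall>x\<in>N. fscale c x \<in> N)"

lemma fun_subspaceD:
  assumes "fun_subspace N"
  shows "0 \<in> N" "x \<in> N \<Longrightarrow> y \<in> N \<Longrightarrow> x + y \<in> N" "x \<in> N \<Longrightarrow> fscale c x \<in> N"
    "x \<in> N \<Longrightarrow> - x \<in> N" "x \<in> N \<Longrightarrow> y \<in> N \<Longrightarrow> x - y \<in> N"
proof -
  have *: "- x = fscale (-1) x" for x :: "'a \<Rightarrow> 'b" by (simp add: fscale_def fun_eq_iff)
  have m: "- x \<in> N" if "x \<in> N" for x using assms that unfolding * fun_subspace_def by blast
  show "0 \<in> N" "x \<in> N \<Longrightarrow> y \<in> N \<Longrightarrow> x + y \<in> N" "x \<in> N \<Longrightarrow> fscale c x \<in> N"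
    using assms by (auto simp: fun_subspace_def)
  show "x \<in> N \<Longrightarrow> - x \<in> N" by (rule m)
  show "x \<in> N \<Longrightarrow> y \<in> N \<Longrightarrow> x - y \<in> N"
    using assms m[of y] unfolding diff_conv_add_uminus fun_subspace_def by blast
qed

lemma coset_eq_iff:
  assumes "fun_subspace N"
  shows "z +o N = w +o N \<longleftrightarrow> z - w \<in> N"
proof
  assume "z +o N = w +o N"
  moreover have "z \<in> z +o N" using fun_subspaceD(1)[OF assms] by (simp add: mem_coset)
  ultimately show "z - w \<in> N" by (simp add: mem_coset)
next
  assume zw: "z - w \<in> N"
  have "x - z \<in> N \<longleftrightarrow> x - w \<in> N" for x
    using fun_subspaceD(2)[OF assms, of "x - z" "z - w"] fun_subspaceD(5)[OF assms, of "x - w" "z - w"] zw by auto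
  then show "z +o N = w +o N" by (auto simp: mem_coset)
qed

lemma coset_add:
  assumes "fun_subspace N" "M \<subseteq> N" "0 \<in> M"
  shows "(z +o M) + N = z +o N"
proof (rule set_eqI)
  fix x
  have "x \<in> (z +o M) + N \<longleftrightarrow> (\<exists>m\<in>M. \<exists>n\<in>N. x = z + m + n)"
    by (auto simp: set_plus_def elt_set_plus_def)
  also have "\<dots> \<longleftrightarrow> x - z \<in> N"
  proof
    assume "\<exists>m\<in>M. \<exists>n\<in>N. x = z + m + n"
    then show "x - z \<in> N" using fun_subspaceD(2)[OF assms(1)] assms(2) by (auto simp: algebra_simps)
  next
    assume "x - z \<in> N"
    then show "\<exists>m\<in>M. \<exists>n\<in>N. x = z + m + n" using assms(3) by (intro bexI[of _ 0] bexI[of _ "x - z"]) auto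
  qed
  finally show "x \<in> (z +o M) + N \<longleftrightarrow> x \<in> z +o N" by (simp add: mem_coset)
qed

lemma coset_plus:
  assumes "fun_subspace N"
  shows "(z +o N) + (w +o N) = (z + w) +o N"
proof (rule set_eqI)
  fix x
  have "x \<in> (z +o N) + (w +o N) \<longleftrightarrow> (\<exists>m\<in>N. \<exists>n\<in>N. x = (z + m) + (w + n))"
    by (auto simp: set_plus_def elt_set_plus_def)
  also have "\<dots> \<longleftrightarrow> x - (z + w) \<in> N"
  proof
    assume "\<exists>m\<in>N. \<exists>n\<in>N. x = (z + m) + (w + n)"
    then show "x - (z + w) \<in> N" using fun_subspaceD(2)[OF assms] by (auto simp: algebra_simps)
  next
    assume "x - (z + w) \<in> N"
    then show "\<exists>m\<in>N. \<exists>n\<in>N. x = (z + m) + (w + n)"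
      using fun_subspaceD(1)[OF assms] by (intro bexI[of _ 0] bexI[of _ "x - (z + w)"]) (auto simp: algebra_simps)
  qed
  finally show "x \<in> (z +o N) + (w +o N) \<longleftrightarrow> x \<in> (z + w) +o N" by (simp add: mem_coset)
qed

lemma quot_map_coset:
  assumes N: "fun_subspace N" and add: "\<And>n. n \<in> N \<Longrightarrow> T (z + n) = T z + T n" and TN: "T ` N \<subseteq> N" "T 0 = 0"
  shows "quot_map N T (z +o N) = T z +o N"
proof -
  have "T ` (z +o N) = T z +o T ` N"
    using add by (force simp: elt_set_plus_def)
  then show ?thesis
    unfolding quot_map_def using coset_add[OF N TN(1)] fun_subspaceD(1)[OF N] TN(2) by (metis imageI)
qed

lemma quot_map_scale:
  assumes N: "fun_subspace N"
  shows "quot_map N (fscale c) (z +o N) = fscale c z +o N"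
  by (rule quot_map_coset[OF N])
    (use fun_subspaceD(3)[OF N] in \<open>auto simp: fscale_def fun_eq_iff algebra_simps\<close>)

lemma quot_subspaceI:
  assumes N: "fun_subspace N" and Z: "fun_subspace Z"
  shows "quot_subspace N ((\<lambda>z. z +o N) ` Z)"
  unfolding quot_subspace_def
proof (intro conjI ballI allI)
  show "N \<in> (\<lambda>z. z +o N) ` Z"
    using fun_subspaceD(1)[OF Z] by (intro image_eqI[of _ _ 0]) (auto simp: mem_coset)
next
  fix X Y assume "X \<in> (\<lambda>z. z +o N) ` Z" "Y \<in> (\<lambda>z. z +o N) ` Z"
  then show "X + Y \<in> (\<lambda>z. z +o N) ` Z"
    using fun_subspaceD(2)[OF Z] by (auto simp: coset_plus[OF N])
next
  fix c X assume "X \<in> (\<lambda>z. z +o N) ` Z"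
  then show "quot_map N (fscale c) X \<in> (\<lambda>z. z +o N) ` Z"
    using fun_subspaceD(3)[OF Z] by (auto simp: quot_map_scale[OF N])
qed

text \<open>The isomorphism sends \<open>z + M\<close> to \<open>z + N\<close>; its injectivity is the condition \<open>Z \<inter> N \<subseteq> M\<close>.\<close>

lemma quot_isoI:
  assumes N: "fun_subspace N" and M: "fun_subspace M" and Z: "fun_subspace Z" and MN: "M \<subseteq> N" and ZN: "Z \<inter> N \<subseteq> M"
  shows "quot_iso M (quot Z M) N ((\<lambda>z. z +o N) ` Z)"
  unfolding quot_iso_def
proof (intro exI[of _ "\<lambda>X. X + N"] conjI ballI allI)
  note add = coset_add[OF N MN fun_subspaceD(1)[OF M]]
  show "bij_betw (\<lambda>X. X + N) (quot Z M) ((\<lambda>z. z +o N) ` Z)"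
    unfolding bij_betw_def
  proof
    show "inj_on (\<lambda>X. X + N) (quot Z M)"
      using fun_subspaceD(5)[OF Z] ZN
      by (auto simp: inj_on_def quot_def add coset_eq_iff[OF N] coset_eq_iff[OF M])
    show "(\<lambda>X. X + N) ` quot Z M = (\<lambda>z. z +o N) ` Z"
      unfolding quot_def image_image add ..
  qed
next
  fix X Y assume "X \<in> quot Z M" "Y \<in> quot Z M"
  then show "X + Y + N = X + N + (Y + N)"
    by (auto simp: quot_def coset_plus[OF M] coset_plus[OF N] coset_add[OF N MN fun_subspaceD(1)[OF M]])
next
  fix c X assume "X \<in> quot Z M"
  then show "quot_map M (fscale c) X + N = quot_map N (fscale c) (X + N)"
    by (auto simp: quot_def quot_map_scale[OF M] quot_map_scale[OF N] coset_add[OF N MN fun_subspaceD(1)[OF M]])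
qed

section \<open>Cochains\<close>

declare yd_pow.simps [simp del]

lemma tpow_cong:
  assumes "carrier V = carrier V'" "smul V = smul V'"
  shows "tpow V n = tpow V' n" "words V n = words V' n" "wtens V n = wtens V' n"
proof -
  have w: "words V n = words V' n" for n using assms by (simp add: words_def)
  have "multilin_forms V n = multilin_forms V' n"
    unfolding multilin_forms_def multilin_map_def w lin_map_cong'[OF assms refl refl] by simp
  then show "tpow V n = tpow V' n" "words V n = words V' n" "wtens V n = wtens V' n"
    by (simp_all add: tpow_def wtens_def fun_eq_iff w)
qed

lemma (in hopf_alg) yd_morphism_iff:
  assumes V: "yd_mod H V \<alpha> \<delta>" and W: "vecsp W"
    and X: "carrier X = carrier V" "smul X = smul V"
      "\<And>x v. x \<in> carrier H \<Longrightarrow> v \<in> carrier V \<Longrightarrow> act X x v = \<alpha> x v"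
      "\<And>v. v \<in> carrier V \<Longrightarrow> coact X v = \<delta> v"
    and Y: "carrier Y = carrier W" "smul Y = smul W" "act Y = \<beta>" "coact Y = \<gamma>"
  shows "yd_morphism H X Y f \<longleftrightarrow> yd_hom H V \<alpha> \<delta> W \<beta> \<gamma> f"
proof -
  interpret yd_mod H V \<alpha> \<delta> by fact
  have lm: "lin_map X Y = lin_map V W" by (rule lin_map_cong') (use X Y in auto)
  have T: "tensor H Y = tensor H W" "tens H Y = tens H W" by (rule tensor_cong; rule refl Y)+
  have L: "tlift H X (tensor H W) = tlift H V (tensor H W)"
    by (rule tlift_cong; rule refl X)
  have "tlift H V (tensor H W) (\<lambda>(a, x). tens H W a (f x)) (\<delta> v) = sw H V (\<delta> v) (\<lambda>a x. tens H W a (f x))"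
    if "lin_map V W f" "v \<in> carrier V" for v
    by (assumption | rule sweq that W lin_comp[OF that(1)] lin_map_in[OF that(1)] lin refl)+
  then show ?thesis
    unfolding yd_morphism_def yd_hom_def lm T L Y X(1) by (auto simp: X)
qed

locale yd_bialg = hopf_alg H for H :: "('k::field, 'h::ab_group_add) hopf" +
  fixes B :: "('k, 'b::ab_group_add, 'h) yd_bialg"
  assumes B: "yd_bialgebra H B"
begin

abbreviation "P n \<equiv> tpow B n"
abbreviation "actn n \<equiv> act (yd_pow H (yd_of B) n)"
abbreviation "coactn n \<equiv> coact (yd_pow H (yd_of B) n)"

lemma yd_of_simps: "carrier (yd_of B) = carrier B" "smul (yd_of B) = smul B"
  "act (yd_of B) = bact B" "coact (yd_of B) = bcoact B"
  by (simp_all add: yd_of_def)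

lemmas tpow_yd_of = tpow_cong[OF yd_of_simps(1,2)]

sublocale B: yd_mod_powers H "yd_of B"
proof -
  have "yd_mod H (yd_of B) (act (yd_of B)) (coact (yd_of B))"
    by (rule yd_mod_of_yd_module) (use B in \<open>simp add: yd_bialgebra_def\<close>)
  then show "yd_mod_powers H (yd_of B)" by (rule yd_mod_powers.intro)
qed

lemma vecsp_B: "vecsp B"
  using B by (simp add: yd_bialgebra_def algebra_def)

lemma yd_mod_P: "yd_mod H (P n) (actn n) (coactn n)"
  using B.yd_mod_pow[of n] unfolding tpow_yd_of .

sublocale P: yd_mod H "P n" "actn n" "coactn n" for n
  by (rule yd_mod_P)

lemma counit_hom:
  "yd_hom H (yd_of B) (act (yd_of B)) (coact (yd_of B)) ground (\<lambda>x c. \<epsilon> x * c) (tens H ground \<one>) (counit B)"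
proof -
  have "yd_morphism H (yd_of B) (yd_unit H) (counit B)" using B by (simp add: yd_bialgebra_def)
  then show ?thesis
    by (subst (asm) yd_morphism_iff[OF B.yd_mod_axioms vecsp_ground])
      (simp_all add: yd_unit_def)
qed

lemma mult_hom:
  defines "V \<equiv> yd_of B" and "M \<equiv> tlift B B B (\<lambda>(x, y). mul B x y)"
  shows "yd_hom H (tensor V V) (tact H V (act V) V (act V)) (tcoact H V (coact V) V (coact V)) V (act V) (coact V) M"
    and "u \<in> carrier B \<Longrightarrow> v \<in> carrier B \<Longrightarrow> M (tens V V u v) = mul B u v"
proof -
  interpret VV: yd_mod_pair H V "act V" "coact V" V "act V" "coact V"
    unfolding V_def by (intro yd_mod_pair.intro hopf_alg_axioms B.yd_mod_axioms)
  have "yd_morphism H (yd_tensor H V V) V M"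
    using B by (simp add: yd_bialgebra_def V_def M_def)
  then show "yd_hom H (tensor V V) (tact H V (act V) V (act V)) (tcoact H V (coact V) V (coact V)) V (act V) (coact V) M"
    by (subst (asm) yd_morphism_iff[OF VV.yd_mod_tensor VV.V.vecsp_V])
      (simp_all add: VV.yd_tensor_eq)
  have T: "tens V V = tens B B" unfolding V_def by (rule tensor_cong; rule yd_of_simps)
  show "u \<in> carrier B \<Longrightarrow> v \<in> carrier B \<Longrightarrow> M (tens V V u v) = mul B u v"
    unfolding T M_def by (subst tensor_universal(2)) (use B in \<open>auto simp: yd_bialgebra_def algebra_def\<close>)
qed

text \<open>The face maps apply the counit to the first or the last tensor factor, or multiply two
  neighbours. They are morphisms because the counit and the multiplication of \<open>B\<close> are.\<close>

lemma hoch_diff_faces: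
  "\<exists>F. (\<forall>i\<le>Suc n. yd_hom H (P (Suc n)) (actn (Suc n)) (coactn (Suc n)) (P n) (actn n) (coactn n) (F i)) \<and>
    (\<forall>f\<in>cochains B n. hoch_diff B n f = restr (P (Suc n)) (\<lambda>z. \<Sum>i\<le>Suc n. (-1) ^ i * f (F i z)))"
proof -
  let ?hom = "yd_hom H (P (Suc n)) (actn (Suc n)) (coactn (Suc n)) (P n) (actn n) (coactn n)"
  let ?w = "wtens B (Suc n)"
  obtain F0 where F0: "?hom F0" "\<And>vs. vs \<in> words B (Suc n) \<Longrightarrow> F0 (?w vs) = fscale (counit B (hd vs)) (wtens B n (tl vs))"
    using B.counit_face_first[OF counit_hom, of n] unfolding tpow_yd_of smul_tensor by blast
  obtain Fl where Fl: "?hom Fl" "\<And>vs. vs \<in> words B (Suc n) \<Longrightarrow> Fl (?w vs) = fscale (counit B (last vs)) (wtens B n (butlast vs))"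
    using B.counit_face_last[OF counit_hom, of n] unfolding tpow_yd_of smul_tensor by blast
  have "\<exists>F. ?hom F \<and> (\<forall>vs\<in>words B (Suc n). F (?w vs) =
      wtens B n (take i vs @ mul B (vs ! i) (vs ! Suc i) # drop (Suc (Suc i)) vs))" if i: "i < n" for i
  proof -
    let ?m = "\<lambda>u v. tlift B B B (\<lambda>(x, y). mul B x y) (tens (yd_of B) (yd_of B) u v)"
    obtain F where F: "?hom F" "\<And>vs. vs \<in> words B (Suc n) \<Longrightarrow> F (?w vs) =
        wtens B n (take i vs @ ?m (vs ! i) (vs ! Suc i) # drop (Suc (Suc i)) vs)"
      using B.mult_face[OF mult_hom(1) i] unfolding tpow_yd_of by blast
    have "?m (vs ! i) (vs ! Suc i) = mul B (vs ! i) (vs ! Suc i)" if "vs \<in> words B (Suc n)" for vs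
      using that i by (intro mult_hom(2)) (auto simp: words_def intro!: subsetD[OF _ nth_mem])
    with F show ?thesis by (intro exI[of _ F]) simp
  qed
  then have "\<forall>i. \<exists>F. i < n \<longrightarrow> ?hom F \<and> (\<forall>vs\<in>words B (Suc n). F (?w vs) =
      wtens B n (take i vs @ mul B (vs ! i) (vs ! Suc i) # drop (Suc (Suc i)) vs))" by blast
  from choice[OF this] obtain Fm where Fm: "\<And>i. i < n \<Longrightarrow> ?hom (Fm i)" "\<And>i vs. i < n \<Longrightarrow> vs \<in> words B (Suc n) \<Longrightarrow>
      Fm i (?w vs) = wtens B n (take i vs @ mul B (vs ! i) (vs ! Suc i) # drop (Suc (Suc i)) vs)"
    by blast
  define F where "F i = (case i of 0 \<Rightarrow> F0 | Suc j \<Rightarrow> if j < n then Fm j else Fl)" for i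
  have hom: "?hom (F i)" for i using F0(1) Fl(1) Fm(1) by (simp add: F_def split: nat.split)
  have "hoch_diff B n f = restr (P (Suc n)) (\<lambda>z. \<Sum>i\<le>Suc n. (-1) ^ i * f (F i z))"
    if f: "f \<in> cochains B n" for f
    unfolding hoch_diff_def
  proof (rule restr_cong, rule wlift_eqI[OF vecsp_B])
    have f': "lin_map (P n) ground f" using f by (simp add: cochains_def dual_D)
    show "lin_map (P (Suc n)) ground (\<lambda>z. \<Sum>i\<le>Suc n. (-1) ^ i * f (F i z))"
      by (intro lin_sum lin_mult_r lin_comp[OF f'] yd_homD(1)[OF hom] vecsp_ground)
    fix vs assume vs: "vs \<in> words B (Suc n)"
    have mem: "wtens B n (tl vs) \<in> carrier (P n)" "wtens B n (butlast vs) \<in> carrier (P n)"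
      using vs by (cases vs; force simp: words_def intro!: wtens_in dest: in_set_butlastD split: if_splits)+
    note sc = lin_map_smul[OF f', simplified]
    have "(\<Sum>i\<le>Suc n. (-1) ^ i * f (F i (?w vs))) =
      f (F0 (?w vs)) + ((\<Sum>i<n. (-1) ^ Suc i * f (Fm i (?w vs))) + (-1) ^ Suc n * f (Fl (?w vs)))"
    proof -
      have "(\<Sum>i\<le>Suc n. g i) = g 0 + ((\<Sum>i<n. g (Suc i)) + g (Suc n))" for g :: "nat \<Rightarrow> 'k"
        by (subst sum.atMost_Suc_shift) (simp flip: lessThan_Suc_atMost)
      from this[of "\<lambda>i. (-1) ^ i * f (F i (?w vs))"] show ?thesis by (simp add: F_def)
    qed
    then show "counit B (hd vs) * f (wtens B n (tl vs)) +
          (\<Sum>i<n. (-1) ^ Suc i * f (wtens B n (take i vs @ mul B (vs ! i) (vs ! Suc i) # drop (Suc (Suc i)) vs))) +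
          (-1) ^ Suc n * f (wtens B n (butlast vs)) * counit B (last vs) =
        (\<Sum>i\<le>Suc n. (-1) ^ i * f (F i (?w vs)))"
      using vs by (simp add: F0(2) Fl(2) Fm(2) sc mem algebra_simps)
  qed simp_all
  with hom show ?thesis by blast
qed

abbreviation "C n \<equiv> dual (P n)"

lemma cochains_eq: "cochains B n = carrier (C n)"
  by (simp add: cochains_def)

lemma D_ract_eq:
  assumes "d \<in> carrier DD"
  shows "D_ract H B n f d = restr (P n) (\<lambda>z. f (P.dact n d z))"
  unfolding D_ract_def form_ract_def
proof (rule restr_cong)
  fix z assume z: "z \<in> carrier (P n)"
  have "double_act H (yd_pow H (yd_of B) n) d z = P.dact n d z"
    by (rule P.double_act_eq) (simp_all add: tpow_yd_of assms z)
  then show "f (double_act H (yd_pow H (yd_of B) n) d z) = f (P.dact n d z)" by simp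
qed

abbreviation "R n f d \<equiv> restr (P n) (\<lambda>z. f (P.dact n d z))"

lemma bil_R: "bil (C n) DD (C n) (R n)"
proof -
  have "bil (C n) DD (C n) (\<lambda>f d. restr (P n) (\<lambda>z. ev f (P.dact n d z)))"
    by (assumption | rule lin)+
  then show ?thesis by (simp add: ev_def)
qed

lemma R_in: "f \<in> carrier (C n) \<Longrightarrow> d \<in> carrier DD \<Longrightarrow> R n f d \<in> carrier (C n)"
  by (rule bil_in[OF bil_R])

lemma R_mul:
  assumes "f \<in> carrier (C n)" "d \<in> carrier DD" "e \<in> carrier DD"
  shows "R n f (dmul d e) = R n (R n f d) e"
proof (rule restr_cong)
  fix z assume z: "z \<in> carrier (P n)"
  have "P.dact n e z \<in> carrier (P n)" by (assumption | rule z assms lin)+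
  then show "f (P.dact n (dmul d e) z) = R n f d (P.dact n e z)"
    using z assms by (simp add: restr_apply P.dact_mul)
qed

lemma R_one:
  assumes "f \<in> carrier (C n)"
  shows "R n f (tens (dual H) H (restr H \<epsilon>) \<one>) = f"
  by (rule dual_eqI[OF R_in assms]) (rule assms double_unt_in | simp add: restr_apply P.dact_one)+

lemma lin_diff: "lin_map (C n) (C (Suc n)) (hoch_diff B n)"
proof -
  obtain F where F: "\<And>i. i \<le> Suc n \<Longrightarrow> yd_hom H (P (Suc n)) (actn (Suc n)) (coactn (Suc n)) (P n) (actn n) (coactn n) (F i)"
    and eq: "\<And>f. f \<in> cochains B n \<Longrightarrow> hoch_diff B n f = restr (P (Suc n)) (\<lambda>z. \<Sum>i\<le>Suc n. (-1) ^ i * f (F i z))"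
    using hoch_diff_faces[of n] by blast
  have "lin_map (C n) (C (Suc n)) (\<lambda>f. restr (P (Suc n)) (\<lambda>z. \<Sum>i\<le>Suc n. (-1) ^ i * f (F i z)))"
  proof (rule lin_restr)
    fix f assume "f \<in> carrier (C n)"
    then have f: "lin_map (P n) ground f" by (rule dual_D)
    show "lin_map (P (Suc n)) ground (\<lambda>z. \<Sum>i\<le>Suc n. (-1) ^ i * f (F i z))"
      by (intro lin_sum lin_mult_r lin_comp[OF f] yd_homD(1)[OF F] vecsp_ground) auto
  qed (intro lin_sum lin_mult_r lin_dual_eval vecsp_ground vecsp_tpow)+
  then show ?thesis by (rule lin_map_cong) (simp_all add: eq cochains_eq)
qed

text \<open>The face maps commute with the action of \<open>D(H)\<close>, being morphisms.\<close>

lemma diff_R: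
  assumes f: "f \<in> carrier (C n)" and d: "d \<in> carrier DD"
  shows "hoch_diff B n (R n f d) = R (Suc n) (hoch_diff B n f) d"
proof -
  obtain F where F: "\<And>i. i \<le> Suc n \<Longrightarrow> yd_hom H (P (Suc n)) (actn (Suc n)) (coactn (Suc n)) (P n) (actn n) (coactn n) (F i)"
    and eq: "\<And>f. f \<in> cochains B n \<Longrightarrow> hoch_diff B n f = restr (P (Suc n)) (\<lambda>z. \<Sum>i\<le>Suc n. (-1) ^ i * f (F i z))"
    using hoch_diff_faces[of n] by blast
  have "hoch_diff B n (R n f d) = restr (P (Suc n)) (\<lambda>z. \<Sum>i\<le>Suc n. (-1) ^ i * R n f d (F i z))"
    by (rule eq) (simp add: cochains_eq R_in f d)
  also have "\<dots> = R (Suc n) (hoch_diff B n f) d"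
  proof (rule restr_cong)
    fix z assume z: "z \<in> carrier (P (Suc n))"
    have dz: "P.dact (Suc n) d z \<in> carrier (P (Suc n))" by (assumption | rule z d lin)+
    have "(-1) ^ i * R n f d (F i z) = (-1) ^ i * f (F i (P.dact (Suc n) d z))" if "i \<le> Suc n" for i
      using lin_map_in[OF yd_homD(1)[OF F[OF that]] z] P.hom_dact[OF F[OF that] yd_mod_P d z]
      by (simp add: restr_apply)
    then have "(\<Sum>i\<le>Suc n. (-1) ^ i * R n f d (F i z)) = (\<Sum>i\<le>Suc n. (-1) ^ i * f (F i (P.dact (Suc n) d z)))" (is "?l = _")
      by (intro sum.cong) simp_all
    also have "\<dots> = hoch_diff B n f (P.dact (Suc n) d z)"
      using f dz by (simp only: eq cochains_eq restr_apply)
    finally show "?l = hoch_diff B n f (P.dact (Suc n) d z)" .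
  qed
  finally show ?thesis .
qed

lemma yd_cochains_iff:
  "f \<in> yd_cochains H B n \<longleftrightarrow> f \<in> carrier (C n) \<and> (\<forall>d\<in>carrier DD. R n f d = fscale (dcounit d) f)"
proof -
  have "yd_morphism H (yd_pow H (yd_of B) n) (yd_unit H) f \<longleftrightarrow> (\<forall>d\<in>carrier DD. R n f d = fscale (dcounit d) f)"
    if f: "f \<in> carrier (C n)"
  proof -
    have "yd_morphism H (yd_pow H (yd_of B) n) (yd_unit H) f \<longleftrightarrow>
      yd_hom H (P n) (actn n) (coactn n) ground (\<lambda>x c. \<epsilon> x * c) (tens H ground \<one>) f"
      by (rule yd_morphism_iff[OF yd_mod_P vecsp_ground]) (simp_all add: yd_unit_def tpow_yd_of)
    also have "\<dots> \<longleftrightarrow> (\<forall>d\<in>carrier DD. \<forall>z\<in>carrier (P n). f (P.dact n d z) = dcounit d * f z)"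
      by (rule P.hom_ground_iff[OF dual_D(1)[OF f]])
    also have "\<dots> \<longleftrightarrow> (\<forall>d\<in>carrier DD. R n f d = fscale (dcounit d) f)"
      using dual_D(2)[OF f] by (force simp: fun_eq_iff restr_def fscale_def)
    finally show ?thesis .
  qed
  then show ?thesis by (auto simp: yd_cochains_def cochains_eq)
qed

lemma D_invariants_iff:
  assumes X: "X \<subseteq> carrier (C n)"
  shows "invariants (drinfeld_double H) (form_lact (drinfeld_double H)) (D_ract H B n) X = X \<inter> yd_cochains H B n"
  using X by (auto simp: invariants_def yd_cochains_iff double_simps D_ract_eq form_lact_def double_counit)

lemma fun_subspace_iff: "module.subspace fscale N \<longleftrightarrow> fun_subspace N"
proof -
  interpret F: vector_space fscale by (rule vector_space_fscale)
  show ?thesis by (simp add: F.subspace_def fun_subspace_def)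
qed

lemma fun_subspace_C: "fun_subspace (carrier (C n))"
  using vecsp_subspace[OF vecsp_dual] by (simp add: fun_subspace_iff)

lemma fun_subspace_yd: "fun_subspace (yd_cochains H B n)"
  unfolding fun_subspace_def
proof (intro conjI ballI allI)
  have L: "lin_map (C n) (C n) (\<lambda>f. R n f d)" if "d \<in> carrier DD" for d
    by (rule bil_l[OF bil_R that lin_id])
  note C = fun_subspaceD[OF fun_subspace_C]
  show "0 \<in> yd_cochains H B n"
    using C(1) lin_map_zero[OF L vecsp_dual vecsp_dual] by (simp add: yd_cochains_iff fscale_def fun_eq_iff)
  fix f g assume f: "f \<in> yd_cochains H B n"
  show "f + g \<in> yd_cochains H B n" if g: "g \<in> yd_cochains H B n"
    using f g C(2) lin_map_add[OF L] by (auto simp: yd_cochains_iff fscale_def fun_eq_iff algebra_simps)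
  show "fscale c f \<in> yd_cochains H B n" for c
    using f C(3) lin_map_smul[OF L] by (auto simp: yd_cochains_iff fscale_def fun_eq_iff algebra_simps)
qed

lemma fun_subspace_kernel:
  assumes "fun_subspace X" "X \<subseteq> carrier (C n)"
  shows "fun_subspace {f \<in> X. hoch_diff B n f = 0}"
  using fun_subspaceD(1-3)[OF assms(1)] assms(2) lin_map_zero[OF lin_diff vecsp_dual vecsp_dual, of n]
    lin_map_add[OF lin_diff, of _ n] lin_map_smul[OF lin_diff, of _ n]
  by (auto simp: fun_subspace_def subset_iff) (auto simp: fscale_def fun_eq_iff)

lemma fun_subspace_image:
  assumes X: "fun_subspace X" "X \<subseteq> carrier (C n)"
  shows "fun_subspace (hoch_diff B n ` X)"
  unfolding fun_subspace_def
proof (intro conjI ballI allI)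
  show "0 \<in> hoch_diff B n ` X"
    using fun_subspaceD(1)[OF X(1)] lin_map_zero[OF lin_diff vecsp_dual vecsp_dual, of n] by (metis imageI)
  fix x y assume x: "x \<in> hoch_diff B n ` X"
  show "x + y \<in> hoch_diff B n ` X" if y: "y \<in> hoch_diff B n ` X"
  proof -
    obtain f g where "x = hoch_diff B n f" "y = hoch_diff B n g" "f \<in> X" "g \<in> X" using x y by auto
    then show ?thesis using lin_map_add[OF lin_diff, of f n g] X fun_subspaceD(2)[OF X(1)]
      by (intro image_eqI[of _ _ "f + g"]) (auto simp: subset_iff)
  qed
  show "fscale c x \<in> hoch_diff B n ` X" for c
  proof -
    obtain f where "x = hoch_diff B n f" "f \<in> X" using x by auto
    then show ?thesis using lin_map_smul[OF lin_diff, of f n c] X fun_subspaceD(3)[OF X(1)]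
      by (intro image_eqI[of _ _ "fscale c f"]) (auto simp: subset_iff)
  qed
qed

lemma yd_sub: "yd_cochains H B n \<subseteq> carrier (C n)"
  by (auto simp: yd_cochains_iff)

lemma fun_subspace_0: "fun_subspace {0 :: 'x \<Rightarrow> 'k}"
  by (auto simp: fun_subspace_def fscale_def fun_eq_iff)

lemma cocycles_props:
  "fun_subspace (HZ B n)" "HZ B n \<subseteq> carrier (C n)" "fun_subspace (HZ_YD H B n)" "HZ_YD H B n = HZ B n \<inter> yd_cochains H B n"
  using fun_subspace_kernel[OF fun_subspace_C] fun_subspace_kernel[OF fun_subspace_yd yd_sub] yd_sub[of n]
  by (auto simp: cocycles_def cochains_eq)

lemma coboundaries_props: "fun_subspace (HB B n)" "HB B n \<subseteq> carrier (C n)" "fun_subspace (HB_YD H B n)"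
  using fun_subspace_image[OF fun_subspace_C] fun_subspace_image[OF fun_subspace_yd yd_sub] fun_subspaceD(1)[OF fun_subspace_C, of n] lin_map_in[OF lin_diff]
  by (auto simp: coboundaries_def cochains_eq fun_subspace_0 split: nat.splits)

lemma R_HZ:
  assumes f: "f \<in> HZ B n" and d: "d \<in> carrier DD"
  shows "R n f d \<in> HZ B n"
proof -
  have "R (Suc n) 0 d = 0" by (auto simp: restr_def fun_eq_iff)
  then show ?thesis
    using f d diff_R[of f n d] R_in[of f n d] by (auto simp: cocycles_def cochains_eq)
qed

lemma R_HB:
  assumes f: "f \<in> HB B n" and d: "d \<in> carrier DD"
  shows "R n f d \<in> HB B n"
proof (cases n)
  case 0
  then show ?thesis using f by (auto simp: coboundaries_def restr_def fun_eq_iff)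
next
  case (Suc m)
  then obtain g where g: "g \<in> carrier (C m)" "f = hoch_diff B m g"
    using f by (auto simp: coboundaries_def cochains_eq)
  then have "R n f d = hoch_diff B m (R m g d)" using diff_R[OF g(1) d] unfolding Suc by simp
  then show ?thesis
    using R_in[OF g(1) d] unfolding Suc coboundaries_def nat.case cochains_eq by (rule image_eqI)
qed

lemma bimodule_C:
  "bimodule (drinfeld_double H) (C n) (form_lact (drinfeld_double H)) (D_ract H B n)"
  unfolding bimodule_def
proof (intro conjI ballI)
  have lm: "lin_map (drinfeld_double H) X = lin_map DD X" for X :: "('k, 'x::ab_group_add) vecsp"
    by (rule lin_map_cong') (simp_all add: double_simps)
  have lact: "form_lact dbl d f = smul (C n) (dcounit d) f" if "d \<in> carrier DD" for d f
    using that by (simp add: form_lact_def double_counit)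
  have L: "bil DD (C n) (C n) (\<lambda>d f. smul (C n) (dcounit d) f)"
    by (assumption | rule lin)+
  show "bil dbl (C n) (C n) (form_lact dbl)"
    unfolding bilin_map_def split lm double_simps
  proof (intro conjI ballI)
    show "lin_map (C n) (C n) (\<lambda>f. form_lact dbl d f)" if "d \<in> carrier DD" for d
      by (rule lin_map_cong[OF bil_r[OF L that lin_id]]) (simp_all add: lact that)
    show "lin_map DD (C n) (\<lambda>d. form_lact dbl d f)" if "f \<in> carrier (C n)" for f
      by (rule lin_map_cong[OF bil_l[OF L that lin_id]]) (simp_all add: lact)
  qed
  show "bil (C n) dbl (C n) (D_ract H B n)"
    unfolding bilin_map_def split lm double_simps
  proof (intro conjI ballI)
    show "lin_map DD (C n) (\<lambda>d. D_ract H B n f d)" if "f \<in> carrier (C n)" for f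
      by (rule lin_map_cong[OF bil_r[OF bil_R that lin_id]]) (simp_all add: D_ract_eq)
    show "lin_map (C n) (C n) (\<lambda>f. D_ract H B n f d)" if "d \<in> carrier DD" for d
      by (rule lin_map_cong[OF bil_l[OF bil_R that lin_id]]) (simp_all add: D_ract_eq that)
  qed
  show "vecsp (C n)" by simp
  fix f assume f: "f \<in> carrier (C n)"
  show "form_lact dbl (unt dbl) f = f" "D_ract H B n f (unt dbl) = f"
    using R_one[OF f] by (simp_all add: double_simps lact D_ract_eq double_unt_in dcounit_unt fscale_def)
  fix d e assume "d \<in> carrier dbl" "e \<in> carrier dbl"
  then have d: "d \<in> carrier DD" and e: "e \<in> carrier DD" by (simp_all add: double_simps)
  have de: "dmul d e \<in> carrier DD" by (rule bil_in[OF bil_dmul d e])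
  show "form_lact dbl (mul dbl d e) f = form_lact dbl d (form_lact dbl e f)"
    using d e de by (simp add: lact double_mul dcounit_mul fscale_def mult.assoc)
  show "D_ract H B n f (mul dbl d e) = D_ract H B n (D_ract H B n f d) e"
    using d e de by (simp add: D_ract_eq double_mul R_mul[OF f])
  show "D_ract H B n (form_lact dbl d f) e = form_lact dbl d (D_ract H B n f e)"
    using lin_map_smul[OF bil_l[OF bil_R e lin_id] f, of "dcounit d"] d e by (simp add: lact D_ract_eq)
qed

lemma sub_bimoduleI:
  assumes "fun_subspace Y" "Y \<subseteq> carrier (C n)" "\<And>f d. f \<in> Y \<Longrightarrow> d \<in> carrier DD \<Longrightarrow> R n f d \<in> Y"
  shows "sub_bimodule (drinfeld_double H) (C n) (form_lact (drinfeld_double H)) (D_ract H B n) Y"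
  unfolding sub_bimodule_def
  using assms fun_subspaceD(3)[OF assms(1)] by (auto simp: bimodule_C fun_subspace_iff double_simps D_ract_eq form_lact_def)

lemma HH_invariants_D_iff:
  "X \<in> HH_invariants (drinfeld_double H) B n (D_ract H B n) \<longleftrightarrow>
    (\<exists>z\<in>HZ B n. X = z +o HB B n \<and> (\<forall>d\<in>carrier DD. fscale (dcounit d) z +o HB B n = R n z d +o HB B n))"
proof -
  note N = coboundaries_props(1)[of n]
  have quot_R: "quot_map (HB B n) (\<lambda>f. D_ract H B n f d) (z +o HB B n) = R n z d +o HB B n"
    if z: "z \<in> HZ B n" and d: "d \<in> carrier DD" for z d
  proof -
    have zC: "z \<in> carrier (C n)" using z cocycles_props(2) by blast
    have "quot_map (HB B n) (\<lambda>f. R n f d) (z +o HB B n) = R n z d +o HB B n"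
      using R_HB[OF _ d] coboundaries_props(2)[of n] lin_map_add[OF bil_l[OF bil_R d lin_id] zC]
        lin_map_zero[OF bil_l[OF bil_R d lin_id, of n] vecsp_dual vecsp_dual]
      by (intro quot_map_coset[OF N]) (auto simp: subset_iff)
    then show ?thesis using d by (simp add: D_ract_eq)
  qed
  have "X \<in> HH_invariants dbl B n (D_ract H B n) \<longleftrightarrow> X \<in> HH B n \<and>
    (\<forall>d\<in>carrier DD. quot_map (HB B n) (fscale (dcounit d)) X = quot_map (HB B n) (\<lambda>f. D_ract H B n f d) X)"
    by (auto simp: HH_invariants_def invariants_def double_simps form_lact_def[abs_def] double_counit)
  also have "\<dots> \<longleftrightarrow> (\<exists>z\<in>HZ B n. X = z +o HB B n \<and> (\<forall>d\<in>carrier DD. fscale (dcounit d) z +o HB B n = R n z d +o HB B n))"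
    unfolding cohomology_def quot_def
    by (auto simp: quot_map_scale[OF N] quot_R)
  finally show ?thesis .
qed

text \<open>The element \<open>h \<in> H\<close> acts on cochains as \<open>\<epsilon> \<otimes> h \<in> D(H)\<close> does, and the counits agree.\<close>

lemma HH_invariants_D_H:
  "HH_invariants (drinfeld_double H) B n (D_ract H B n) \<subseteq> HH_invariants H B n (H_ract H B n)"
proof
  fix X assume X: "X \<in> HH_invariants (drinfeld_double H) B n (D_ract H B n)"
  have "quot_map (HB B n) (form_lact H h) X = quot_map (HB B n) (\<lambda>f. H_ract H B n f h) X"
    if h: "h \<in> carrier H" for h
  proof -
    let ?d = "tens (dual H) H (restr H \<epsilon>) h"
    have d: "?d \<in> carrier DD" "restr H \<epsilon> \<in> carrier (dual H)" by (assumption | rule h lin)+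
    have "(form_lact H h :: (('k, 'b list) tens \<Rightarrow> 'k) \<Rightarrow> _) = form_lact dbl ?d"
      using h d by (simp add: form_lact_def fun_eq_iff double_counit dcounit_tens ev_restr unt_in counit_unt)
    moreover have "H_ract H B n f h = D_ract H B n f ?d" for f
      unfolding D_ract_eq[OF d(1)] H_ract_def form_ract_def
      by (rule restr_cong) (simp add: P.dact_H h)
    moreover have "quot_map (HB B n) (form_lact dbl ?d) X = quot_map (HB B n) (\<lambda>f. D_ract H B n f ?d) X"
      using X d(1) by (simp add: HH_invariants_def invariants_def double_simps)
    ultimately show ?thesis by simp
  qed
  moreover have "X \<in> HH B n" using X by (simp add: HH_invariants_def invariants_def)
  ultimately show "X \<in> HH_invariants H B n (H_ract H B n)"
    by (simp add: HH_invariants_def invariants_def)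
qed

end

section \<open>Averaging over the Drinfeld double\<close>

locale yd_bialg_semisimple = yd_bialg H B for H :: "('k::field, 'h::ab_group_add) hopf"
    and B :: "('k, 'b::ab_group_add, 'h) yd_bialg" +
  assumes ss: "semisimple_algebra H" and css: "cosemisimple_coalgebra H"
begin

text \<open>The integral \<open>l \<otimes> t\<close> of \<open>D(H)\<close>, with \<open>t\<close> from semisimplicity and \<open>l\<close> from cosemisimplicity.\<close>

lemma averaging_element:
  "\<exists>L. L \<in> carrier DD \<and> dcounit L = 1 \<and> (\<forall>d\<in>carrier DD. dmul L d = fscale (dcounit d) L)"
proof -
  obtain t where t: "two_sided_integral t" using two_sided_integral_exists[OF ss] by blast
  obtain l where l: "two_sided_cointegral l" using two_sided_cointegral_exists[OF css] by blast
  interpret hopf_cointegral H l by unfold_locales fact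
  show ?thesis using double_integral[OF t] by auto
qed

definition avg where
  "avg = (SOME L. L \<in> carrier DD \<and> dcounit L = 1 \<and> (\<forall>d\<in>carrier DD. dmul L d = fscale (dcounit d) L))"

lemma avg: "avg \<in> carrier DD" "dcounit avg = 1" "d \<in> carrier DD \<Longrightarrow> dmul avg d = fscale (dcounit d) avg"
  using someI_ex[OF averaging_element] by (auto simp: avg_def)

lemma R_avg:
  assumes f: "f \<in> carrier (C n)"
  shows "R n f avg \<in> yd_cochains H B n"
  unfolding yd_cochains_iff
proof (intro conjI ballI R_in f avg)
  fix d assume d: "d \<in> carrier DD"
  have "R n (R n f avg) d = R n f (fscale (dcounit d) avg)"
    using R_mul[OF f avg(1) d] avg(3)[OF d] by simp
  also have "\<dots> = fscale (dcounit d) (R n f avg)"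
    using lin_map_smul[OF bil_r[OF bil_R f lin_id] avg(1), of "dcounit d"] by simp
  finally show "R n (R n f avg) d = fscale (dcounit d) (R n f avg)" .
qed

lemma R_avg_id: "f \<in> yd_cochains H B n \<Longrightarrow> R n f avg = f"
  by (simp add: yd_cochains_iff avg fscale_def)

text \<open>If \<open>g = d f\<close> is invariant, then \<open>g = g \<Lambda> = (d f) \<Lambda> = d (f \<Lambda>)\<close> for the averaging element \<open>\<Lambda>\<close>, and \<open>f \<Lambda>\<close>
  is invariant.\<close>

lemma HB_YD_eq: "HB_YD H B n = HB B n \<inter> yd_cochains H B n"
proof (cases n)
  case 0
  then show ?thesis using fun_subspaceD(1)[OF fun_subspace_yd, of n] by (auto simp: coboundaries_def)
next
  case (Suc m)
  have "hoch_diff B m f \<in> yd_cochains H B (Suc m)" if f: "f \<in> yd_cochains H B m" for f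
    unfolding yd_cochains_iff
  proof (intro conjI ballI)
    have fC: "f \<in> carrier (C m)" using f yd_sub by blast
    then show "hoch_diff B m f \<in> carrier (C (Suc m))" by (rule lin_map_in[OF lin_diff])
    fix d assume d: "d \<in> carrier DD"
    have "R (Suc m) (hoch_diff B m f) d = hoch_diff B m (fscale (dcounit d) f)"
      using f d by (simp add: diff_R[OF fC d, symmetric] yd_cochains_iff)
    then show "R (Suc m) (hoch_diff B m f) d = fscale (dcounit d) (hoch_diff B m f)"
      using lin_map_smul[OF lin_diff fC, of "dcounit d"] by simp
  qed
  moreover have "g \<in> hoch_diff B m ` yd_cochains H B m"
    if g: "g \<in> yd_cochains H B (Suc m)" and f: "g = hoch_diff B m f" "f \<in> carrier (C m)" for f g
  proof -
    have "g = hoch_diff B m (R m f avg)"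
      using R_avg_id[OF g] diff_R[OF f(2) avg(1)] f(1) by simp
    then show ?thesis using R_avg[OF f(2)] by blast
  qed
  ultimately show ?thesis
    unfolding Suc coboundaries_def nat.case cochains_eq using yd_sub[of m] by blast
qed

text \<open>Invariance of the class of \<open>z\<close> under the averaging element \<open>\<Lambda>\<close> says that the cocycle \<open>z \<Lambda>\<close>, which is
  itself invariant, represents the same class.\<close>

lemma HH_invariants_eq:
  "HH_invariants (drinfeld_double H) B n (D_ract H B n) = (\<lambda>z. z +o HB B n) ` HZ_YD H B n"
proof (intro equalityI subsetI)
  fix X assume "X \<in> HH_invariants (drinfeld_double H) B n (D_ract H B n)"
  then obtain z where z: "z \<in> HZ B n" "X = z +o HB B n"
    "\<And>d. d \<in> carrier DD \<Longrightarrow> fscale (dcounit d) z +o HB B n = R n z d +o HB B n"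
    unfolding HH_invariants_D_iff by blast
  have "fscale (dcounit avg) z = z" by (simp add: avg fscale_def)
  then have "X = R n z avg +o HB B n" using z(2) z(3)[OF avg(1)] by simp
  moreover have "R n z avg \<in> HZ_YD H B n"
    unfolding cocycles_props(4) using R_HZ[OF z(1) avg(1)] R_avg z(1) cocycles_props(2) by blast
  ultimately show "X \<in> (\<lambda>z. z +o HB B n) ` HZ_YD H B n" by blast
next
  fix X assume "X \<in> (\<lambda>z. z +o HB B n) ` HZ_YD H B n"
  then show "X \<in> HH_invariants (drinfeld_double H) B n (D_ract H B n)"
    unfolding HH_invariants_D_iff cocycles_props(4) by (auto simp: yd_cochains_iff)
qed

end

theorem proposition4p7:
  fixes H :: "('k::field, 'h::ab_group_add) hopf"
    and B :: "('k, 'b::ab_group_add, 'h) yd_bialg"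
    and n :: nat
  assumes "hopf_algebra H" and "semisimple_algebra H" and "cosemisimple_coalgebra H"
    and "yd_bialgebra H B"
  shows "sub_bimodule (drinfeld_double H) (dual (tpow B n))
           (form_lact (drinfeld_double H)) (D_ract H B n) (HZ B n) \<and>
         sub_bimodule (drinfeld_double H) (dual (tpow B n))
           (form_lact (drinfeld_double H)) (D_ract H B n) (HB B n) \<and>
         HZ_YD H B n =
           invariants (drinfeld_double H) (form_lact (drinfeld_double H)) (D_ract H B n) (HZ B n) \<and>
         HB_YD H B n =
           invariants (drinfeld_double H) (form_lact (drinfeld_double H)) (D_ract H B n) (HB B n) \<and>
         quot_iso (HB_YD H B n) (HH_YD H B n)
           (HB B n) (HH_invariants (drinfeld_double H) B n (D_ract H B n)) \<and>
         HH_invariants (drinfeld_double H) B n (D_ract H B n) \<subseteq> HH_invariants H B n (H_ract H B n) \<and>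
         quot_subspace (HB B n) (HH_invariants (drinfeld_double H) B n (D_ract H B n))"
proof -
  interpret yd_bialg_semisimple H B
    by unfold_locales fact+
  note N = coboundaries_props[of n] and Z = cocycles_props[of n]
  show ?thesis
  proof (intro conjI)
    show "quot_iso (HB_YD H B n) (HH_YD H B n)
           (HB B n) (HH_invariants (drinfeld_double H) B n (D_ract H B n))"
      unfolding HH_invariants_eq cohomology_def
      by (rule quot_isoI) (use N Z HB_YD_eq in auto)
    show "quot_subspace (HB B n) (HH_invariants (drinfeld_double H) B n (D_ract H B n))"
      unfolding HH_invariants_eq by (rule quot_subspaceI) (use N Z in auto)
  qed (simp_all add: sub_bimoduleI R_HZ R_HB N Z D_invariants_iff HB_YD_eq HH_invariants_D_H)
qed

end
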